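(* There exists a deterministic polynomial-time one-way communication protocol that, given any $\varepsilon > 0$, computes a $(3/2+\varepsilon)$-approximation to the maximum matching of $G_A \cup G_B$ using $O\!\left(\frac{n \log(1/\varepsilon)}{\varepsilon^2}\right)$ communication from Alice to Bob.
   Context: One-way communication model for matching: there is a common vertex set $V$ with $|V| = n$. Alice holds a graph $G_A(V,E_A)$ and Bob holds a graph $G_B(V,E_B)$. Alice sends a single message to Bob, after which Bob must output a matching in the graph $G_A \cup G_B = (V, E_A \cup E_B)$. For a graph $G$, $\mu(G)$ denotes the size of a maximum matching of $G$. A protocol is a $(3/2+\varepsilon)$-approximation if the matching output by Bob always has size at least $\mu(G_A \cup G_B)/(3/2+\varepsilon)$. The communication is the length (in bits or, equivalently up to logarithmic factors, in edges, as used in the paper) of Alice's message. *)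

theory Defs
  imports
    Complex_Main
    "HOL-Library.Log_Nat"
    "HOL-Computational_Algebra.Polynomial"
begin

section \<open>Graphs and matchings\<close>

definition simple_graph :: "nat \<Rightarrow> nat set set \<Rightarrow> bool" where
  "simple_graph n E \<longleftrightarrow> E \<subseteq> {{u, v} | u v. u < n \<and> v < n \<and> u \<noteq> v}"

definition matching :: "nat set set \<Rightarrow> nat set set \<Rightarrow> bool" where
  "matching E M \<longleftrightarrow> M \<subseteq> E \<and> (\<forall>e\<in>M. \<forall>f\<in>M. e \<noteq> f \<longrightarrow> e \<inter> f = {})"

definition max_matching_size :: "nat set set \<Rightarrow> nat" where
  "max_matching_size E = Max (card ` {M. matching E M})"

definition edge_set :: "(nat \<times> nat) list \<Rightarrow> nat set set" where
  "edge_set es = (\<lambda>(u, v). {u, v}) ` set es"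

text \<open>An edge list presents a graph when every edge is listed exactly once, in one of its two
  orientations; the order of the list is arbitrary.\<close>

definition edge_list_of :: "(nat \<times> nat) list \<Rightarrow> nat set set \<Rightarrow> bool" where
  "edge_list_of es E \<longleftrightarrow> edge_set es = E \<and> distinct (map (\<lambda>(u, v). {u, v}) es)"


section \<open>The machine model: a deterministic while-language with step counting\<close>

text \<open>This is a structured random access machine. Every variable is an unbounded array of natural
  numbers, and a scalar is the entry at index 0 of an array. The only arithmetic is addition and
  truncated subtraction. Hence one step lengthens the stored numbers by at most a constant
  number of bits (the constant depending on the program), so that the unit-cost measure below is
  polynomially related to Turing machine time. This would fail with multiplication as a
  primitive.\<close>

type_synonym vname = string
type_synonym state = "vname \<Rightarrow> nat \<Rightarrow> nat"

datatype aexp = N nat | Get vname aexp | Plus aexp aexp | Minus aexp aexp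

datatype bexp = Less aexp aexp | Not bexp | And bexp bexp

datatype com =
    Skip
  | Put vname aexp aexp  \<comment> \<open>\<open>Put x i a\<close> is the array assignment \<open>x[i] := a\<close>\<close>
  | Seq com com
  | If bexp com com
  | While bexp com

fun aval :: "aexp \<Rightarrow> state \<Rightarrow> nat" where
  "aval (N k) s = k"
| "aval (Get x i) s = s x (aval i s)"
| "aval (Plus a b) s = aval a s + aval b s"
| "aval (Minus a b) s = aval a s - aval b s"

fun bval :: "bexp \<Rightarrow> state \<Rightarrow> bool" where
  "bval (Less a b) s \<longleftrightarrow> aval a s < aval b s"
| "bval (Not b) s \<longleftrightarrow> \<not> bval b s"
| "bval (And b c) s \<longleftrightarrow> bval b s \<and> bval c s"

text \<open>\<open>exec c s t s'\<close>: started in \<open>s\<close>, the program \<open>c\<close> halts in \<open>s'\<close> after exactly \<open>t\<close> steps.\<close>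

inductive exec :: "com \<Rightarrow> state \<Rightarrow> nat \<Rightarrow> state \<Rightarrow> bool" where
  Skip: "exec Skip s 1 s"
| Put: "exec (Put x i a) s 1 (s(x := (s x)(aval i s := aval a s)))"
| Seq: "exec c s t s' \<Longrightarrow> exec d s' u s'' \<Longrightarrow> exec (Seq c d) s (t + u) s''"
| IfTrue: "bval b s \<Longrightarrow> exec c s t s' \<Longrightarrow> exec (If b c d) s (1 + t) s'"
| IfFalse: "\<not> bval b s \<Longrightarrow> exec d s t s' \<Longrightarrow> exec (If b c d) s (1 + t) s'"
| WhileFalse: "\<not> bval b s \<Longrightarrow> exec (While b c) s 1 s"
| WhileTrue: "bval b s \<Longrightarrow> exec c s t s' \<Longrightarrow> exec (While b c) s' u s''
    \<Longrightarrow> exec (While b c) s (1 + t + u) s''"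

inductive_cases exec_SkipE: "exec Skip s t s'"
inductive_cases exec_PutE: "exec (Put x i a) s t s'"
inductive_cases exec_SeqE: "exec (Seq c d) s t s'"
inductive_cases exec_IfE: "exec (If b c d) s t s'"
inductive_cases exec_WhileE: "exec (While b c) s t s'"

lemma exec_deterministic:
  "exec c s t s' \<Longrightarrow> exec c s u s'' \<Longrightarrow> u = t \<and> s'' = s'"
proof (induction arbitrary: u s'' rule: exec.induct)
  case Skip
  then show ?case by (elim exec_SkipE) simp
next
  case Put
  then show ?case by (elim exec_PutE) simp
next
  case Seq
  from Seq.prems show ?case by (rule exec_SeqE) (metis Seq.IH)
next
  case IfTrue
  from IfTrue.prems show ?case by (rule exec_IfE) (auto dest: IfTrue.IH simp: IfTrue.hyps)
next
  case IfFalse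
  from IfFalse.prems show ?case by (rule exec_IfE) (auto dest: IfFalse.IH simp: IfFalse.hyps)
next
  case WhileFalse
  from WhileFalse.prems show ?case by (rule exec_WhileE) (auto simp: WhileFalse.hyps)
next
  case WhileTrue
  from WhileTrue.prems show ?case
    by (rule exec_WhileE) (auto dest!: WhileTrue.IH simp: WhileTrue.hyps)
qed


section \<open>One-way protocols\<close>

definition store :: "vname \<Rightarrow> nat \<Rightarrow> state \<Rightarrow> state" where
  "store x k s = s(x := (\<lambda>i. if i = 0 then k else 0))"

definition store_edges :: "vname \<Rightarrow> (nat \<times> nat) list \<Rightarrow> state \<Rightarrow> state" where
  "store_edges x es s = (store (x @ ''_len'') (length es) s)
     (x @ ''_fst'' := (\<lambda>i. if i < length es then fst (es ! i) else 0),
      x @ ''_snd'' := (\<lambda>i. if i < length es then snd (es ! i) else 0))"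

definition load_edges :: "vname \<Rightarrow> state \<Rightarrow> (nat \<times> nat) list" where
  "load_edges x s = map (\<lambda>i. (s (x @ ''_fst'') i, s (x @ ''_snd'') i)) [0..<s (x @ ''_len'') 0]"

text \<open>Both players know the number \<open>n\<close> of vertices and the accuracy parameter, given as a
  fraction \<open>p / q\<close>. Apart from that, Alice sees only her own edges, and Bob only his own edges
  and the message. All other memory is initially 0.\<close>

definition alice_input :: "nat \<Rightarrow> nat \<Rightarrow> nat \<Rightarrow> (nat \<times> nat) list \<Rightarrow> state" where
  "alice_input n p q as =
     store_edges ''edges'' as (store ''q'' q (store ''p'' p (store ''n'' n (\<lambda>_ _. 0))))"

definition bob_input ::
    "nat \<Rightarrow> nat \<Rightarrow> nat \<Rightarrow> (nat \<times> nat) list \<Rightarrow> (nat \<times> nat) list \<Rightarrow> state" where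
  "bob_input n p q bs msg =
     store_edges ''msg'' msg
       (store_edges ''edges'' bs (store ''q'' q (store ''p'' p (store ''n'' n (\<lambda>_ _. 0)))))"

text \<open>\<open>protocol_run A B n p q as bs tA msg tB out\<close>: Alice's program \<open>A\<close> sends \<open>msg\<close> after \<open>tA\<close>
  steps, whereupon Bob's program \<open>B\<close> outputs \<open>out\<close> after \<open>tB\<close> steps.\<close>

definition protocol_run ::
    "com \<Rightarrow> com \<Rightarrow> nat \<Rightarrow> nat \<Rightarrow> nat \<Rightarrow> (nat \<times> nat) list \<Rightarrow> (nat \<times> nat) list \<Rightarrow>
     nat \<Rightarrow> (nat \<times> nat) list \<Rightarrow> nat \<Rightarrow> (nat \<times> nat) list \<Rightarrow> bool" where
  "protocol_run A B n p q as bs tA msg tB out \<longleftrightarrow>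
     (\<exists>s. exec A (alice_input n p q as) tA s \<and> msg = load_edges ''out'' s) \<and>
     (\<exists>s. exec B (bob_input n p q bs msg) tB s \<and> out = load_edges ''out'' s)"

definition valid_input ::
    "nat \<Rightarrow> nat \<Rightarrow> nat \<Rightarrow> (nat \<times> nat) list \<Rightarrow> nat set set \<Rightarrow> bool" where
  "valid_input n p q es E \<longleftrightarrow> 0 < p \<and> 0 < q \<and> simple_graph n E \<and> edge_list_of es E"

text \<open>The fraction \<open>p / q\<close> contributes only the lengths of the binary representations of \<open>p\<close> and
  \<open>q\<close> to the input size, so the running time cannot depend polynomially on \<open>q / p\<close>.
  The same polynomial serves all accuracies.\<close>

definition input_size :: "nat \<Rightarrow> nat \<Rightarrow> nat \<Rightarrow> nat \<Rightarrow> nat" where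
  "input_size n p q m = n + floorlog 2 p + floorlog 2 q + m"

definition poly_time_protocol :: "com \<Rightarrow> com \<Rightarrow> bool" where
  "poly_time_protocol A B \<longleftrightarrow>
     (\<exists>T :: nat poly. \<forall>n p q as bs EA EB.
        valid_input n p q as EA \<longrightarrow> valid_input n p q bs EB \<longrightarrow>
        (\<exists>tA msg tB out. protocol_run A B n p q as bs tA msg tB out \<and>
           tA \<le> poly T (input_size n p q (length as)) \<and>
           tB \<le> poly T (input_size n p q (length bs + length msg))))"

text \<open>Communication is counted in edges: the message is a list of edges on the common vertex set,
  so each entry is worth \<open>2 \<lceil>log\<^sub>2 n\<rceil>\<close> bits. The accuracy parameter \<open>\<epsilon>\<close> may be any positive real;
  since a program needs finite data, it is handed any rational \<open>p / q\<close> in \<open>[\<epsilon> / 2, \<epsilon>]\<close>, the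
  value \<open>\<epsilon>\<close> itself being allowed when it is rational.

  As \<open>ln (1 / \<epsilon>)\<close> vanishes at \<open>\<epsilon> = 1\<close>, the bound \<open>O(n log(1/\<epsilon>)/\<epsilon>\<^sup>2)\<close> is meaningful only for
  \<open>\<epsilon>\<close> bounded away from 1. It is therefore read with \<open>\<epsilon>\<close> replaced by \<open>min \<epsilon> (1/2)\<close>: verbatim for
  \<open>\<epsilon> \<le> 1/2\<close>, and as \<open>O(n)\<close> beyond.\<close>

definition communication_bound :: "com \<Rightarrow> com \<Rightarrow> (nat \<Rightarrow> real \<Rightarrow> real) \<Rightarrow> bool" where
  "communication_bound A B f \<longleftrightarrow>
     (\<forall>(\<epsilon>::real) n p q as bs EA EB tA msg tB out.
        0 < \<epsilon> \<longrightarrow> \<epsilon> / 2 \<le> real p / real q \<longrightarrow> real p / real q \<le> \<epsilon> \<longrightarrow>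
        valid_input n p q as EA \<longrightarrow> valid_input n p q bs EB \<longrightarrow>
        protocol_run A B n p q as bs tA msg tB out \<longrightarrow>
        simple_graph n (edge_set msg) \<and> real (length msg) \<le> f n \<epsilon>)"

definition approximates_max_matching :: "com \<Rightarrow> com \<Rightarrow> (real \<Rightarrow> real) \<Rightarrow> bool" where
  "approximates_max_matching A B \<alpha> \<longleftrightarrow>
     (\<forall>(\<epsilon>::real) n p q as bs EA EB tA msg tB out.
        0 < \<epsilon> \<longrightarrow> \<epsilon> / 2 \<le> real p / real q \<longrightarrow> real p / real q \<le> \<epsilon> \<longrightarrow>
        valid_input n p q as EA \<longrightarrow> valid_input n p q bs EB \<longrightarrow>
        protocol_run A B n p q as bs tA msg tB out \<longrightarrow>
        (\<exists>M. edge_list_of out M \<and> matching (EA \<union> EB) M \<and>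
           real (card M) \<ge> real (max_matching_size (EA \<union> EB)) / \<alpha> \<epsilon>))"

end

theory Submission imports Defs begin

text \<open>
  Alice sends an edge degree constrained subgraph \<open>H\<close> of her graph: degree sums are at most \<open>\<beta>\<close> on the
  edges of \<open>H\<close> and at least \<open>\<beta> - 1\<close> on her other edges, with \<open>\<beta> = O(1/\<epsilon>)\<close>. Toggling a violated edge
  increases a bounded integer potential, so local search finds \<open>H\<close> in polynomial time.

  Bob computes a maximum matching \<open>M\<close> of \<open>H \<union> G\<^sub>B\<close> by growing alternating forests and contracting
  blossoms. When a forest gets stuck it yields a Tutte-Berge barrier, which survives expanding the
  blossoms. An edge of an optimal matching of \<open>G\<^sub>A \<union> G\<^sub>B\<close> that crosses between parts of the barrier is
  an edge of Alice outside \<open>H\<close>, hence has degree sum at least \<open>\<beta> - 1\<close> in \<open>H\<close>. The \<open>H\<close>-edges at these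
  crossing vertices end in the barrier set or in the part itself, and the degree constraint forces
  both to be so large that \<open>3 |M|\<close> is at least \<open>2 - 4/\<beta>\<close> times the optimum.
\<close>

subsection \<open>Barriers and edge degree constraints\<close>

text \<open>In a general graph the edges of \<open>H\<close> may hide inside the parts of a barrier,
  where the charging that suffices for a Hall witness of a bipartite graph gives nothing. Here the
  inside of a part is paid for by its own share \<lfloor>|part| / 2\<rfloor> in the Tutte-Berge
  formula, so \<beta> stays linear in 1/\<epsilon>. The message then has O(n/\<epsilon>) edges,
  which lies below the claimed bound.

  Bob's side is shaped by the need for a barrier, not only for a matching, and by storage in plain
  arrays. In place of parent pointers, the forest keeps for each outer vertex a complete matching
  with that vertex free. In place of nested blossoms, each class of the contraction keeps for each
  of its vertices a perfect matching of the rest. Augmenting, contracting and expanding thus become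
  formulas evaluated vertex by vertex. After every contraction the forest is rebuilt from nothing,
  and after every augmentation the contraction is dropped; this costs only polynomial
  factors.\<close>

lemma even_card_involution:
  assumes "finite X" "\<And>x. x \<in> X \<Longrightarrow> g x \<in> X \<and> g x \<noteq> x \<and> g (g x) = x"
  shows "even (card X)"
  using assms
proof (induction "card X" arbitrary: X rule: less_induct)
  case less
  show ?case
  proof (cases "X = {}")
    case False
    then obtain x where x: "x \<in> X" by blast
    let ?Y = "X - {x, g x}"
    have gx: "g x \<in> X" "g x \<noteq> x" "g (g x) = x" using less.prems(2)[OF x] by auto
    have c: "card X = card ?Y + 2"
      using less.prems(1) x gx card_Diff_subset[of "{x, g x}" X] card_mono[of X "{x, g x}"] by auto
    have "even (card ?Y)"
    proof (rule less.hyps)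
      show "card ?Y < card X" using c by simp
      show "finite ?Y" using less.prems(1) by simp
      fix y assume y: "y \<in> ?Y"
      have "g y \<in> X \<and> g y \<noteq> y \<and> g (g y) = y" using less.prems(2) y by blast
      moreover have "g y \<noteq> x" using y calculation by force
      moreover have "g y \<noteq> g x" using y calculation gx by force
      ultimately show "g y \<in> ?Y \<and> g y \<noteq> y \<and> g (g y) = y" by blast
    qed
    then show ?thesis using c by simp
  qed simp
qed

text \<open>Mates are coded as \<open>0\<close> or \<open>Suc y\<close> because this is how a
  matching lies in an array of the machine, whose cells start at 0. Only arguments in
  \<open>L\<close> are constrained, so an array may hold anything beyond.\<close>

definition mate_on :: "nat set \<Rightarrow> (nat \<Rightarrow> nat \<Rightarrow> bool) \<Rightarrow> (nat \<Rightarrow> nat) \<Rightarrow> bool" where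
  "mate_on L a m \<longleftrightarrow> (\<forall>x\<in>L. \<forall>y. m x = Suc y \<longrightarrow> y \<in> L \<and> y \<noteq> x \<and> a x y \<and> m y = Suc x)"

lemma mate_onD:
  assumes "mate_on L a m" "x \<in> L" "m x = Suc y"
  shows "y \<in> L" "y \<noteq> x" "a x y" "m y = Suc x"
  using assms unfolding mate_on_def by blast+

section \<open>Tutte-Berge barriers\<close>

definition part :: "nat set \<Rightarrow> nat set \<Rightarrow> (nat \<Rightarrow> nat) \<Rightarrow> nat \<Rightarrow> nat set" where
  "part L A \<kappa> j = {x \<in> L - A. \<kappa> x = j}"

definition crossing :: "nat set \<Rightarrow> nat set \<Rightarrow> (nat \<Rightarrow> nat) \<Rightarrow> (nat \<Rightarrow> nat) \<Rightarrow> nat set" where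
  "crossing L A \<kappa> m = {x \<in> L - A. \<exists>y \<in> L - A. m x = Suc y \<and> \<kappa> y \<noteq> \<kappa> x}"

text \<open>A part of odd size that no matching edge joins to another part cannot be matched within
  itself, so it contains a free vertex or a vertex whose mate lies in \<open>A\<close>. The labels
  \<kappa> are not tied to the relation \<open>a\<close>: the lemma is also applied to a matching of
  a larger graph than the one that \<kappa> separates, and then the parts with crossing edges make
  up the third summand.\<close>

lemma odd_parts_bound:
  assumes fin: "finite L" and m: "mate_on L a m" and A: "A \<subseteq> L"
  shows "card {j. odd (card (part L A \<kappa> j))}
    \<le> card {x \<in> L - A. m x = 0} + card {x \<in> A. m x \<noteq> 0} + card (\<kappa> ` crossing L A \<kappa> m)"
proof -
  let ?J = "{j. odd (card (part L A \<kappa> j))} - \<kappa> ` crossing L A \<kappa> m"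
  let ?T = "{x \<in> L - A. m x = 0} \<union> {x \<in> A. m x \<noteq> 0}"
  have finA: "finite A" using fin A finite_subset by blast
  have finX: "finite (crossing L A \<kappa> m)" using fin by (simp add: crossing_def)
  have ex: "\<exists>t. t \<in> ?T \<and> ((t \<in> part L A \<kappa> j \<and> m t = 0) \<or> (t \<in> A \<and> m t \<noteq> 0 \<and> m t - 1 \<in> part L A \<kappa> j))"
    if j: "j \<in> ?J" for j
  proof (rule ccontr)
    assume no: "\<not> ?thesis"
    have "even (card (part L A \<kappa> j))"
    proof (rule even_card_involution[where g = "\<lambda>x. m x - 1"])
      show "finite (part L A \<kappa> j)" using fin by (simp add: part_def)
      fix x assume x: "x \<in> part L A \<kappa> j"
      then have xL: "x \<in> L" "x \<notin> A" "\<kappa> x = j" by (auto simp: part_def)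
      have "m x \<noteq> 0" using no x xL by auto
      then obtain y where y: "m x = Suc y" using not0_implies_Suc by blast
      note yp = mate_onD[OF m xL(1) y]
      have "y \<notin> A" using no x yp by auto
      moreover have "x \<notin> crossing L A \<kappa> m" using j xL by blast
      ultimately have "y \<in> part L A \<kappa> j" using yp xL y by (auto simp: part_def crossing_def)
      then show "m x - 1 \<in> part L A \<kappa> j \<and> m x - 1 \<noteq> x \<and> m (m x - 1) - 1 = x"
        using yp y by simp
    qed
    then show False using j by simp
  qed
  \<comment> \<open>The chosen vertex determines its part, by its own label or by that of its mate;
    hence \<open>g\<close> is injective.\<close>
  define g where "g j = (SOME t. t \<in> ?T \<and> ((t \<in> part L A \<kappa> j \<and> m t = 0) \<or> (t \<in> A \<and> m t \<noteq> 0 \<and> m t - 1 \<in> part L A \<kappa> j)))" for j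
  have g: "g j \<in> ?T \<and> ((g j \<in> part L A \<kappa> j \<and> m (g j) = 0) \<or> (g j \<in> A \<and> m (g j) \<noteq> 0 \<and> m (g j) - 1 \<in> part L A \<kappa> j))"
    if "j \<in> ?J" for j
    unfolding g_def by (rule someI_ex[OF ex[OF that]])
  have "inj_on g ?J"
  proof (rule inj_onI)
    fix i j assume "i \<in> ?J" "j \<in> ?J" "g i = g j"
    then show "i = j" using g[of i] g[of j] by (auto simp: part_def)
  qed
  moreover have "g ` ?J \<subseteq> ?T" using g by (intro image_subsetI) (rule conjunct1)
  moreover have "finite ?T" using fin finA by simp
  ultimately have "card ?J \<le> card ?T" by (rule card_inj_on_le)
  also have "\<dots> \<le> card {x \<in> L - A. m x = 0} + card {x \<in> A. m x \<noteq> 0}" by (rule card_Un_le)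
  finally have 1: "card ?J \<le> \<dots>" .
  have "card {j. odd (card (part L A \<kappa> j))} \<le> card (?J \<union> \<kappa> ` crossing L A \<kappa> m)"
  proof (rule card_mono)
    have "{j. odd (card (part L A \<kappa> j))} \<subseteq> \<kappa> ` L"
    proof
      fix j assume "j \<in> {j. odd (card (part L A \<kappa> j))}"
      then have "part L A \<kappa> j \<noteq> {}" by auto
      then show "j \<in> \<kappa> ` L" by (auto simp: part_def)
    qed
    then have "finite {j. odd (card (part L A \<kappa> j))}" using fin finite_subset by blast
    then show "finite (?J \<union> \<kappa> ` crossing L A \<kappa> m)" using finX by simp
  qed auto
  also have "\<dots> \<le> card ?J + card (\<kappa> ` crossing L A \<kappa> m)" by (rule card_Un_le)
  finally show ?thesis using 1 by linarith
qed

text \<open>The dual object of the Tutte-Berge formula: each part is a union of components of the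
  graph without \<open>A\<close>. Labels that do not occur have an empty part, which is even and
  does not count.\<close>

definition barrier :: "nat set \<Rightarrow> (nat \<Rightarrow> nat \<Rightarrow> bool) \<Rightarrow> nat \<Rightarrow> nat set \<Rightarrow> (nat \<Rightarrow> nat) \<Rightarrow> bool" where
  "barrier L a f A \<kappa> \<longleftrightarrow> A \<subseteq> L \<and> (\<forall>x\<in>L - A. \<forall>y\<in>L - A. a x y \<longrightarrow> \<kappa> x = \<kappa> y)
     \<and> f + card A \<le> card {j. odd (card (part L A \<kappa> j))}"

text \<open>Weak duality. If the bound is attained, the counting is tight and all of
  \<open>A\<close> is matched; this complementary slackness is what allows blossoms to be expanded
  in \<open>barrier_contract\<close>.\<close>

lemma barrier_optimal:
  assumes fin: "finite L" and b: "barrier L a f A \<kappa>" and m: "mate_on L a m"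
  shows "f \<le> card {x \<in> L. m x = 0}"
    and "f = card {x \<in> L. m x = 0} \<Longrightarrow> x \<in> L \<Longrightarrow> m x = 0 \<Longrightarrow> x \<notin> A"
proof -
  have A: "A \<subseteq> L" and finA: "finite A" using b fin finite_subset by (auto simp: barrier_def)
  have cr: "crossing L A \<kappa> m = {}"
  proof -
    have False if "x \<in> L - A" "y \<in> L - A" "m x = Suc y" "\<kappa> y \<noteq> \<kappa> x" for x y
      using that b mate_onD(3)[OF m _ that(3)] by (force simp: barrier_def)
    then show ?thesis by (force simp: crossing_def)
  qed
  have le: "f + card A \<le> card {x \<in> L - A. m x = 0} + card {x \<in> A. m x \<noteq> 0}"
    using odd_parts_bound[OF fin m A, of \<kappa>] b cr by (simp add: barrier_def)
  have s: "card {x \<in> L. m x = 0} = card {x \<in> L - A. m x = 0} + card {x \<in> A. m x = 0}"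
    using fin A finA by (subst card_Un_disjoint[symmetric]) (auto intro!: arg_cong[where f = card])
  have t: "card A = card {x \<in> A. m x \<noteq> 0} + card {x \<in> A. m x = 0}"
    using finA by (subst card_Un_disjoint[symmetric]) (auto intro!: arg_cong[where f = card])
  show "f \<le> card {x \<in> L. m x = 0}" using le s t by linarith
  assume "f = card {x \<in> L. m x = 0}" "x \<in> L" "m x = 0"
  moreover have "card {x \<in> A. m x = 0} > 0" if "x \<in> A"
    using that \<open>m x = 0\<close> finA by (auto simp: card_gt_0_iff)
  ultimately show "x \<notin> A" using le s t by linarith
qed

text \<open>Each neighbour \<open>y\<close> of \<open>x\<close> has degree at most \<open>\<beta> - deg x\<close>, so the charges \<open>1 / (\<beta> - deg x)\<close> that
  \<open>y\<close> receives from its neighbours sum to at most 1.\<close>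

lemma degree_charging:
  fixes nb :: "nat \<Rightarrow> nat set" and \<beta> :: nat
  assumes sym: "\<And>x y. y \<in> nb x \<Longrightarrow> x \<in> nb y" and finnb: "\<And>x. finite (nb x)"
    and P1: "\<And>x y. y \<in> nb x \<Longrightarrow> card (nb x) + card (nb y) \<le> \<beta>"
    and S: "finite S" and Y: "finite Y"
  shows "(\<Sum>x\<in>S. real (card (nb x \<inter> Y)) / (real \<beta> - real (card (nb x)))) \<le> real (card Y)"
proof -
  have "(\<Sum>x\<in>S. real (card (nb x \<inter> Y)) / (real \<beta> - real (card (nb x))))
      = (\<Sum>x\<in>S. \<Sum>y\<in>nb x \<inter> Y. 1 / (real \<beta> - real (card (nb x))))" by simp
  also have "\<dots> \<le> (\<Sum>x\<in>S. \<Sum>y\<in>nb x \<inter> Y. 1 / real (card (nb y)))"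
  proof (intro sum_mono)
    fix x y assume "x \<in> S" "y \<in> nb x \<inter> Y"
    then have y: "y \<in> nb x" by simp
    have "card (nb y) > 0" using sym[OF y] finnb by (auto simp: card_gt_0_iff)
    moreover have "real (card (nb y)) \<le> real \<beta> - real (card (nb x))" using P1[OF y] by linarith
    ultimately show "1 / (real \<beta> - real (card (nb x))) \<le> 1 / real (card (nb y))"
      by (intro divide_left_mono) auto
  qed
  also have "\<dots> = (\<Sum>x\<in>S. \<Sum>y\<in>Y. if y \<in> nb x then 1 / real (card (nb y)) else 0)"
    by (rule sum.cong[OF refl]) (subst Int_commute, rule sum.inter_restrict[OF Y])
  also have "\<dots> = (\<Sum>y\<in>Y. \<Sum>x\<in>S. if y \<in> nb x then 1 / real (card (nb y)) else 0)" by (rule sum.swap)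
  also have "\<dots> \<le> (\<Sum>y\<in>Y. 1)"
  proof (rule sum_mono)
    fix y assume "y \<in> Y"
    have "(\<Sum>x\<in>S. if y \<in> nb x then 1 / real (card (nb y)) else 0)
        = (\<Sum>x\<in>{x\<in>S. y \<in> nb x}. 1 / real (card (nb y)))"
      using S by (subst sum.inter_filter[symmetric]) auto
    also have "\<dots> = real (card {x\<in>S. y \<in> nb x}) / real (card (nb y))" by simp
    also have "\<dots> \<le> 1"
    proof -
      have "card {x\<in>S. y \<in> nb x} \<le> card (nb y)" using sym finnb by (intro card_mono) auto
      then show ?thesis by (cases "card (nb y) = 0") (auto simp: divide_le_eq_1)
    qed
    finally show "(\<Sum>x\<in>S. if y \<in> nb x then 1 / real (card (nb y)) else 0) \<le> 1" .
  qed
  finally show ?thesis by simp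
qed

text \<open>Dropping \<open>i\<close> from the denominator only decreases the left side, and
  \<open>x / (b - x)\<close> lies above its tangent at \<open>b / 2\<close>, which amounts to
  \<open>(2 * x - b)\<^sup>2 \<ge> 0\<close>. The term \<open>4 * i / b\<close> is the loss for the
  edges inside the part.\<close>

lemma charge_tangent:
  fixes o' i b :: real
  assumes "0 \<le> o'" "0 \<le> i" "0 < b" "o' + i < b"
  shows "o' / (b - (o' + i)) \<ge> 1 + (4 * (o' + i) / b - 2) - 4 * i / b"
proof -
  have eq: "1 + (4 * (o' + i) / b - 2) - 4 * i / b = (4 * o' - b) / b" using assms by (simp add: field_simps)
  have "(4 * o' - b) / b \<le> o' / (b - o')"
  proof -
    have "(4 * o' - b) * (b - o') \<le> o' * b"
      using zero_le_square[of "2 * o' - b"] by (simp add: algebra_simps)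
    then show ?thesis using assms by (simp add: divide_simps mult.commute)
  qed
  also have "\<dots> \<le> o' / (b - (o' + i))" using assms by (intro divide_left_mono mult_pos_pos) auto
  finally show ?thesis using eq by simp
qed

text \<open>With \<open>z = (b - d) / b\<close> the claim becomes
  \<open>8 * z\<^sup>2 - (28/5) * z + 1 \<ge> 0\<close>, whose discriminant is negative. A constant
  \<open>c\<close> in place of 3/10 works as long as \<open>(5 + 2 * c)\<^sup>2 \<le> 32\<close>,
  that is up to about 0.328; the value 3/10 is what five vertices need to contribute 3/2 in
  \<open>edcs_barrier_bound\<close>.\<close>

lemma half_charge_tangent:
  fixes d b :: real
  assumes "0 \<le> d" "d < b"
  shows "d / (2 * (b - d)) \<ge> (4 * d / b - 2) + 3 / 10"
proof -
  define z where "z = (b - d) / b"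
  have b: "b > 0" using assms by simp
  have z: "z > 0" using assms b by (simp add: z_def)
  have d: "d = b * (1 - z)" using b by (simp add: z_def field_simps)
  have bd: "b - d = b * z" using b by (simp add: z_def)
  have e1: "d / (2 * (b - d)) = (1 - z) / (2 * z)" unfolding bd using d b z by (simp add: field_simps)
  have e2: "4 * d / b = 4 * (1 - z)" using d b by simp
  have "0 \<le> 4 * (z - 7/20)^2 + 1/100" by simp
  then have "(4 * (1 - z) - 2 + 3/10) * (2 * z) \<le> 1 - z"
    by (simp add: power2_eq_square algebra_simps)
  then have "4 * (1 - z) - 2 + 3/10 \<le> (1 - z) / (2 * z)" using z by (simp add: le_divide_eq)
  then show ?thesis using e1 e2 by simp
qed

text \<open>Write \<open>f'\<close> for the number of vertices free in \<open>m\<close>,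
  \<open>S\<close> for the crossing vertices and \<open>J\<close> for the labels of their parts.
  Crossing edges can save at most one free vertex per crossed part, so
  \<open>f \<le> f' + |J|\<close>. On the other hand crossed parts are expensive:
  \<open>n - f \<ge> 2 * |J| + 2 * (\<Sum>x\<in>S. h x)\<close>, where the sum is hardly negative.
  Twice the first inequality added to the second yields the factor 2/3, and the sum over
  \<open>h\<close> yields the term 4/\<beta>.\<close>

theorem edcs_barrier_bound:
  fixes n f \<beta> :: nat and H EA EB :: "nat set set" and d :: "nat \<Rightarrow> nat"
  defines "V \<equiv> {..<n}"
  assumes sA: "simple_graph n EA" and HA: "H \<subseteq> EA"
    and d: "\<And>v. d v = card {e \<in> H. v \<in> e}"
    and P1: "\<And>u v. {u, v} \<in> H \<Longrightarrow> d u + d v \<le> \<beta>"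
    and P2: "\<And>u v. {u, v} \<in> EA - H \<Longrightarrow> \<beta> \<le> d u + d v + 1"
    and beta: "32 \<le> \<beta>"
    and bar: "barrier V (\<lambda>x y. {x, y} \<in> H \<union> EB) f A \<kappa>"
    and m: "mate_on V (\<lambda>x y. {x, y} \<in> EA \<union> EB) m"
  shows "3 * (real n - real f) \<ge> (real n - real (card {x\<in>V. m x = 0})) * (2 - 4 / real \<beta>)"
proof -
  define nb where "nb x = {y. {x, y} \<in> H}" for x
  define S where "S = crossing V A \<kappa> m"
  define P where "P = part V A \<kappa>"
  \<comment> \<open>\<open>1 + h\<close> is the tangent of the convex function \<open>d / (\<beta> - d)\<close> at \<open>\<beta> / 2\<close>; over the two ends of a
    crossing edge, \<open>h\<close> sums to at least \<open>- 4 / \<beta>\<close>.\<close>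
  define h where "h x = 4 * real (d x) / real \<beta> - 2" for x
  define o' where "o' x = card (nb x \<inter> A)" for x
  \<comment> \<open>The total charge in the sense of \<open>degree_charging\<close> that
    \<open>x\<close> sends into \<open>A\<close>.\<close>
  define q where "q x = real (o' x) / (real \<beta> - real (d x))" for x
  let ?J = "\<kappa> ` S"
  have finV: "finite V" by (simp add: V_def)
  have A: "A \<subseteq> V" and finA: "finite A" using bar finV finite_subset by (auto simp: barrier_def)
  have finS: "finite S" using finV by (simp add: S_def crossing_def)
  have SV: "S \<subseteq> V - A" by (auto simp: S_def crossing_def)
  have HV: "x < n \<and> y < n \<and> x \<noteq> y" if "{x, y} \<in> H" for x y
    using that HA sA unfolding simple_graph_def by (force simp: doubleton_eq_iff)
  have finnb: "finite (nb x)" for x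
    by (rule finite_subset[of _ V]) (auto simp: nb_def V_def dest: HV)
  have nbd: "card (nb x) = d x" for x
  proof -
    have "bij_betw (\<lambda>y. {x, y}) (nb x) {e \<in> H. x \<in> e}"
    proof (rule bij_betwI')
      fix y z show "({x, y} = {x, z}) = (y = z)" by (auto simp: doubleton_eq_iff)
    next
      fix y assume "y \<in> nb x" then show "{x, y} \<in> {e \<in> H. x \<in> e}" by (simp add: nb_def)
    next
      fix e assume "e \<in> {e \<in> H. x \<in> e}"
      then have e: "e \<in> H" "x \<in> e" by auto
      then obtain u v where "e = {u, v}" using HA sA unfolding simple_graph_def by blast
      then have "e = {x, u} \<or> e = {x, v}" using e by auto
      then show "\<exists>y\<in>nb x. e = {x, y}" using e by (auto simp: nb_def)
    qed
    then show ?thesis using d bij_betw_same_card by fastforce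
  qed
  have sym: "y \<in> nb x \<Longrightarrow> x \<in> nb y" for x y by (simp add: nb_def insert_commute)
  have P1': "y \<in> nb x \<Longrightarrow> card (nb x) + card (nb y) \<le> \<beta>" for x y
    using P1 by (simp add: nbd) (simp add: nb_def)
  \<comment> \<open>Keeps the denominators of the charges positive: a neighbour has degree at least
    1 itself.\<close>
  have dlt: "d x < \<beta>" for x
  proof (cases "nb x = {}")
    case True then show ?thesis using nbd[of x] beta by simp
  next
    case False
    then obtain y where y: "y \<in> nb x" by blast
    have "card (nb y) > 0" using sym[OF y] finnb by (auto simp: card_gt_0_iff)
    then show ?thesis using P1'[OF y] nbd by simp
  qed
  have bpos: "real \<beta> > 0" using beta by simp
  have "(\<Sum>x\<in>S. q x) \<le> real (card A)"
    using degree_charging[OF sym finnb P1' finS finA] by (simp add: q_def o'_def nbd)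
  have nbsub: "nb x \<subseteq> A \<union> (P (\<kappa> x) - {x})" if "x \<in> V - A" for x
  proof
    fix y assume y: "y \<in> nb x"
    then have "y \<in> V" "y \<noteq> x" using HV[of x y] by (auto simp: nb_def V_def)
    moreover have "\<kappa> x = \<kappa> y" if "y \<notin> A"
      using bar \<open>x \<in> V - A\<close> \<open>y \<in> V\<close> that y by (auto simp: barrier_def nb_def)
    ultimately show "y \<in> A \<union> (P (\<kappa> x) - {x})" by (auto simp: P_def part_def)
  qed
  define i where "i x = card (nb x \<inter> P (\<kappa> x))" for x
  have finP: "finite (P j)" for j using finV by (simp add: P_def part_def)
  have di: "d x = o' x + i x" if x: "x \<in> V - A" for x
  proof -
    have "nb x = (nb x \<inter> A) \<union> (nb x \<inter> P (\<kappa> x))" using nbsub[OF x] by blast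
    then have "card (nb x) = card ((nb x \<inter> A) \<union> (nb x \<inter> P (\<kappa> x)))" by (rule arg_cong)
    also have "\<dots> = card (nb x \<inter> A) + card (nb x \<inter> P (\<kappa> x))"
      using finnb by (intro card_Un_disjoint) (auto simp: P_def part_def)
    finally have "card (nb x) = card (nb x \<inter> A) + card (nb x \<inter> P (\<kappa> x))" .
    then show ?thesis by (simp add: nbd o'_def i_def)
  qed
  have ile: "real (i x) \<le> real (card (P (\<kappa> x))) - 1" if x: "x \<in> V - A" for x
  proof -
    have xP: "x \<in> P (\<kappa> x)" using x by (simp add: P_def part_def)
    have "x \<notin> nb x" using HV[of x x] by (auto simp: nb_def)
    then have "nb x \<inter> P (\<kappa> x) \<subseteq> P (\<kappa> x) - {x}" by blast
    then have "i x \<le> card (P (\<kappa> x) - {x})" unfolding i_def using finP by (intro card_mono) auto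
    moreover have "card (P (\<kappa> x)) > 0" using xP finP by (auto simp: card_gt_0_iff)
    ultimately show ?thesis using xP finP by (simp add: card_Diff_singleton)
  qed
  \<comment> \<open>Each crossed part has to earn 1, for the free vertex it may save, plus the
    tangent values of its crossing vertices. It earns its share of the matching plus the charges
    that these vertices send into \<open>A\<close>.\<close>
  have cls: "real (card (P j) div 2) + (\<Sum>x\<in>S \<inter> P j. q x) \<ge> 1 + (\<Sum>x\<in>S \<inter> P j. h x)"
    if j: "j \<in> ?J" for j
  proof -
    let ?r = "card (S \<inter> P j)"
    have "card (P j) \<le> 2 * (card (P j) div 2) + 1" by linarith
    then have "real (card (P j)) \<le> real (2 * (card (P j) div 2) + 1)" by (rule of_nat_mono)
    then have fl: "real (card (P j) div 2) \<ge> (real (card (P j)) - 1) / 2"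
      unfolding of_nat_add of_nat_mult by (simp only: of_nat_numeral of_nat_1 field_simps)
    have kx: "\<kappa> x = j" if "x \<in> P j" for x using that by (simp add: P_def part_def)
    have "S \<inter> P j \<noteq> {}" using j SV by (auto simp: P_def part_def)
    then have r1: "?r \<ge> 1" using finS by (simp add: Suc_leI card_gt_0_iff)
    show ?thesis
      \<comment> \<open>With few crossing vertices the degrees inside the part are paid for by its size as such, with
        many by applying the charging argument inside the part.\<close>
    proof (cases "?r \<le> 4")
      case True
      have p1: "real (card (P j)) \<ge> 1"
      proof -
        have "?r \<le> card (P j)" using finP by (intro card_mono) auto
        then show ?thesis using r1 by linarith
      qed
      have "(\<Sum>x\<in>S \<inter> P j. q x) \<ge> (\<Sum>x\<in>S \<inter> P j. 1 + h x - 4 * (real (card (P j)) - 1) / real \<beta>)"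
      proof (rule sum_mono)
        fix x assume x: "x \<in> S \<inter> P j"
        then have xV: "x \<in> V - A" using SV by blast
        have "q x \<ge> 1 + h x - 4 * real (i x) / real \<beta>"
          using charge_tangent[of "real (o' x)" "real (i x)" "real \<beta>"] dlt[of x] bpos
          by (simp add: q_def h_def di[OF xV])
        moreover have "4 * real (i x) / real \<beta> \<le> 4 * (real (card (P j)) - 1) / real \<beta>"
          using ile[OF xV] kx[of x] x bpos by (intro divide_right_mono) auto
        ultimately show "1 + h x - 4 * (real (card (P j)) - 1) / real \<beta> \<le> q x" by linarith
      qed
      also have "(\<Sum>x\<in>S \<inter> P j. 1 + h x - 4 * (real (card (P j)) - 1) / real \<beta>)
         = real ?r + (\<Sum>x\<in>S \<inter> P j. h x) - real ?r * (4 * (real (card (P j)) - 1) / real \<beta>)"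
        by (simp add: sum.distrib sum_subtractf)
      finally have a: "(\<Sum>x\<in>S \<inter> P j. q x) \<ge> \<dots>" .
      \<comment> \<open>At most four vertices lose at most \<open>4 * (|P| - 1) / \<beta>\<close>
        each, which for \<beta> at least 32 is covered by \<open>(|P| - 1) / 2\<close>. This fixes
        the 32. What remains is \<open>?r \<ge> 1\<close>, which pays for the part.\<close>
      have "real ?r * (4 * (real (card (P j)) - 1) / real \<beta>) \<le> 4 * (4 * (real (card (P j)) - 1) / 32)"
        using True beta p1 by (intro mult_mono divide_left_mono) auto
      then show ?thesis using a fl r1 by linarith
    next
      case False
      have cP: "real (card (P j)) \<ge> (\<Sum>x\<in>S \<inter> P j. real (i x) / (real \<beta> - real (d x)))"
      proof -
        have "(\<Sum>x\<in>S \<inter> P j. real (i x) / (real \<beta> - real (d x))) =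
           (\<Sum>x\<in>S \<inter> P j. real (card (nb x \<inter> P j)) / (real \<beta> - real (card (nb x))))"
          by (rule sum.cong) (auto simp: nbd i_def kx)
        then show ?thesis using degree_charging[OF sym finnb P1', where S = "S \<inter> P j" and Y = "P j"] finS finP by simp
      qed
      \<comment> \<open>Charges inside the part count by half, because they sum to at most
        \<open>|P|\<close> while the part contributes only half its size. Charges into
        \<open>A\<close> count fully, so half the charge along all \<open>d x = o' x + i x\<close>
        edges is certainly available.\<close>
      have "(\<Sum>x\<in>S \<inter> P j. h x + 3/10) \<le> (\<Sum>x\<in>S \<inter> P j. q x + real (i x) / (real \<beta> - real (d x)) / 2)"
      proof (rule sum_mono)
        fix x assume "x \<in> S \<inter> P j"
        then have xV: "x \<in> V - A" using SV by blast
        have b: "real \<beta> - real (d x) > 0" using dlt[of x] by simp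
        have "h x + 3/10 \<le> real (d x) / (2 * (real \<beta> - real (d x)))"
          using half_charge_tangent[of "real (d x)" "real \<beta>"] dlt[of x] by (simp add: h_def)
        also have "\<dots> \<le> (2 * real (o' x) + real (i x)) / (2 * (real \<beta> - real (d x)))"
          using b by (intro divide_right_mono) (auto simp: di[OF xV])
        also have "\<dots> = q x + real (i x) / (real \<beta> - real (d x)) / 2"
          unfolding q_def by (simp only: add_divide_distrib mult_divide_mult_cancel_left_if) simp
        finally show "h x + 3/10 \<le> q x + real (i x) / (real \<beta> - real (d x)) / 2" .
      qed
      then have "(\<Sum>x\<in>S \<inter> P j. h x) + real ?r * (3/10)
          \<le> (\<Sum>x\<in>S \<inter> P j. q x) + (\<Sum>x\<in>S \<inter> P j. real (i x) / (real \<beta> - real (d x))) / 2"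
        by (simp add: sum.distrib sum_divide_distrib)
      \<comment> \<open>Five times 3/10 is 1 + 1/2: the 1 pays for the part and the 1/2 for rounding
        down \<open>|P| / 2\<close>.\<close>
      moreover have "real ?r \<ge> 5" using False by linarith
      ultimately show ?thesis using fl cP by linarith
    qed
  qed
  have finJ: "finite ?J" using finS by simp
  let ?K = "\<kappa> ` (V - A)"
  have finK: "finite ?K" using finV by simp
  have JK: "?J \<subseteq> ?K" using SV by blast
  have sumS: "(\<Sum>x\<in>S. g x) = (\<Sum>j\<in>?J. \<Sum>x\<in>S \<inter> P j. g x)" for g :: "nat \<Rightarrow> real"
  proof -
    have "S \<inter> P j = {x \<in> S. \<kappa> x = j}" for j using SV by (auto simp: P_def part_def)
    then show ?thesis using sum.group[OF finS finJ subset_refl, of g] by simp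
  qed
  have "real (card ?J) + (\<Sum>x\<in>S. h x) = (\<Sum>j\<in>?J. 1 + (\<Sum>x\<in>S \<inter> P j. h x))"
    by (simp add: sumS[of h] sum.distrib)
  also have "\<dots> \<le> (\<Sum>j\<in>?J. real (card (P j) div 2) + (\<Sum>x\<in>S \<inter> P j. q x))"
    using cls by (intro sum_mono) auto
  also have "\<dots> = (\<Sum>j\<in>?J. real (card (P j) div 2)) + (\<Sum>x\<in>S. q x)"
    by (simp add: sumS[of q] sum.distrib)
  also have "\<dots> \<le> (\<Sum>j\<in>?K. real (card (P j) div 2)) + real (card A)"
    using \<open>(\<Sum>x\<in>S. q x) \<le> real (card A)\<close> finK JK by (intro add_mono sum_mono2) auto
  \<comment> \<open>Tutte-Berge arithmetic: the left side equals \<open>n + |A|\<close> minus the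
    number of odd parts.\<close>
  also have "2 * \<dots> \<le> real n - real f"
  proof -
    have Pn: "P j = {x \<in> V - A. \<kappa> x = j}" for j by (auto simp: P_def part_def)
    have "card (V - A) = (\<Sum>j\<in>?K. card (P j))"
      using sum.group[of "V - A" ?K \<kappa> "\<lambda>_. 1 :: nat"] finV by (simp add: Pn)
    also have "\<dots> = (\<Sum>j\<in>?K. 2 * (card (P j) div 2) + (if odd (card (P j)) then 1 else 0))"
      by (intro sum.cong refl) (auto elim!: oddE)
    also have "\<dots> = 2 * (\<Sum>j\<in>?K. card (P j) div 2) + card {j\<in>?K. odd (card (P j))}"
      using finK by (simp add: sum.distrib sum_distrib_left sum.inter_filter[symmetric])
    also have "{j\<in>?K. odd (card (P j))} = {j. odd (card (P j))}"
    proof -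
      have "j \<in> ?K" if "odd (card (P j))" for j
      proof -
        have "P j \<noteq> {}" using that by auto
        then show ?thesis by (auto simp: Pn)
      qed
      then show ?thesis by blast
    qed
    finally have "card (V - A) = 2 * (\<Sum>j\<in>?K. card (P j) div 2) + card {j. odd (card (P j))}" .
    moreover have "card (V - A) + card A = n"
      using A finA finV card_mono[OF finV A] by (simp add: card_Diff_subset V_def)
    moreover have "f + card A \<le> card {j. odd (card (P j))}" using bar by (simp add: barrier_def P_def)
    ultimately have "2 * ((\<Sum>j\<in>?K. card (P j) div 2) + card A) + f \<le> n"
      unfolding distrib_left by (smt (verit) add.assoc add.commute add_le_cancel_left mult_2)
    then have "real (2 * ((\<Sum>j\<in>?K. card (P j) div 2) + card A) + f) \<le> real n" by (rule of_nat_mono)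
    then have "2 * (real (\<Sum>j\<in>?K. card (P j) div 2) + real (card A)) + real f \<le> real n" by simp
    then show ?thesis by simp
  qed
  finally have main: "2 * (real (card ?J) + (\<Sum>x\<in>S. h x)) \<le> real n - real f" by simp
  let ?f = "card {x\<in>V. m x = 0}"
  have J: "real f \<le> real ?f + real (card ?J)"
  proof -
    have "card {x \<in> V - A. m x = 0} \<le> ?f" using finV by (intro card_mono) auto
    moreover have "card {x \<in> A. m x \<noteq> 0} \<le> card A" using finA by (intro card_mono) auto
    moreover have "f + card A \<le> card {x \<in> V - A. m x = 0} + card {x \<in> A. m x \<noteq> 0} + card ?J"
      using odd_parts_bound[OF finV m A, of \<kappa>] bar by (simp add: barrier_def S_def)
    ultimately show ?thesis by linarith
  qed
  \<comment> \<open>The mate of a crossing vertex crosses as well. The edge between them joins two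
    parts, so the barrier excludes it from \<open>H \<union> EB\<close>, and \<open>P2\<close>
    applies to it.\<close>
  define \<pi> where "\<pi> x = m x - 1" for x
  have pi: "\<pi> x \<in> S \<and> \<pi> (\<pi> x) = x \<and> {x, \<pi> x} \<in> EA - H" if x: "x \<in> S" for x
  proof -
    obtain y where y: "y \<in> V - A" "m x = Suc y" "\<kappa> y \<noteq> \<kappa> x" and xV: "x \<in> V - A"
      using x by (auto simp: S_def crossing_def)
    note yp = mate_onD[OF m _ y(2)]
    have "{x, y} \<notin> H \<union> EB" using bar xV y by (auto simp: barrier_def)
    moreover have "y \<in> S" using xV y yp by (auto simp: S_def crossing_def)
    ultimately show ?thesis using y xV yp by (auto simp: \<pi>_def)
  qed
  have hsum: "2 * (\<Sum>x\<in>S. h x) \<ge> - (4 / real \<beta>) * real (card S)"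
  proof -
    have "bij_betw \<pi> S S" by (rule bij_betw_byWitness[where f' = \<pi>]) (use pi in auto)
    then have "(\<Sum>x\<in>S. h (\<pi> x)) = (\<Sum>x\<in>S. h x)" by (rule sum.reindex_bij_betw)
    then have "2 * (\<Sum>x\<in>S. h x) = (\<Sum>x\<in>S. h x + h (\<pi> x))" by (simp add: sum.distrib)
    also have "\<dots> \<ge> (\<Sum>x\<in>S. - (4 / real \<beta>))"
    proof (rule sum_mono)
      fix x assume x: "x \<in> S"
      have "real \<beta> - 1 \<le> real (d x) + real (d (\<pi> x))" using P2 pi[OF x] by fastforce
      then have "4 * (real \<beta> - 1) / real \<beta> \<le> 4 * (real (d x) + real (d (\<pi> x))) / real \<beta>"
        using bpos by (intro divide_right_mono) auto
      then show "- (4 / real \<beta>) \<le> h x + h (\<pi> x)"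
        using bpos by (simp add: h_def field_simps)
    qed
    finally show ?thesis by (simp add: mult.commute)
  qed
  have "real (card S) \<le> real n - real ?f"
  proof -
    have "card (S \<union> {x\<in>V. m x = 0}) \<le> card V" using SV finV by (intro card_mono) auto
    moreover have "card (S \<union> {x\<in>V. m x = 0}) = card S + ?f"
      using finS finV by (intro card_Un_disjoint) (auto simp: S_def crossing_def)
    ultimately show ?thesis by (simp add: V_def)
  qed
  then have "(4 / real \<beta>) * real (card S) \<le> (4 / real \<beta>) * (real n - real ?f)"
    using bpos by (intro mult_left_mono) auto
  then show ?thesis using main J hsum by (simp add: algebra_simps)
qed

subsection \<open>Running programs within a time bound\<close>

fun mods :: "com \<Rightarrow> vname set" where
  "mods Skip = {}"
| "mods (Put x i a) = {x}"
| "mods (Seq c d) = mods c \<union> mods d"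
| "mods (If b c d) = mods c \<union> mods d"
| "mods (While b c) = mods c"

fun loop_free :: "com \<Rightarrow> bool" where
  "loop_free (Seq c d) \<longleftrightarrow> loop_free c \<and> loop_free d"
| "loop_free (If b c d) \<longleftrightarrow> loop_free c \<and> loop_free d"
| "loop_free (While b c) \<longleftrightarrow> False"
| "loop_free _ \<longleftrightarrow> True"

fun cost :: "com \<Rightarrow> nat" where
  "cost (Seq c d) = cost c + cost d"
| "cost (If b c d) = 1 + cost c + cost d"
| "cost _ = 1"

text \<open>Lets straight-line code be evaluated by simplification. The clause for loops is a dummy:
  \<open>run\<close> is related to \<open>exec\<close> only for \<open>loop_free\<close>
  programs.\<close>

fun run :: "com \<Rightarrow> state \<Rightarrow> state" where
  "run Skip s = s"
| "run (Put x i a) s = s(x := (s x)(aval i s := aval a s))"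
| "run (Seq c d) s = run d (run c s)"
| "run (If b c d) s = (if bval b s then run c s else run d s)"
| "run (While b c) s = s"

definition frame :: "vname set \<Rightarrow> state \<Rightarrow> state \<Rightarrow> bool" where
  "frame X s s' \<longleftrightarrow> (\<forall>y. y \<notin> X \<longrightarrow> s' y = s y)"

lemma frameD: "frame X s s' \<Longrightarrow> y \<notin> X \<Longrightarrow> s' y = s y"
  by (simp add: frame_def)

lemma frame_refl [simp]: "frame X s s"
  by (simp add: frame_def)

lemma frame_trans: "frame X s t \<Longrightarrow> frame Y t u \<Longrightarrow> X \<subseteq> Z \<Longrightarrow> Y \<subseteq> Z \<Longrightarrow> frame Z s u"
  unfolding frame_def by (metis subsetD)

lemma frame_mono: "frame X s t \<Longrightarrow> X \<subseteq> Z \<Longrightarrow> frame Z s t"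
  unfolding frame_def by blast

text \<open>All time bounds below are powers of one number \<open>W \<ge> 100\<close> that bounds the sizes of all data, so
  that composing programs only changes the exponent.\<close>

definition runs :: "com \<Rightarrow> state \<Rightarrow> nat \<Rightarrow> state \<Rightarrow> bool" where
  "runs c s k s' \<longleftrightarrow> (\<exists>t\<le>k. exec c s t s')"

lemma exec_frame: "exec c s t s' \<Longrightarrow> frame (mods c) s s'"
  by (induction rule: exec.induct) (auto simp: frame_def)

lemma runs_frame: "runs c s k s' \<Longrightarrow> frame (mods c) s s'"
  by (auto simp: runs_def dest: exec_frame)

lemma runs_mono: "runs c s k s' \<Longrightarrow> k \<le> l \<Longrightarrow> runs c s l s'"
  by (auto simp: runs_def intro: le_trans)

lemma exec_run: "loop_free c \<Longrightarrow> \<exists>t\<le>cost c. exec c s t (run c s)"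
proof (induction c arbitrary: s)
  case Skip
  show ?case unfolding cost.simps run.simps using exec.Skip by blast
next
  case (Put x i a)
  show ?case unfolding cost.simps run.simps using exec.Put by blast
next
  case (Seq c d)
  then obtain t u where "t \<le> cost c" "exec c s t (run c s)" "u \<le> cost d" "exec d (run c s) u (run d (run c s))"
    by force
  then show ?case by (intro exI[of _ "t + u"]) (auto intro: exec.Seq)
next
  case (If b c d)
  show ?case
  proof (cases "bval b s")
    case True
    obtain t where "t \<le> cost c" "exec c s t (run c s)" using If by force
    moreover from this have "exec (If b c d) s (1 + t) (run c s)" using True by (intro exec.IfTrue)
    ultimately show ?thesis using True by (intro exI[of _ "1 + t"]) auto
  next
    case False
    obtain t where "t \<le> cost d" "exec d s t (run d s)" using If by force
    moreover from this have "exec (If b c d) s (1 + t) (run d s)" using False by (intro exec.IfFalse)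
    ultimately show ?thesis using False by (intro exI[of _ "1 + t"]) auto
  qed
qed simp

lemma runs_line: "loop_free c \<Longrightarrow> 100 \<le> W \<Longrightarrow> cost c \<le> 100 \<Longrightarrow> runs c s (W ^ 1) (run c s)"
  using exec_run[of c s] unfolding runs_def power_one_right by (meson le_trans)

text \<open>Two summands below a power of \<open>W\<close> sum to less than the next power, so
  exponents are raised generously and never computed exactly.\<close>

lemma runs_Seq:
  assumes "runs c s (W ^ k) s1" "runs d s1 (W ^ l) s2" "100 \<le> W" "k < m" "l < m"
  shows "runs (Seq c d) s (W ^ m) s2"
proof -
  obtain t u where tu: "t \<le> W ^ k" "exec c s t s1" "u \<le> W ^ l" "exec d s1 u s2"
    using assms by (auto simp: runs_def)
  obtain m' where m: "m = Suc m'" using assms(4) by (cases m) auto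
  have "t \<le> W ^ m'" "u \<le> W ^ m'"
    using tu assms m by (auto intro: le_trans[OF _ power_increasing])
  then have "t + u \<le> 2 * W ^ m'" by simp
  also have "\<dots> \<le> W ^ m" using assms(3) by (simp add: m)
  finally show ?thesis using tu unfolding runs_def by (auto intro: exec.Seq)
qed

lemma runs_If:
  assumes "bval b s \<Longrightarrow> runs c s (W ^ k) s'" "\<not> bval b s \<Longrightarrow> runs d s (W ^ k) s'" "100 \<le> W" "k < m"
  shows "runs (If b c d) s (W ^ m) s'"
proof -
  obtain m' where m: "m = Suc m'" using assms(4) by (cases m) auto
  have le: "1 + t \<le> W ^ m" if "t \<le> W ^ k" for t
  proof -
    have "t \<le> W ^ m'" using that assms m by (auto intro: le_trans[OF _ power_increasing])
    moreover have "1 \<le> W ^ m'" using assms(3) by simp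
    ultimately have "1 + t \<le> 2 * W ^ m'" by linarith
    also have "\<dots> \<le> W ^ m" using assms(3) by (simp add: m)
    finally show ?thesis .
  qed
  show ?thesis
  proof (cases "bval b s")
    case True
    then show ?thesis using assms(1) le unfolding runs_def by (metis exec.IfTrue)
  next
    case False
    then show ?thesis using assms(2) le unfolding runs_def by (metis exec.IfFalse)
  qed
qed

lemma while_exec:
  assumes "I s" "\<And>s. I s \<Longrightarrow> bval b s \<Longrightarrow> \<exists>s'. runs c s K s' \<and> I s' \<and> \<mu> s' < (\<mu> s :: nat)"
  shows "\<exists>s'. runs (While b c) s ((K + 1) * \<mu> s + 1) s' \<and> I s' \<and> \<not> bval b s'"
  using assms(1)
proof (induction "\<mu> s" arbitrary: s rule: less_induct)
  case less
  show ?case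
  proof (cases "bval b s")
    case True
    then obtain s1 where s1: "runs c s K s1" "I s1" "\<mu> s1 < \<mu> s" using assms(2) less by blast
    then obtain s2 where s2: "runs (While b c) s1 ((K + 1) * \<mu> s1 + 1) s2" "I s2" "\<not> bval b s2"
      using less by blast
    obtain t u where tu: "t \<le> K" "exec c s t s1" "u \<le> (K + 1) * \<mu> s1 + 1" "exec (While b c) s1 u s2"
      using s1 s2 by (auto simp: runs_def)
    have "1 + t + u \<le> (K + 1) * (\<mu> s1 + 1) + 1" using tu by (simp add: algebra_simps)
    also have "\<dots> \<le> (K + 1) * \<mu> s + 1"
      using s1(3) by (intro add_mono mult_mono) auto
    finally show ?thesis using s2 exec.WhileTrue[OF True tu(2,4)] unfolding runs_def by blast
  next
    case False
    then show ?thesis using less exec.WhileFalse[OF False, of c] unfolding runs_def by force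
  qed
qed

text \<open>The step may assume that variables outside \<open>mods c\<close> still have their values
  from before the loop, and has to restore the invariant only under the frame condition of the body.
  Invariants thus need not list unchanged variables. The total time is at most
  \<open>3 * W ^ (j + k)\<close>, whence the requirement on \<open>m\<close>.\<close>

lemma runs_While:
  assumes "I s" and W: "100 \<le> W" and mu: "\<mu> s \<le> W ^ j" and m: "j + k + 1 < m"
    and step: "\<And>t. I t \<Longrightarrow> frame (mods c) s t \<Longrightarrow> bval b t
      \<Longrightarrow> \<exists>t'. runs c t (W ^ k) t' \<and> (frame (mods c) t t' \<longrightarrow> I t' \<and> \<mu> t' < (\<mu> t :: nat))"
  obtains s' where "runs (While b c) s (W ^ m) s'" "I s'" "\<not> bval b s'" "frame (mods c) s s'"
proof -
  have "\<exists>s'. runs (While b c) s ((W ^ k + 1) * \<mu> s + 1) s' \<and> (I s' \<and> frame (mods c) s s') \<and> \<not> bval b s'"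
  proof (rule while_exec)
    show "I s \<and> frame (mods c) s s" using assms(1) by simp
    fix t assume t: "I t \<and> frame (mods c) s t" "bval b t"
    then obtain t' where t': "runs c t (W ^ k) t'" "frame (mods c) t t' \<longrightarrow> I t' \<and> \<mu> t' < \<mu> t"
      using step by blast
    then show "\<exists>t'. runs c t (W ^ k) t' \<and> (I t' \<and> frame (mods c) s t') \<and> \<mu> t' < \<mu> t"
      using t runs_frame[OF t'(1)] frame_trans by blast
  qed
  then obtain s' where s': "runs (While b c) s ((W ^ k + 1) * \<mu> s + 1) s'" "I s'" "frame (mods c) s s'" "\<not> bval b s'"
    by blast
  have k1: "1 \<le> W ^ k" "1 \<le> W ^ j" using W by simp_all
  have "(W ^ k + 1) * \<mu> s + 1 \<le> (2 * W ^ k) * W ^ j + W ^ k * W ^ j"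
    using mu k1 by (intro add_mono mult_mono) (auto simp: Suc_leI)
  also have "\<dots> = 3 * W ^ (j + k)" by (simp add: power_add)
  also have "\<dots> \<le> W ^ (j + k + 1)" using W by simp
  also have "\<dots> \<le> W ^ m" using W m by (intro power_increasing) auto
  finally show ?thesis using that s' runs_mono by blast
qed

abbreviation V :: "vname \<Rightarrow> aexp" where "V x \<equiv> Get x (N 0)"

section \<open>Counting loops\<close>

definition For :: "vname \<Rightarrow> vname \<Rightarrow> com \<Rightarrow> com" where
  "For i l c = Seq (Put i (N 0) (N 0)) (While (Less (V i) (V l)) (Seq c (Put i (N 0) (Plus (V i) (N 1)))))"

lemma mods_For [simp]: "mods (For i l c) = insert i (mods c)"
  by (auto simp: For_def)

lemma runs_For:
  assumes W: "100 \<le> W" and L: "s l 0 \<le> W" and ilc: "i \<notin> mods c" "l \<notin> mods c" "l \<noteq> i"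
    and m: "k + 4 < m"
    and init: "J 0 (s(i := (s i)(0 := 0)))"
    and step: "\<And>j t. j < s l 0 \<Longrightarrow> t i 0 = j \<Longrightarrow> frame (insert i (mods c)) s t \<Longrightarrow> J j t \<Longrightarrow>
      \<exists>t'. runs c t (W ^ k) t' \<and> (frame (mods c) t t' \<longrightarrow> J (Suc j) (t'(i := (t' i)(0 := Suc j))))"
  obtains s' where "runs (For i l c) s (W ^ m) s'" "J (s l 0) s'" "s' i 0 = s l 0"
    "frame (insert i (mods c)) s s'"
proof -
  let ?s0 = "s(i := (s i)(0 := 0))"
  let ?b = "Less (V i) (V l)"
  let ?c = "Seq c (Put i (N 0) (Plus (V i) (N 1)))"
  let ?I = "\<lambda>t. J (t i 0) t \<and> t i 0 \<le> s l 0 \<and> t l 0 = s l 0"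
  obtain s' where s': "runs (While ?b ?c) ?s0 (W ^ (k + 4)) s'" "?I s'" "\<not> bval ?b s'" "frame (mods ?c) ?s0 s'"
  proof (rule runs_While[of ?I ?s0 W "\<lambda>t. s l 0 - t i 0" 1 "k + 1" "k + 4" ?c ?b])
    show "?I ?s0" using init ilc by simp
    show "100 \<le> W" by (rule W)
    show "s l 0 - ?s0 i 0 \<le> W ^ 1" using L by simp
    show "1 + (k + 1) + 1 < k + 4" by simp
  next
    fix t assume t: "?I t" "frame (mods ?c) ?s0 t" "bval ?b t"
    have "frame (insert i (mods c)) s t" using t(2) by (auto simp: frame_def)
    then obtain t1 where t1: "runs c t (W ^ k) t1"
      "frame (mods c) t t1 \<longrightarrow> J (Suc (t i 0)) (t1(i := (t1 i)(0 := Suc (t i 0))))"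
      using step[of "t i 0" t] t by auto
    have f1: "frame (mods c) t t1" using t1 runs_frame by blast
    have ti: "t1 i = t i" "t1 l = t l" using f1 ilc by (auto simp: frame_def)
    let ?t2 = "t1(i := (t1 i)(0 := Suc (t i 0)))"
    have "runs (Put i (N 0) (Plus (V i) (N 1))) t1 1 ?t2"
      using exec.Put[of i "N 0" "Plus (V i) (N 1)" t1] ti by (auto simp: runs_def)
    then have "runs (Put i (N 0) (Plus (V i) (N 1))) t1 (W ^ 0) ?t2" by simp
    then have "runs ?c t (W ^ (k + 1)) ?t2" using t1(1) W by (intro runs_Seq[where k = k and l = 0]) auto
    moreover have "?I ?t2 \<and> s l 0 - ?t2 i 0 < s l 0 - t i 0"
      using t1 f1 t ti ilc by auto
    ultimately show "\<exists>t'. runs ?c t (W ^ (k + 1)) t' \<and>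
      (frame (mods ?c) t t' \<longrightarrow> ?I t' \<and> s l 0 - t' i 0 < s l 0 - t i 0)" by blast
  qed
  have "runs (Put i (N 0) (N 0)) s (W ^ 0) ?s0"
    using exec.Put[of i "N 0" "N 0" s] by (auto simp: runs_def)
  then have "runs (For i l c) s (W ^ m) s'"
    unfolding For_def using s'(1) W m by (rule_tac runs_Seq[where k = 0 and l = "k + 4"]) auto
  moreover have "s' i 0 = s l 0" using s'(2,3) by simp
  moreover have "frame (insert i (mods c)) s s'" using s'(4) by (auto simp: frame_def)
  ultimately show ?thesis using that s'(2) by metis
qed

definition Fill :: "vname \<Rightarrow> vname \<Rightarrow> com \<Rightarrow> vname \<Rightarrow> aexp \<Rightarrow> vname \<Rightarrow> com" where
  "Fill i l B X off t = For i l (Seq B (Put X (Plus off (V i)) (V t)))"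

lemma mods_Fill [simp]: "mods (Fill i l B X off t) = insert i (insert X (mods B))"
  by (auto simp: Fill_def)

text \<open>The hypothesis \<open>val\<close> offers that the cells of \<open>X\<close> not yet
  written hold their old values. This lets the body read the array that is being filled, as when a
  row of \<open>T\<close> is copied within \<open>T\<close>, or when \<open>R\<close> is renamed in
  place.\<close>

lemma runs_Fill:
  assumes W: "100 \<le> W" and L: "s l 0 \<le> W" and B: "loop_free B" "cost B \<le> 99"
    and d: "i \<notin> mods B" "l \<notin> mods B" "l \<noteq> i" "X \<notin> mods B" "X \<noteq> i" "X \<noteq> l" "t \<noteq> X"
    and off: "\<And>u. frame (insert i (insert X (mods B))) s u \<Longrightarrow> aval off u = p"
    and val: "\<And>j u. j < s l 0 \<Longrightarrow> u i 0 = j \<Longrightarrow> frame (insert i (insert X (mods B))) s u \<Longrightarrow>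
      (\<forall>k. k < p \<or> p + j \<le> k \<longrightarrow> u X k = s X k) \<Longrightarrow> run B u t 0 = val j"
  obtains s' where "runs (Fill i l B X off t) s (W ^ 6) s'"
    "s' X = (\<lambda>k. if p \<le> k \<and> k < p + s l 0 then val (k - p) else s X k)"
    "frame (insert i (insert X (mods B))) s s'"
proof -
  let ?c = "Seq B (Put X (Plus off (V i)) (V t))"
  let ?J = "\<lambda>j u. u X = (\<lambda>k. if p \<le> k \<and> k < p + j then val (k - p) else s X k)"
  obtain s' where s': "runs (For i l ?c) s (W ^ 6) s'" "?J (s l 0) s'" "s' i 0 = s l 0"
    "frame (insert i (mods ?c)) s s'"
  proof (rule runs_For[of W s l i ?c 1 6 ?J])
    fix j u assume u: "j < s l 0" "u i 0 = j" "frame (insert i (mods ?c)) s u" "?J j u"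
    have fr: "frame (insert i (insert X (mods B))) s u" using u(3) by (auto simp: frame_def)
    have v: "run B u t 0 = val j" using val[OF u(1,2) fr] u(4) by simp
    have "exec B u t' (run B u) \<Longrightarrow> frame (mods B) u (run B u)" for t' by (rule exec_frame)
    then have fB: "frame (mods B) u (run B u)" using exec_run[OF B(1)] by blast
    have "frame (insert i (insert X (mods B))) s (run B u)"
      using fr fB by (auto simp: frame_def)
    then have o: "aval off (run B u) = p" by (rule off)
    have i: "run B u i = u i" "run B u X = u X" using fB d by (auto simp: frame_def)
    have "runs ?c u (W ^ 1) (run ?c u)" using B W by (intro runs_line) auto
    moreover have "?J (Suc j) ((run ?c u)(i := (run ?c u i)(0 := Suc j)))"
      using u(2,4) v o i d by (auto simp: fun_eq_iff)
    ultimately show "\<exists>t'. runs ?c u (W ^ 1) t' \<and>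
      (frame (mods ?c) u t' \<longrightarrow> ?J (Suc j) (t'(i := (t' i)(0 := Suc j))))" by blast
  qed (use W L d in \<open>auto simp: fun_eq_iff\<close>)
  then show ?thesis using that[of s'] by (auto simp: Fill_def insert_commute)
qed

subsection \<open>Edge degree constrained subgraphs by local search\<close>

text \<open>Sets of edges are represented by positions in the list, since the program marks edges by
  index; \<open>deg_card\<close> translates to degrees in a graph.\<close>

definition deg :: "(nat \<times> nat) list \<Rightarrow> nat set \<Rightarrow> nat \<Rightarrow> nat" where
  "deg es I v = card {j \<in> I. v = fst (es ! j) \<or> v = snd (es ! j)}"

text \<open>The coefficient is centred between the two kinds of violation. Inserting an edge with
  degree sum \<open>D \<le> \<beta> - 2\<close> gains \<open>2 * \<beta> - 3 - 2 * D\<close>,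
  deleting one with degree sum \<open>D \<ge> \<beta> + 1\<close> gains
  \<open>2 * D - 2 * \<beta> - 1\<close>; both are at least 1. With the lower bound \<beta> instead
  of \<open>\<beta> - 1\<close> an inserted edge could be violated at once.\<close>

definition potential :: "nat \<Rightarrow> nat \<Rightarrow> (nat \<times> nat) list \<Rightarrow> nat set \<Rightarrow> int" where
  "potential \<beta> n es I = (2 * int \<beta> - 1) * int (card I) - (\<Sum>v<n. (int (deg es I v))\<^sup>2)"

definition proper_edges :: "nat \<Rightarrow> (nat \<times> nat) list \<Rightarrow> bool" where
  "proper_edges n es \<longleftrightarrow> (\<forall>j<length es. fst (es ! j) < n \<and> snd (es ! j) < n \<and> fst (es ! j) \<noteq> snd (es ! j))"

lemma deg_insert:
  assumes "finite I" "j \<notin> I"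
  shows "deg es (insert j I) v = deg es I v + (if v = fst (es ! j) \<or> v = snd (es ! j) then 1 else 0)"
proof -
  let ?P = "\<lambda>j. v = fst (es ! j) \<or> v = snd (es ! j)"
  have "{i \<in> insert j I. ?P i} = (if ?P j then insert j {i \<in> I. ?P i} else {i \<in> I. ?P i})" by auto
  then show ?thesis using assms by (auto simp: deg_def)
qed

lemma potential_insert:
  assumes "finite I" "j \<notin> I" "proper_edges n es" "j < length es"
  shows "potential \<beta> n es (insert j I) = potential \<beta> n es I + 2 * int \<beta> - 3
    - 2 * (int (deg es I (fst (es ! j))) + int (deg es I (snd (es ! j))))"
proof -
  let ?a = "fst (es ! j)" and ?b = "snd (es ! j)"
  have ab: "?a < n" "?b < n" "?a \<noteq> ?b" using assms by (auto simp: proper_edges_def)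
  have "(\<Sum>v<n. (int (deg es (insert j I) v))\<^sup>2) = (\<Sum>v<n. (int (deg es I v))\<^sup>2
      + ((if v = ?a then 2 * int (deg es I ?a) + 1 else 0) + (if v = ?b then 2 * int (deg es I ?b) + 1 else 0)))"
    using ab assms by (intro sum.cong refl) (auto simp: deg_insert power2_eq_square algebra_simps)
  also have "\<dots> = (\<Sum>v<n. (int (deg es I v))\<^sup>2) + (2 * int (deg es I ?a) + 1) + (2 * int (deg es I ?b) + 1)"
    using ab by (simp add: sum.distrib)
  finally show ?thesis using assms by (simp add: potential_def algebra_simps)
qed

lemma potential_le:
  assumes "I \<subseteq> {..<length es}"
  shows "potential \<beta> n es I \<le> 2 * int \<beta> * int (length es)"
proof -
  have "card I \<le> length es" using assms card_mono[of "{..<length es}" I] by simp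
  then have "(2 * int \<beta>) * int (card I) \<le> (2 * int \<beta>) * int (length es)" by (intro mult_left_mono) auto
  moreover have "0 \<le> (\<Sum>v<n. (int (deg es I v))\<^sup>2)" by (simp add: sum_nonneg)
  ultimately show ?thesis unfolding potential_def left_diff_distrib by linarith
qed

lemma handshake:
  assumes "I \<subseteq> {..<length es}" "proper_edges n es"
  shows "(\<Sum>v<n. deg es I v) = 2 * card I"
proof -
  have "finite I" using assms finite_subset by blast
  then show ?thesis using assms(1)
  proof (induction I rule: finite_induct)
    case empty
    then show ?case by (simp add: deg_def)
  next
    case (insert j I)
    let ?a = "fst (es ! j)" and ?b = "snd (es ! j)"
    have ab: "?a < n" "?b < n" "?a \<noteq> ?b" using assms insert by (auto simp: proper_edges_def)
    have "(\<Sum>v<n. deg es (insert j I) v)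
        = (\<Sum>v<n. deg es I v + ((if v = ?a then 1 else 0) + (if v = ?b then 1 else 0)))"
      using ab insert by (intro sum.cong refl) (auto simp: deg_insert)
    also have "\<dots> = (\<Sum>v<n. deg es I v) + 2" using ab by (simp add: sum.distrib)
    finally show ?case using insert by simp
  qed
qed

definition edge_constrained :: "nat \<Rightarrow> (nat \<times> nat) list \<Rightarrow> nat set \<Rightarrow> nat \<Rightarrow> bool" where
  "edge_constrained \<beta> es I j \<longleftrightarrow>
    (j \<in> I \<longrightarrow> deg es I (fst (es ! j)) + deg es I (snd (es ! j)) \<le> \<beta>) \<and>
    (j \<notin> I \<longrightarrow> \<beta> \<le> deg es I (fst (es ! j)) + deg es I (snd (es ! j)) + 1)"

text \<open>A change alters the degrees at edges already passed, so the scan starts again at index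
  0; otherwise it moves on. Reaching the end of the list certifies all constraints.\<close>

definition toggle :: com where
  "toggle = Seq (Put ''u'' (N 0) (Get ''edges_fst'' (V ''i''))) (Seq (Put ''v'' (N 0) (Get ''edges_snd'' (V ''i'')))
    (Seq (Put ''x'' (N 0) (Plus (Get ''d'' (V ''u'')) (Get ''d'' (V ''v''))))
    (If (And (Less (Get ''h'' (V ''i'')) (N 1)) (Less (Plus (V ''x'') (N 1)) (V ''b'')))
      (Seq (Put ''h'' (V ''i'') (N 1)) (Seq (Put ''d'' (V ''u'') (Plus (Get ''d'' (V ''u'')) (N 1)))
        (Seq (Put ''d'' (V ''v'') (Plus (Get ''d'' (V ''v'')) (N 1))) (Put ''i'' (N 0) (N 0)))))
    (If (And (Less (N 0) (Get ''h'' (V ''i''))) (Less (V ''b'') (V ''x'')))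
      (Seq (Put ''h'' (V ''i'') (N 0)) (Seq (Put ''d'' (V ''u'') (Minus (Get ''d'' (V ''u'')) (N 1)))
        (Seq (Put ''d'' (V ''v'') (Minus (Get ''d'' (V ''v'')) (N 1))) (Put ''i'' (N 0) (N 0)))))
      (Put ''i'' (N 0) (Plus (V ''i'') (N 1)))))))"

definition local_search :: com where
  "local_search = Seq (Put ''i'' (N 0) (N 0)) (While (Less (V ''i'') (V ''edges_len'')) toggle)"

text \<open>The number \<open>k\<close> of rounds is the least one with \<open>k * p \<ge> 3 * q\<close>, cut off at \<open>2 * n\<close> because \<open>q / p\<close> may be
  exponential in the input size. With \<open>\<beta> > 2 * n + 1\<close> the constraints force \<open>H\<close> to be Alice's whole graph.\<close>

definition choose_beta :: com where
  "choose_beta = Seq (Put ''z'' (N 0) (Plus (V ''q'') (Plus (V ''q'') (V ''q''))))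
    (Seq (Put ''y'' (N 0) (Plus (V ''n'') (V ''n'')))
    (Seq (While (And (Less (V ''a'') (V ''z'')) (Less (V ''k'') (V ''y'')))
      (Seq (Put ''a'' (N 0) (Plus (V ''a'') (V ''p''))) (Put ''k'' (N 0) (Plus (V ''k'') (N 1)))))
    (Put ''b'' (N 0) (Plus (V ''k'') (N 32)))))"

definition send_edges :: com where
  "send_edges = For ''i'' ''edges_len'' (If (Less (N 0) (Get ''h'' (V ''i'')))
    (Seq (Put ''out_fst'' (V ''out_len'') (Get ''edges_fst'' (V ''i'')))
    (Seq (Put ''out_snd'' (V ''out_len'') (Get ''edges_snd'' (V ''i'')))
      (Put ''out_len'' (N 0) (Plus (V ''out_len'') (N 1))))) Skip)"

definition alice :: com where
  "alice = Seq choose_beta (Seq local_search send_edges)"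

definition selected :: "state \<Rightarrow> nat \<Rightarrow> nat set" where
  "selected s m = {j. j < m \<and> s ''h'' j \<noteq> 0}"

definition search_inv :: "nat \<Rightarrow> (nat \<times> nat) list \<Rightarrow> state \<Rightarrow> bool" where
  "search_inv \<beta> es s \<longleftrightarrow> (\<forall>v. s ''d'' v = deg es (selected s (length es)) v) \<and> s ''i'' 0 \<le> length es
    \<and> (\<forall>j<s ''i'' 0. edge_constrained \<beta> es (selected s (length es)) j)"

lemma load_edges_push:
  assumes "s' ''out_len'' 0 = Suc (s ''out_len'' 0)"
    "s' ''out_fst'' = (s ''out_fst'')(s ''out_len'' 0 := a)" "s' ''out_snd'' = (s ''out_snd'')(s ''out_len'' 0 := b)"
  shows "load_edges ''out'' s' = load_edges ''out'' s @ [(a, b)]"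
  using assms by (auto simp: load_edges_def)

lemma load_edges_cong:
  assumes "s' (x @ ''_len'') = s (x @ ''_len'')" "s' (x @ ''_fst'') = s (x @ ''_fst'')"
    "s' (x @ ''_snd'') = s (x @ ''_snd'')"
  shows "load_edges x s' = load_edges x s"
  using assms by (simp add: load_edges_def)

lemma load_edges_nth:
  "i < s (x @ ''_len'') 0 \<Longrightarrow> load_edges x s ! i = (s (x @ ''_fst'') i, s (x @ ''_snd'') i)"
  by (simp add: load_edges_def)

lemma length_load_edges [simp]: "length (load_edges x s) = s (x @ ''_len'') 0"
  by (simp add: load_edges_def)

lemma toggle_step:
  assumes es: "load_edges ''edges'' s = es" "proper_edges n es" and b: "s ''b'' 0 = \<beta>" "1 \<le> \<beta>"
    and inv: "search_inv \<beta> es s" and i: "s ''i'' 0 < length es"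
  shows "search_inv \<beta> es (run toggle s)"
    and "potential \<beta> n es (selected (run toggle s) (length es)) > potential \<beta> n es (selected s (length es))
      \<or> selected (run toggle s) (length es) = selected s (length es) \<and> run toggle s ''i'' 0 = Suc (s ''i'' 0)"
proof -
  let ?m = "length es" and ?i = "s ''i'' 0"
  let ?I = "selected s ?m"
  let ?u = "fst (es ! ?i)" and ?v = "snd (es ! ?i)"
  have len: "s ''edges_len'' 0 = ?m" using es(1) by (auto simp: load_edges_def)
  have "es ! ?i = (s ''edges_fst'' ?i, s ''edges_snd'' ?i)"
    using load_edges_nth[of ?i s "''edges''"] es(1) i len by simp
  then have uv: "s ''edges_fst'' ?i = ?u" "s ''edges_snd'' ?i = ?v" by auto
  have ne: "?u \<noteq> ?v" using es(2) i by (auto simp: proper_edges_def)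
  have d: "s ''d'' v = deg es ?I v" for v using inv by (simp add: search_inv_def)
  have fin: "finite ?I" by (simp add: selected_def)
  have inI: "?i \<in> ?I \<longleftrightarrow> s ''h'' ?i \<noteq> 0" using i by (simp add: selected_def)
  let ?x = "deg es ?I ?u + deg es ?I ?v"
  consider (ins) "s ''h'' ?i = 0" "?x + 1 < \<beta>" | (del) "s ''h'' ?i \<noteq> 0" "\<beta> < ?x"
    | (ok) "edge_constrained \<beta> es ?I ?i"
    unfolding edge_constrained_def using inI by linarith
  then have "search_inv \<beta> es (run toggle s) \<and>
     (potential \<beta> n es (selected (run toggle s) ?m) > potential \<beta> n es ?I
      \<or> selected (run toggle s) ?m = ?I \<and> run toggle s ''i'' 0 = Suc ?i)"
  proof cases
    case ins
    have r: "run toggle s ''h'' = (s ''h'')(?i := 1)" "run toggle s ''i'' 0 = 0"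
      "run toggle s ''d'' = (s ''d'')(?u := s ''d'' ?u + 1, ?v := s ''d'' ?v + 1)"
      using ins uv d b ne by (simp_all add: toggle_def)
    have sel: "selected (run toggle s) ?m = insert ?i ?I" using i by (auto simp: selected_def r)
    have ni: "?i \<notin> ?I" using ins inI by simp
    have "search_inv \<beta> es (run toggle s)"
    proof -
      have "run toggle s ''d'' v = deg es (insert ?i ?I) v" for v
        unfolding r(3) deg_insert[OF fin ni] using ne by (simp add: d)
      then show ?thesis unfolding search_inv_def sel r(2) by simp
    qed
    moreover have "int (deg es ?I ?u) + int (deg es ?I ?v) + 2 \<le> int \<beta>" using ins(2) by linarith
    then have "2 * (int (deg es ?I ?u) + int (deg es ?I ?v)) + 4 \<le> 2 * int \<beta>" by simp
    then have "potential \<beta> n es (insert ?i ?I) > potential \<beta> n es ?I"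
      unfolding potential_insert[OF fin ni es(2) i] by linarith
    ultimately show ?thesis using sel by simp
  next
    case del
    have r: "run toggle s ''h'' = (s ''h'')(?i := 0)" "run toggle s ''i'' 0 = 0"
      "run toggle s ''d'' = (s ''d'')(?u := s ''d'' ?u - 1, ?v := s ''d'' ?v - 1)"
      using del uv d b ne by (simp_all add: toggle_def)
    let ?I' = "?I - {?i}"
    have sel: "selected (run toggle s) ?m = ?I'" using i by (auto simp: selected_def r)
    have ni: "?i \<notin> ?I'" "finite ?I'" "insert ?i ?I' = ?I" using del inI fin by auto
    have dI: "deg es ?I v = deg es ?I' v + (if v = ?u \<or> v = ?v then 1 else 0)" for v
      using deg_insert[OF ni(2,1), of es v] ni(3) by simp
    have "search_inv \<beta> es (run toggle s)"
    proof -
      have "run toggle s ''d'' v = deg es ?I' v" for v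
        unfolding r(3) using dI[of v] ne by (auto simp: d)
      then show ?thesis unfolding search_inv_def sel r(2) by simp
    qed
    moreover have "int \<beta> + 1 \<le> int (deg es ?I' ?u) + int (deg es ?I' ?v) + 2"
      using del dI[of ?u] dI[of ?v] by simp
    then have "2 * int \<beta> \<le> 2 * (int (deg es ?I' ?u) + int (deg es ?I' ?v)) + 2" by simp
    then have "potential \<beta> n es ?I' > potential \<beta> n es ?I"
      using potential_insert[OF ni(2,1) es(2) i, of \<beta>] unfolding ni(3) by linarith
    ultimately show ?thesis using sel by simp
  next
    case ok
    have nc: "\<not> (s ''h'' ?i < 1 \<and> ?x + 1 < \<beta>)" "\<not> (0 < s ''h'' ?i \<and> \<beta> < ?x)"
      using ok inI by (auto simp: edge_constrained_def)
    have r: "run toggle s ''h'' = s ''h''" "run toggle s ''i'' 0 = Suc ?i" "run toggle s ''d'' = s ''d''"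
      using nc uv d b ne by (auto simp: toggle_def)
    have sel: "selected (run toggle s) ?m = ?I" by (auto simp: selected_def r)
    then have "search_inv \<beta> es (run toggle s)"
      using inv ok i by (auto simp: search_inv_def r less_Suc_eq)
    then show ?thesis using sel r by simp
  qed
  then show "search_inv \<beta> es (run toggle s)"
    "potential \<beta> n es (selected (run toggle s) (length es)) > potential \<beta> n es (selected s (length es))
      \<or> selected (run toggle s) (length es) = selected s (length es) \<and> run toggle s ''i'' 0 = Suc (s ''i'' 0)"
    by auto
qed

lemma local_search_runs:
  assumes W: "100 \<le> W" and es: "load_edges ''edges'' s = es" "proper_edges n es" and m: "length es \<le> W"
    and b: "s ''b'' 0 = \<beta>" "1 \<le> \<beta>" "\<beta> \<le> 3 * W"
    and z: "\<And>k. s ''h'' k = 0" "\<And>k. s ''d'' k = 0"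
  obtains s' where "runs local_search s (W ^ 10) s'" "frame {''i'', ''u'', ''v'', ''x'', ''h'', ''d''} s s'"
    "\<And>j. j < length es \<Longrightarrow> edge_constrained \<beta> es (selected s' (length es)) j"
proof -
  let ?m = "length es"
  let ?s0 = "s(''i'' := (s ''i'')(0 := 0))"
  have len: "s ''edges_len'' 0 = ?m" using es(1) by (auto simp: load_edges_def)
  have sel0: "selected ?s0 ?m = {}" using z by (simp add: selected_def)
  let ?I = "\<lambda>t. search_inv \<beta> es t"
  let ?pot = "\<lambda>t. nat (2 * int \<beta> * int ?m - potential \<beta> n es (selected t ?m))"
  \<comment> \<open>A lexicographic measure in one number: a change lowers \<open>?pot\<close>,
    which outweighs the reset of the scan by up to \<open>?m\<close> positions.\<close>
  let ?\<mu> = "\<lambda>t. ?pot t * (?m + 1) + (?m - t ''i'' 0)"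
  have mt: "mods toggle = {''i'', ''u'', ''v'', ''x'', ''h'', ''d''}" by (auto simp: toggle_def)
  have psub: "selected t ?m \<subseteq> {..<?m}" for t by (auto simp: selected_def)
  obtain s' where s': "runs (While (Less (V ''i'') (V ''edges_len'')) toggle) ?s0 (W ^ 9) s'" "?I s'"
    "\<not> bval (Less (V ''i'') (V ''edges_len'')) s'" "frame (mods toggle) ?s0 s'"
  proof (rule runs_While[of ?I ?s0 W ?\<mu> 5 1 9 toggle "Less (V ''i'') (V ''edges_len'')"])
    show "?I ?s0" using sel0 z by (auto simp: search_inv_def deg_def)
    show "100 \<le> W" by (rule W)
    have "potential \<beta> n es {} = 0" by (simp add: potential_def deg_def)
    then have "?\<mu> ?s0 = 2 * \<beta> * ?m * (?m + 1) + ?m" by (simp only: sel0) (simp add: nat_mult_distrib)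
    also have "\<dots> \<le> 2 * (3 * W) * W * (2 * W) + W"
      using b m W by (intro add_mono mult_mono) auto
    also have "\<dots> \<le> W ^ 5"
    proof -
      have "12 * W ^ 3 + W \<le> 13 * W ^ 3" using W by (simp add: power3_eq_cube)
      also have "\<dots> \<le> W ^ 2 * W ^ 3"
        using W mult_le_mono[of 13 W 1 W] by (intro mult_right_mono) (auto simp: power2_eq_square)
      finally show ?thesis by (simp add: power3_eq_cube numeral_eq_Suc algebra_simps)
    qed
    finally show "?\<mu> ?s0 \<le> W ^ 5" .
    show "5 + 1 + 1 < (9::nat)" by simp
  next
    fix t assume t: "?I t" "frame (mods toggle) ?s0 t" "bval (Less (V ''i'') (V ''edges_len'')) t"
    have f: "t ''edges_len'' = s ''edges_len''" "t ''edges_fst'' = s ''edges_fst''"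
      "t ''edges_snd'' = s ''edges_snd''" "t ''b'' = s ''b''"
      using t(2) by (auto simp: frame_def mt)
    have l: "load_edges ''edges'' t = es" using es(1) f by (simp add: load_edges_def)
    have ti: "t ''i'' 0 < ?m" using t(3) f len by simp
    note st = toggle_step[OF l es(2) _ b(2) t(1) ti]
    have bt: "t ''b'' 0 = \<beta>" using f b by simp
    have "runs toggle t (W ^ 1) (run toggle t)" using W by (intro runs_line) (auto simp: toggle_def)
    moreover have "?\<mu> (run toggle t) < ?\<mu> t"
      using st(2)[OF bt]
    proof
      assume lt: "potential \<beta> n es (selected t ?m) < potential \<beta> n es (selected (run toggle t) ?m)"
      have "?pot (run toggle t) + 1 \<le> ?pot t"
        using lt potential_le[OF psub, of \<beta> n "run toggle t"] by linarith
      then have "(?pot (run toggle t) + 1) * (?m + 1) \<le> ?pot t * (?m + 1)" by (rule mult_right_mono) simp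
      then have "?pot (run toggle t) * (?m + 1) + (?m + 1) \<le> ?pot t * (?m + 1)"
        by (simp only: add_mult_distrib mult_1)
      then show ?thesis by linarith
    next
      assume "selected (run toggle t) ?m = selected t ?m \<and> run toggle t ''i'' 0 = Suc (t ''i'' 0)"
      then show ?thesis using ti by simp
    qed
    ultimately show "\<exists>t'. runs toggle t (W ^ 1) t' \<and> (frame (mods toggle) t t' \<longrightarrow> ?I t' \<and> ?\<mu> t' < ?\<mu> t)"
      using st(1)[OF bt] by blast
  qed
  have "runs (Put ''i'' (N 0) (N 0)) s (W ^ 1) (run (Put ''i'' (N 0) (N 0)) s)" using W by (intro runs_line) auto
  from runs_Seq[OF this _ W] have "runs local_search s (W ^ 10) s'"
    unfolding local_search_def using s'(1) by simp
  moreover have f: "frame {''i'', ''u'', ''v'', ''x'', ''h'', ''d''} s s'"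
    using s'(4) by (auto simp: frame_def mt)
  moreover have "edge_constrained \<beta> es (selected s' ?m) j" if "j < ?m" for j
  proof -
    have "s' ''edges_len'' 0 = ?m" using f len by (simp add: frame_def)
    then have "?m \<le> s' ''i'' 0" using s'(3) by simp
    then show ?thesis using s'(2) that by (simp add: search_inv_def)
  qed
  ultimately show ?thesis using that by blast
qed

text \<open>The variable \<open>a\<close> holds \<open>k * p\<close> by repeated addition. The loop
  is left as soon as \<open>a\<close> reaches \<open>3 * q\<close>, so it overshoots by less than
  \<open>p\<close>; this last bound limits the communication, while reaching \<open>3 * q\<close>
  controls the approximation.\<close>

lemma choose_beta_runs:
  assumes W: "100 \<le> W" and n: "s ''n'' 0 = n" "2 * n \<le> W" and pq: "s ''p'' 0 = p" "s ''q'' 0 = q" "0 < p"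
    and z: "s ''a'' 0 = 0" "s ''k'' 0 = 0"
  obtains s' k where "runs choose_beta s (W ^ 7) s'" "frame {''z'', ''y'', ''a'', ''k'', ''b''} s s'"
    "s' ''b'' 0 = k + 32" "k \<le> 2 * n" "3 * q \<le> k * p \<or> k = 2 * n" "k * p < 3 * q + p"
proof -
  let ?c = "Seq (Put ''a'' (N 0) (Plus (V ''a'') (V ''p''))) (Put ''k'' (N 0) (Plus (V ''k'') (N 1)))"
  let ?b = "And (Less (V ''a'') (V ''z'')) (Less (V ''k'') (V ''y''))"
  let ?i1 = "Put ''z'' (N 0) (Plus (V ''q'') (Plus (V ''q'') (V ''q'')))"
  let ?i2 = "Put ''y'' (N 0) (Plus (V ''n'') (V ''n''))"
  let ?i3 = "Put ''b'' (N 0) (Plus (V ''k'') (N 32))"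
  let ?s0 = "run ?i2 (run ?i1 s)"
  let ?I = "\<lambda>t. t ''a'' 0 = t ''k'' 0 * p \<and> t ''k'' 0 \<le> 2 * n \<and> t ''a'' 0 < 3 * q + p"
  obtain s1 where s1: "runs (While ?b ?c) ?s0 (W ^ 4) s1" "?I s1" "\<not> bval ?b s1" "frame (mods ?c) ?s0 s1"
  proof (rule runs_While[of ?I ?s0 W "\<lambda>t. 2 * n - t ''k'' 0" 1 1 4 ?c ?b])
    show "?I ?s0" using z pq by simp
    show "2 * n - ?s0 ''k'' 0 \<le> W ^ 1" using n by simp
  next
    fix t assume t: "?I t" "frame (mods ?c) ?s0 t" "bval ?b t"
    have f: "t ''p'' 0 = p" "t ''z'' 0 = 3 * q" "t ''y'' 0 = 2 * n"
      using t(2) pq n by (auto simp: frame_def)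
    have "runs ?c t (W ^ 1) (run ?c t)" using W by (intro runs_line) auto
    moreover have "?I (run ?c t) \<and> 2 * n - run ?c t ''k'' 0 < 2 * n - t ''k'' 0"
      using t f by auto
    ultimately show "\<exists>t'. runs ?c t (W ^ 1) t' \<and>
      (frame (mods ?c) t t' \<longrightarrow> ?I t' \<and> 2 * n - t' ''k'' 0 < 2 * n - t ''k'' 0)" by blast
  qed (use W in auto)
  let ?s' = "run ?i3 s1"
  have r: "runs ?i1 s (W ^ 1) (run ?i1 s)" "runs ?i2 (run ?i1 s) (W ^ 1) ?s0" "runs ?i3 s1 (W ^ 1) ?s'"
    using W by (intro runs_line; simp)+
  have "runs (Seq (While ?b ?c) ?i3) ?s0 (W ^ 5) ?s'"
    using s1(1) r(3) W by (rule runs_Seq) auto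
  from runs_Seq[OF r(2) this W] have "runs (Seq ?i2 (Seq (While ?b ?c) ?i3)) (run ?i1 s) (W ^ 6) ?s'"
    by simp
  from runs_Seq[OF r(1) this W] have "runs choose_beta s (W ^ 7) ?s'"
    unfolding choose_beta_def by simp
  moreover have "frame {''z'', ''y'', ''a'', ''k'', ''b''} s ?s'" using s1(4) by (auto simp: frame_def)
  moreover have "s1 ''z'' 0 = 3 * q" "s1 ''y'' 0 = 2 * n" using s1(4) pq n by (auto simp: frame_def)
  then have "3 * q \<le> s1 ''k'' 0 * p \<or> s1 ''k'' 0 = 2 * n" using s1(2,3) by auto
  ultimately show ?thesis using that[of ?s' "s1 ''k'' 0"] s1(2) by auto
qed

lemma send_edges_runs:
  assumes W: "100 \<le> W" and es: "load_edges ''edges'' s = es" and m: "length es \<le> W"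
    and z: "s ''out_len'' 0 = 0"
  obtains s' where "runs send_edges s (W ^ 6) s'"
    "load_edges ''out'' s' = map ((!) es) (filter (\<lambda>j. j \<in> selected s (length es)) [0..<length es])"
proof -
  let ?m = "length es"
  let ?c = "If (Less (N 0) (Get ''h'' (V ''i'')))
    (Seq (Put ''out_fst'' (V ''out_len'') (Get ''edges_fst'' (V ''i'')))
    (Seq (Put ''out_snd'' (V ''out_len'') (Get ''edges_snd'' (V ''i'')))
      (Put ''out_len'' (N 0) (Plus (V ''out_len'') (N 1))))) Skip"
  let ?P = "\<lambda>j. j \<in> selected s ?m"
  have len: "s ''edges_len'' 0 = ?m" using es(1) by (auto simp: load_edges_def)
  let ?J = "\<lambda>j t. load_edges ''out'' t = map ((!) es) (filter ?P [0..<j])"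
  obtain s' where "runs (For ''i'' ''edges_len'' ?c) s (W ^ 6) s'" "?J (s ''edges_len'' 0) s'"
  proof (rule runs_For[of W s "''edges_len''" "''i''" ?c 1 6 ?J])
    show "?J 0 (s(''i'' := (s ''i'')(0 := 0)))" using z by (simp add: load_edges_def)
  next
    fix j t assume t: "j < s ''edges_len'' 0" "t ''i'' 0 = j" "frame (insert ''i'' (mods ?c)) s t" "?J j t"
    have f: "t ''h'' = s ''h''" "t ''edges_fst'' = s ''edges_fst''" "t ''edges_snd'' = s ''edges_snd''"
      using t(3) by (auto simp: frame_def)
    have ej: "es ! j = (s ''edges_fst'' j, s ''edges_snd'' j)"
      using load_edges_nth[of j s "''edges''"] es(1) t(1) by simp
    have P: "?P j \<longleftrightarrow> 0 < t ''h'' j" using t(1) f len by (simp add: selected_def)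
    let ?t' = "(run ?c t)(''i'' := (run ?c t ''i'')(0 := Suc j))"
    have "?J (Suc j) ?t'"
    proof (cases "?P j")
      case True
      have "load_edges ''out'' ?t' = load_edges ''out'' t @ [es ! j]"
        unfolding ej by (rule load_edges_push) (use True P f t(2) in auto)
      then show ?thesis using t(4) True by simp
    next
      case False
      have "load_edges ''out'' ?t' = load_edges ''out'' t"
        by (rule load_edges_cong) (use False P t(2) in auto)
      then show ?thesis using t(4) False by simp
    qed
    moreover have "runs ?c t (W ^ 1) (run ?c t)" using W by (intro runs_line) auto
    ultimately show "\<exists>t'. runs ?c t (W ^ 1) t' \<and>
      (frame (mods ?c) t t' \<longrightarrow> ?J (Suc j) (t'(''i'' := (t' ''i'')(0 := Suc j))))" by blast
  qed (use W m len in auto)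
  then show ?thesis using that len by (auto simp: send_edges_def)
qed

lemma alice_runs:
  assumes W: "100 \<le> W" "2 * n \<le> W" "length es \<le> W" and es: "proper_edges n es" and p: "0 < p"
  obtains s' I k where "runs alice (alice_input n p q es) (W ^ 12) s'"
    "load_edges ''out'' s' = map ((!) es) (filter (\<lambda>j. j \<in> I) [0..<length es])"
    "I \<subseteq> {..<length es}" "\<And>j. j < length es \<Longrightarrow> edge_constrained (k + 32) es I j"
    "k \<le> 2 * n" "3 * q \<le> k * p \<or> k = 2 * n" "k * p < 3 * q + p"
proof -
  let ?s = "alice_input n p q es"
  have in0: "?s ''n'' 0 = n" "?s ''p'' 0 = p" "?s ''q'' 0 = q" "?s ''a'' 0 = 0" "?s ''k'' 0 = 0"
    by (simp_all add: alice_input_def store_edges_def store_def)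
  have ld: "load_edges ''edges'' ?s = es"
    by (auto simp: alice_input_def store_edges_def store_def load_edges_def intro!: nth_equalityI)
  obtain s1 k where s1: "runs choose_beta ?s (W ^ 7) s1" "frame {''z'', ''y'', ''a'', ''k'', ''b''} ?s s1"
    "s1 ''b'' 0 = k + 32" "k \<le> 2 * n" "3 * q \<le> k * p \<or> k = 2 * n" "k * p < 3 * q + p"
    by (rule choose_beta_runs[of W ?s n p q, OF W(1) in0(1) W(2) in0(2,3) p in0(4,5)])
  have z1: "s1 ''h'' j = 0" "s1 ''d'' j = 0" "s1 ''out_len'' 0 = 0" for j
    using s1(2) by (simp_all add: frame_def alice_input_def store_edges_def store_def)
  have ld1: "load_edges ''edges'' s1 = es"
    using ld load_edges_cong[of s1 "''edges''" ?s] s1(2) by (simp add: frame_def)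
  obtain s2 where s2: "runs local_search s1 (W ^ 10) s2" "frame {''i'', ''u'', ''v'', ''x'', ''h'', ''d''} s1 s2"
    "\<And>j. j < length es \<Longrightarrow> edge_constrained (k + 32) es (selected s2 (length es)) j"
    by (rule local_search_runs[of W s1 es n "k + 32", OF W(1) ld1 es W(3) s1(3)]) (use s1(4) W z1 in auto)
  have ld2: "load_edges ''edges'' s2 = es"
    using ld1 load_edges_cong[of s2 "''edges''" s1] s2(2) by (simp add: frame_def)
  have "s2 ''out_len'' 0 = 0" using s2(2) z1 by (simp add: frame_def)
  then obtain s3 where s3: "runs send_edges s2 (W ^ 6) s3"
    "load_edges ''out'' s3 = map ((!) es) (filter (\<lambda>j. j \<in> selected s2 (length es)) [0..<length es])"
    by (rule send_edges_runs[of W s2 es, OF W(1) ld2 W(3)])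
  have "runs (Seq local_search send_edges) s1 (W ^ 11) s3"
    using s2(1) s3(1) W(1) by (rule runs_Seq) auto
  from runs_Seq[OF s1(1) this W(1)] have "runs alice ?s (W ^ 12) s3"
    unfolding alice_def by simp
  moreover have "selected s2 (length es) \<subseteq> {..<length es}" by (auto simp: selected_def)
  ultimately show ?thesis using that s3(2) s2(3) s1(4-6) by blast
qed

subsection \<open>Contracted graphs\<close>

text \<open>A contraction is given by a map \<open>rep\<close> onto representatives. \<open>Q a\<close> is a perfect matching of
  the class of \<open>a\<close> with \<open>a\<close> removed, and \<open>w x z\<close>, \<open>w z x\<close> are the two ends of an edge joining the classes
  of \<open>x\<close> and \<open>z\<close>. As for mates, the value 0 means that there is none, and vertices are shifted by one.\<close>

definition live :: "nat \<Rightarrow> (nat \<Rightarrow> nat) \<Rightarrow> nat set" where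
  "live n rep = {x. x < n \<and> rep x = x}"

definition rep_ok :: "nat \<Rightarrow> (nat \<Rightarrow> nat) \<Rightarrow> bool" where
  "rep_ok n rep \<longleftrightarrow> (\<forall>a<n. rep a \<in> live n rep)"

definition ladj :: "nat \<Rightarrow> (nat \<Rightarrow> nat \<Rightarrow> bool) \<Rightarrow> (nat \<Rightarrow> nat) \<Rightarrow> nat \<Rightarrow> nat \<Rightarrow> bool" where
  "ladj n ad rep x z \<longleftrightarrow> x \<noteq> z \<and> (\<exists>a<n. \<exists>b<n. ad a b \<and> rep a = x \<and> rep b = z)"

definition class_matchings ::
    "nat \<Rightarrow> (nat \<Rightarrow> nat \<Rightarrow> bool) \<Rightarrow> (nat \<Rightarrow> nat) \<Rightarrow> (nat \<Rightarrow> nat \<Rightarrow> nat) \<Rightarrow> bool" where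
  "class_matchings n ad rep Q \<longleftrightarrow> (\<forall>a<n. \<forall>b<n. rep b = rep a \<and> b \<noteq> a \<longrightarrow>
     (\<exists>c<n. Q a b = Suc c \<and> rep c = rep a \<and> c \<noteq> a \<and> c \<noteq> b \<and> ad b c \<and> Q a c = Suc b))"

definition witnesses ::
    "nat \<Rightarrow> (nat \<Rightarrow> nat \<Rightarrow> bool) \<Rightarrow> (nat \<Rightarrow> nat) \<Rightarrow> (nat \<Rightarrow> nat \<Rightarrow> nat) \<Rightarrow> bool" where
  "witnesses n ad rep w \<longleftrightarrow> (\<forall>x<n. \<forall>z<n. (w x z \<noteq> 0 \<longrightarrow> ladj n ad rep x z) \<and> (ladj n ad rep x z \<longrightarrow>
     (\<exists>a<n. \<exists>b<n. ad a b \<and> rep a = x \<and> rep b = z \<and> w x z = Suc a \<and> w z x = Suc b)))"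

text \<open>When a matching \<open>K\<close> of the classes is expanded, each class has exactly one
  vertex that its inner matching leaves over: the end of the witness edge along \<open>K\<close> or,
  in a free class, a vertex that stays free. The latter is the representative, except that
  \<open>a\<close> is prescribed for the class \<open>cur\<close>.\<close>

definition exposed ::
    "(nat \<Rightarrow> nat \<Rightarrow> nat) \<Rightarrow> (nat \<Rightarrow> nat) \<Rightarrow> nat \<Rightarrow> nat \<Rightarrow> nat \<Rightarrow> nat" where
  "exposed w K cur a x = (if K x = 0 then (if x = cur then a else x) else w x (K x - 1) - 1)"

definition lift_mate ::
    "(nat \<Rightarrow> nat) \<Rightarrow> (nat \<Rightarrow> nat \<Rightarrow> nat) \<Rightarrow> (nat \<Rightarrow> nat \<Rightarrow> nat) \<Rightarrow> (nat \<Rightarrow> nat) \<Rightarrow> nat \<Rightarrow> nat \<Rightarrow> nat \<Rightarrow> nat" where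
  "lift_mate rep Q w K cur a b = (let x = rep b; e = exposed w K cur a x in
     if e = b then (if K x = 0 then 0 else w (K x - 1) x) else Q e b)"

lemma class_matchingsD:
  assumes "class_matchings n ad rep Q" "a < n" "b < n" "rep b = rep a" "b \<noteq> a"
  obtains c where "c < n" "Q a b = Suc c" "rep c = rep a" "c \<noteq> a" "c \<noteq> b" "ad b c" "Q a c = Suc b"
  using assms unfolding class_matchings_def by blast

lemma live_lt: "x \<in> live n rep \<Longrightarrow> x < n" "x \<in> live n rep \<Longrightarrow> rep x = x"
  by (auto simp: live_def)

lemma finite_live [simp]: "finite (live n rep)"
  by (simp add: live_def)

lemma exposed_props:
  assumes r: "rep_ok n rep" and w: "witnesses n ad rep w" and K: "mate_on (live n rep) (ladj n ad rep) K"
    and a: "a < n" "rep a = cur" and x: "x \<in> live n rep"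
  shows "exposed w K cur a x < n" "rep (exposed w K cur a x) = x"
    and "K x = Suc z \<Longrightarrow> w z x = Suc (exposed w K cur a z) \<and> ad (exposed w K cur a x) (exposed w K cur a z)"
proof -
  have 1: "exposed w K cur a x < n \<and> rep (exposed w K cur a x) = x" if x: "x \<in> live n rep" for x
  proof (cases "K x")
    case 0
    then show ?thesis using a x by (auto simp: exposed_def live_def)
  next
    case (Suc z)
    note z = mate_onD[OF K x Suc]
    show ?thesis using w z(1,3) x Suc unfolding witnesses_def exposed_def
      by (fastforce dest!: live_lt(1))
  qed
  from 1[OF x] show "exposed w K cur a x < n" "rep (exposed w K cur a x) = x" by auto
  assume Nx: "K x = Suc z"
  note z = mate_onD[OF K x Nx]
  obtain b c where bc: "ad b c" "w x z = Suc b" "w z x = Suc c"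
    using w z(1,3) x unfolding witnesses_def by (meson live_lt(1))
  then show "w z x = Suc (exposed w K cur a z) \<and> ad (exposed w K cur a x) (exposed w K cur a z)"
    using Nx z(4) by (simp add: exposed_def)
qed

text \<open>Every class is covered by the inner matching that leaves out its exposed vertex, and the
  exposed vertices of matched classes are joined by witness edges. Free classes thus correspond one
  to one to free vertices. The choice of \<open>a\<close> serves to build the inner matchings of a
  merged class.\<close>

lemma lift_mate_props:
  assumes r: "rep_ok n rep" and w: "witnesses n ad rep w" and Q: "class_matchings n ad rep Q"
    and K: "mate_on (live n rep) (ladj n ad rep) K" and a: "a < n" "rep a = cur"
    and irr: "\<And>a. \<not> ad a a"
  defines "D \<equiv> lift_mate rep Q w K cur a"
  shows "mate_on {..<n} ad D"
    and "\<And>b. b < n \<Longrightarrow> D b = 0 \<longleftrightarrow> K (rep b) = 0 \<and> b = (if rep b = cur then a else rep b)"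
    and "\<And>b c. b < n \<Longrightarrow> D b = Suc c \<Longrightarrow> rep c = rep b \<or> K (rep b) = Suc (rep c)"
    and "card {b \<in> {..<n}. D b = 0} = card {x \<in> live n rep. K x = 0}"
proof -
  let ?e = "exposed w K cur a"
  note ep = exposed_props[OF r w K a]
  have rl: "rep b \<in> live n rep" if "b < n" for b using r that by (simp add: rep_ok_def)
  have main: "(D b = 0 \<longrightarrow> K (rep b) = 0 \<and> b = ?e (rep b)) \<and>
     (\<forall>c. D b = Suc c \<longrightarrow> c < n \<and> c \<noteq> b \<and> ad b c \<and> D c = Suc b \<and> (rep c = rep b \<or> K (rep b) = Suc (rep c)))"
    if b: "b < n" for b
  proof (cases "?e (rep b) = b")
    case True
    show ?thesis
    proof (cases "K (rep b)")
      case 0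
      then show ?thesis using True by (simp add: D_def lift_mate_def)
    next
      case (Suc z)
      note z = mate_onD[OF K rl[OF b] Suc]
      have wz: "w z (rep b) = Suc (?e z)" "ad b (?e z)" using ep(3)[OF rl[OF b] Suc] True by auto
      have wb: "w (rep b) z = Suc b" using ep(3)[OF z(1) z(4)] True by simp
      have ez: "?e z < n" "rep (?e z) = z" using ep(1,2)[OF z(1)] by auto
      have "D b = Suc (?e z)" using True Suc wz by (simp add: D_def lift_mate_def)
      moreover have "D (?e z) = Suc b" using ez z(4) wb by (simp add: D_def lift_mate_def)
      ultimately show ?thesis using ez wz Suc irr by auto
    qed
  next
    case False
    have e: "?e (rep b) < n" "rep (?e (rep b)) = rep b" using ep(1,2)[OF rl[OF b]] by auto
    obtain c where c: "c < n" "Q (?e (rep b)) b = Suc c" "rep c = rep b" "c \<noteq> ?e (rep b)" "c \<noteq> b"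
      "ad b c" "Q (?e (rep b)) c = Suc b"
      by (rule class_matchingsD[OF Q e(1) b]) (use e False in auto)
    have "D b = Suc c" unfolding D_def lift_mate_def Let_def using False c(2) by simp
    moreover have "D c = Suc b" unfolding D_def lift_mate_def Let_def c(3) using c(4,7) by simp
    ultimately show ?thesis using c by simp
  qed
  show "mate_on {..<n} ad D" unfolding mate_on_def lessThan_iff using main by blast
  show zero: "D b = 0 \<longleftrightarrow> K (rep b) = 0 \<and> b = (if rep b = cur then a else rep b)" if b: "b < n" for b
  proof
    assume "D b = 0"
    then show "K (rep b) = 0 \<and> b = (if rep b = cur then a else rep b)"
      using main[OF b] by (auto simp: exposed_def)
  next
    assume *: "K (rep b) = 0 \<and> b = (if rep b = cur then a else rep b)"
    then have "?e (rep b) = b" by (auto simp: exposed_def)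
    then show "D b = 0" using * by (simp add: D_def lift_mate_def)
  qed
  show "rep c = rep b \<or> K (rep b) = Suc (rep c)" if "b < n" "D b = Suc c" for b c
    using main that by blast
  have "bij_betw (\<lambda>x. if x = cur then a else x) {x \<in> live n rep. K x = 0} {b \<in> {..<n}. D b = 0}"
  proof (rule bij_betw_byWitness[where f' = rep])
    show "\<forall>x\<in>{x \<in> live n rep. K x = 0}. rep (if x = cur then a else x) = x"
      using a live_lt(2) by auto
    show "\<forall>b\<in>{b \<in> {..<n}. D b = 0}. (if rep b = cur then a else rep b) = b"
      using zero by auto
    show "(\<lambda>x. if x = cur then a else x) ` {x \<in> live n rep. K x = 0} \<subseteq> {b \<in> {..<n}. D b = 0}"
      using zero a by (auto simp: live_def)
    show "rep ` {b \<in> {..<n}. D b = 0} \<subseteq> {x \<in> live n rep. K x = 0}"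
      using zero rl by auto
  qed
  then show "card {b \<in> {..<n}. D b = 0} = card {x \<in> live n rep. K x = 0}"
    using bij_betw_same_card by fastforce
qed

section \<open>Merging a set of classes into one vertex\<close>

definition near_perfect :: "nat set \<Rightarrow> nat \<Rightarrow> (nat \<Rightarrow> nat) \<Rightarrow> bool" where
  "near_perfect C c K \<longleftrightarrow> K c = 0 \<and> (\<forall>y\<in>C. y \<noteq> c \<longrightarrow> (\<exists>z\<in>C. K y = Suc z))"

definition contract :: "nat set \<Rightarrow> nat \<Rightarrow> (nat \<Rightarrow> nat) \<Rightarrow> nat \<Rightarrow> nat" where
  "contract C u rep a = (if rep a \<in> C then u else rep a)"

lemma live_contract:
  assumes "rep_ok n rep" "C \<subseteq> live n rep" "u \<in> C"
  shows "live n (contract C u rep) = live n rep - (C - {u})"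
  using assms by (auto simp: live_def contract_def rep_ok_def)

lemma rep_ok_contract:
  assumes "rep_ok n rep" "C \<subseteq> live n rep" "u \<in> C"
  shows "rep_ok n (contract C u rep)"
  unfolding rep_ok_def live_contract[OF assms]
  using assms by (auto simp: contract_def rep_ok_def)

lemma ladj_contract:
  assumes "ladj n ad rep x z" "x \<notin> C \<or> z \<notin> C" "u \<in> C"
  shows "ladj n ad (contract C u rep) (if x \<in> C then u else x) (if z \<in> C then u else z)"
proof -
  obtain a b where ab: "a < n" "b < n" "ad a b" "rep a = x" "rep b = z" "x \<noteq> z"
    using assms(1) by (auto simp: ladj_def)
  have "contract C u rep a = (if x \<in> C then u else x)" "contract C u rep b = (if z \<in> C then u else z)"
    using ab by (auto simp: contract_def)
  moreover have "(if x \<in> C then u else x) \<noteq> (if z \<in> C then u else z)" using ab assms by auto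
  ultimately show ?thesis using ab unfolding ladj_def by blast
qed

text \<open>To leave \<open>a\<close> out of the merged class, the matching of \<open>C\<close> that
  misses the class of \<open>a\<close> is expanded with \<open>a\<close> as the prescribed free
  vertex. No other class of \<open>C\<close> is free, so \<open>a\<close> is the only vertex
  missed.\<close>

lemma class_matchings_contract:
  assumes r: "rep_ok n rep" and w: "witnesses n ad rep w" and Q: "class_matchings n ad rep Q"
    and irr: "\<And>a. \<not> ad a a"
    and C: "C \<subseteq> live n rep" "u \<in> C"
    and K: "\<And>c. c \<in> C \<Longrightarrow> mate_on (live n rep) (ladj n ad rep) (Nc c) \<and> near_perfect C c (Nc c)"
    and Q'C: "\<And>a b. a < n \<Longrightarrow> b < n \<Longrightarrow> rep a \<in> C \<Longrightarrow> Q' a b = lift_mate rep Q w (Nc (rep a)) (rep a) a b"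
    and Q'n: "\<And>a b. a < n \<Longrightarrow> b < n \<Longrightarrow> rep a \<notin> C \<Longrightarrow> Q' a b = Q a b"
  shows "class_matchings n ad (contract C u rep) Q'"
  unfolding class_matchings_def
proof (intro allI impI)
  fix a b assume a: "a < n" and b: "b < n" and ab: "contract C u rep b = contract C u rep a \<and> b \<noteq> a"
  show "\<exists>c<n. Q' a b = Suc c \<and> contract C u rep c = contract C u rep a \<and> c \<noteq> a \<and> c \<noteq> b \<and> ad b c \<and> Q' a c = Suc b"
  proof (cases "rep a \<in> C")
    case False
    then have "rep b = rep a" using ab C by (auto simp: contract_def split: if_splits)
    then obtain c where c: "c < n" "Q a b = Suc c" "rep c = rep a" "c \<noteq> a" "c \<noteq> b" "ad b c" "Q a c = Suc b"
      using class_matchingsD[OF Q a b] ab by blast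
    then show ?thesis using Q'n a b False by (auto simp: contract_def)
  next
    case True
    have bC: "rep b \<in> C"
    proof (rule ccontr)
      assume "rep b \<notin> C"
      then show False using ab True C by (auto simp: contract_def split: if_splits)
    qed
    let ?D = "lift_mate rep Q w (Nc (rep a)) (rep a) a"
    note K' = K[OF True]
    note L = lift_mate_props[OF r w Q conjunct1[OF K'] a refl irr]
    have "?D b \<noteq> 0"
    proof
      assume "?D b = 0"
      then have 0: "Nc (rep a) (rep b) = 0" "b = (if rep b = rep a then a else rep b)" using L(2)[OF b] by auto
      then have "rep b = rep a" using K' bC unfolding near_perfect_def by force
      then show False using 0 ab by simp
    qed
    then obtain c where c: "?D b = Suc c" using not0_implies_Suc by blast
    have cp: "c < n" "c \<noteq> b" "ad b c" "?D c = Suc b" using mate_onD[OF L(1) _ c] b by auto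
    have "c \<noteq> a" using L(2)[OF a] cp(4) K' by (auto simp: near_perfect_def)
    moreover have "rep c \<in> C"
    proof -
      have "rep c = rep b \<or> Nc (rep a) (rep b) = Suc (rep c)" using L(3)[OF b c] .
      then show ?thesis
      proof
        assume *: "Nc (rep a) (rep b) = Suc (rep c)"
        then have "rep b \<noteq> rep a" using K' by (auto simp: near_perfect_def)
        then show ?thesis using * K' bC unfolding near_perfect_def by force
      qed (use bC in simp)
    qed
    ultimately show ?thesis using c cp Q'C a b True by (auto simp: contract_def)
  qed
qed

lemma mate_on_contract:
  assumes r: "rep_ok n rep" and C: "C \<subseteq> live n rep" "u \<in> C"
    and K: "mate_on (live n rep) (ladj n ad rep) K" "near_perfect C u K"
  shows "mate_on (live n (contract C u rep)) (ladj n ad (contract C u rep)) (\<lambda>v. if v \<in> C then 0 else K v)"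
  unfolding mate_on_def
proof (intro ballI allI impI)
  fix x y assume x: "x \<in> live n (contract C u rep)" and xy: "(if x \<in> C then 0 else K x) = Suc y"
  have xC: "x \<notin> C" "K x = Suc y" using xy by (auto split: if_splits)
  have xL: "x \<in> live n rep" using x live_contract[OF r C] by simp
  note y = mate_onD[OF K(1) xL xC(2)]
  have yC: "y \<notin> C"
  proof
    assume "y \<in> C"
    then have "x \<in> C" using K(2) y(4) unfolding near_perfect_def by force
    then show False using xC by simp
  qed
  then have "ladj n ad (contract C u rep) x y" using ladj_contract[OF y(3) _ C(2)] xC by simp
  then show "y \<in> live n (contract C u rep) \<and> y \<noteq> x \<and> ladj n ad (contract C u rep) x y \<and> (if y \<in> C then 0 else K y) = Suc x"
    using y yC live_contract[OF r C] by simp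
qed

text \<open>The set \<open>C\<close> holds one free vertex before and after, namely
  \<open>u\<close>.\<close>

lemma free_contract:
  assumes r: "rep_ok n rep" and C: "C \<subseteq> live n rep" "u \<in> C" and K: "near_perfect C u K"
  shows "{x \<in> live n (contract C u rep). (if x \<in> C then 0 else K x) = 0} = {x \<in> live n rep. K x = 0}"
  using K C unfolding live_contract[OF r C] near_perfect_def by force

text \<open>The contracted vertex is free in a matching that meets the barrier bound, hence it lies outside
  the barrier set and may be expanded without changing the parity of its part.\<close>

lemma barrier_contract:
  assumes r: "rep_ok n rep" and C: "C \<subseteq> live n rep" "u \<in> C"
    and K: "mate_on (live n rep) (ladj n ad rep) K" "near_perfect C u K"
    and b: "barrier (live n (contract C u rep)) (ladj n ad (contract C u rep)) f A \<kappa>"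
    and f: "f = card {x \<in> live n rep. K x = 0}"
  shows "\<exists>A \<kappa>. barrier (live n rep) (ladj n ad rep) f A \<kappa>"
proof -
  let ?L = "live n rep" and ?rep' = "contract C u rep"
  let ?L' = "live n ?rep'"
  let ?K' = "\<lambda>v. if v \<in> C then 0 else K v"
  have L': "?L' = ?L - (C - {u})" by (rule live_contract[OF r C])
  have finC: "finite C" using finite_subset[OF C(1)] by simp
  have uA: "u \<notin> A"
  proof (rule barrier_optimal(2)[OF _ b mate_on_contract[OF r C K]])
    show "f = card {x \<in> ?L'. ?K' x = 0}" using free_contract[OF r C K(2)] f by simp
    show "u \<in> ?L'" using L' C by auto
  qed (use C in auto)
  have A: "A \<subseteq> ?L'" using b by (simp add: barrier_def)
  then have AC: "A \<inter> C = {}" using uA L' by auto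
  \<comment> \<open>The expanded blossom goes as a whole into the part of \<open>u\<close>. It adds
    the vertices of \<open>C - {u}\<close>, which \<open>K\<close> matches among themselves, so no
    parity changes.\<close>
  define \<kappa>' where "\<kappa>' x = (if x \<in> C then \<kappa> u else \<kappa> x)" for x
  have evC: "even (card (C - {u}))"
  proof (rule even_card_involution[where g = "\<lambda>x. K x - 1"])
    fix x assume x: "x \<in> C - {u}"
    then obtain y where y: "y \<in> C" "K x = Suc y" using K(2) by (auto simp: near_perfect_def)
    note yp = mate_onD[OF K(1) _ y(2)]
    have "y \<noteq> u" using yp(4) x C K(2) by (auto simp: near_perfect_def)
    then show "K x - 1 \<in> C - {u} \<and> K x - 1 \<noteq> x \<and> K (K x - 1) - 1 = x"
      using y yp x C by auto
  qed (use finC in simp)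
  have par: "odd (card (part ?L A \<kappa>' j)) \<longleftrightarrow> odd (card (part ?L' A \<kappa> j))" for j
  proof (cases "j = \<kappa> u")
    case True
    have "part ?L A \<kappa>' j = part ?L' A \<kappa> j \<union> (C - {u})"
      using C AC L' uA True by (auto simp: part_def \<kappa>'_def)
    moreover have "part ?L' A \<kappa> j \<inter> (C - {u}) = {}" using L' by (auto simp: part_def)
    moreover have "finite (part ?L' A \<kappa> j)" by (simp add: part_def)
    ultimately have "card (part ?L A \<kappa>' j) = card (part ?L' A \<kappa> j) + card (C - {u})"
      using finC by (simp add: card_Un_disjoint)
    then show ?thesis using evC by simp
  next
    case False
    then have "part ?L A \<kappa>' j = part ?L' A \<kappa> j"
      using C AC L' by (auto simp: part_def \<kappa>'_def)
    then show ?thesis by simp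
  qed
  have "barrier ?L (ladj n ad rep) f A \<kappa>'"
    unfolding barrier_def
  proof (intro conjI ballI impI)
    show "A \<subseteq> ?L" using A L' by auto
    show "f + card A \<le> card {j. odd (card (part ?L A \<kappa>' j))}"
      using b par by (simp add: barrier_def)
    fix x y assume x: "x \<in> ?L - A" and y: "y \<in> ?L - A" and xy: "ladj n ad rep x y"
    show "\<kappa>' x = \<kappa>' y"
    proof (cases "x \<in> C \<and> y \<in> C")
      case False
      let ?x = "if x \<in> C then u else x" and ?y = "if y \<in> C then u else y"
      have "ladj n ad ?rep' ?x ?y" using ladj_contract[OF xy _ C(2)] False by blast
      moreover have "?x \<in> ?L' - A" "?y \<in> ?L' - A" using x y L' C uA by auto
      ultimately have "\<kappa> ?x = \<kappa> ?y" using b unfolding barrier_def by blast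
      then show ?thesis by (auto simp: \<kappa>'_def)
    qed (simp add: \<kappa>'_def)
  qed
  then show ?thesis by blast
qed

subsection \<open>Alternating forests\<close>

text \<open>\<open>lab\<close> is 1 on the outer and 2 on the inner vertices, \<open>rt\<close> is the root of the tree of a vertex, and
  \<open>T w\<close> is the matching obtained from \<open>M\<close> by moving the free vertex from \<open>rt w\<close> to \<open>w\<close>.\<close>

definition forest ::
    "nat set \<Rightarrow> (nat \<Rightarrow> nat \<Rightarrow> bool) \<Rightarrow> (nat \<Rightarrow> nat) \<Rightarrow> (nat \<Rightarrow> nat) \<Rightarrow> (nat \<Rightarrow> nat) \<Rightarrow> (nat \<Rightarrow> nat \<Rightarrow> nat) \<Rightarrow> bool" where
  "forest L la M lab rt T \<longleftrightarrow> mate_on L la M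
   \<and> (\<forall>v\<in>L. lab v = 0 \<or> lab v = 1 \<or> lab v = 2)
   \<and> (\<forall>v\<in>L. M v = 0 \<longrightarrow> lab v = 1 \<and> rt v = v)
   \<and> (\<forall>v\<in>L. lab v \<noteq> 0 \<longrightarrow> rt v \<in> L \<and> M (rt v) = 0)
   \<and> (\<forall>v\<in>L. lab v = 2 \<longrightarrow> (\<exists>y\<in>L. M v = Suc y \<and> lab y = 1 \<and> rt y = rt v))
   \<and> (\<forall>v\<in>L. \<forall>y. lab v = 1 \<and> M v = Suc y \<longrightarrow> lab y = 2)
   \<and> (\<forall>w\<in>L. lab w = 1 \<longrightarrow> mate_on L la (T w) \<and> T w w = 0
      \<and> (\<forall>v\<in>L. lab v = 0 \<or> rt v \<noteq> rt w \<longrightarrow> T w v = M v)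
      \<and> (\<forall>v\<in>L. lab v = 1 \<and> rt v = rt w \<and> v \<noteq> w \<longrightarrow> (\<exists>y\<in>L. T w v = Suc y \<and> lab y = 2 \<and> rt y = rt w))
      \<and> (\<forall>v\<in>L. lab v = 2 \<and> rt v = rt w \<longrightarrow> (\<exists>y\<in>L. T w v = Suc y \<and> lab y = 1 \<and> rt y = rt w)))"

lemma forestD:
  assumes "forest L la M lab rt T"
  shows "mate_on L la M"
    and "v \<in> L \<Longrightarrow> lab v = 0 \<or> lab v = 1 \<or> lab v = 2"
    and "v \<in> L \<Longrightarrow> M v = 0 \<Longrightarrow> lab v = 1 \<and> rt v = v"
    and "v \<in> L \<Longrightarrow> lab v \<noteq> 0 \<Longrightarrow> rt v \<in> L \<and> M (rt v) = 0"
    and "v \<in> L \<Longrightarrow> lab v = 2 \<Longrightarrow> \<exists>y\<in>L. M v = Suc y \<and> lab y = 1 \<and> rt y = rt v"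
    and "v \<in> L \<Longrightarrow> lab v = 1 \<Longrightarrow> M v = Suc y \<Longrightarrow> lab y = 2"
    and "w \<in> L \<Longrightarrow> lab w = 1 \<Longrightarrow> mate_on L la (T w) \<and> T w w = 0"
    and "w \<in> L \<Longrightarrow> lab w = 1 \<Longrightarrow> v \<in> L \<Longrightarrow> lab v = 0 \<or> rt v \<noteq> rt w \<Longrightarrow> T w v = M v"
    and "w \<in> L \<Longrightarrow> lab w = 1 \<Longrightarrow> v \<in> L \<Longrightarrow> lab v = 1 \<Longrightarrow> rt v = rt w \<Longrightarrow> v \<noteq> w
      \<Longrightarrow> \<exists>y\<in>L. T w v = Suc y \<and> lab y = 2 \<and> rt y = rt w"
    and "w \<in> L \<Longrightarrow> lab w = 1 \<Longrightarrow> v \<in> L \<Longrightarrow> lab v = 2 \<Longrightarrow> rt v = rt w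
      \<Longrightarrow> \<exists>y\<in>L. T w v = Suc y \<and> lab y = 1 \<and> rt y = rt w"
proof -
  note A = assms[unfolded forest_def]
  note A2 = A[THEN conjunct2] note A3 = A2[THEN conjunct2] note A4 = A3[THEN conjunct2]
  note A5 = A4[THEN conjunct2] note A6 = A5[THEN conjunct2] note A7 = A6[THEN conjunct2]
  show "mate_on L la M" by (rule A[THEN conjunct1])
  show "v \<in> L \<Longrightarrow> lab v = 0 \<or> lab v = 1 \<or> lab v = 2"
    using A2[THEN conjunct1] by blast
  show "v \<in> L \<Longrightarrow> M v = 0 \<Longrightarrow> lab v = 1 \<and> rt v = v"
    using A3[THEN conjunct1] by blast
  show "v \<in> L \<Longrightarrow> lab v \<noteq> 0 \<Longrightarrow> rt v \<in> L \<and> M (rt v) = 0"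
    using A4[THEN conjunct1] by blast
  show "v \<in> L \<Longrightarrow> lab v = 2 \<Longrightarrow> \<exists>y\<in>L. M v = Suc y \<and> lab y = 1 \<and> rt y = rt v"
    using A5[THEN conjunct1] by blast
  show "v \<in> L \<Longrightarrow> lab v = 1 \<Longrightarrow> M v = Suc y \<Longrightarrow> lab y = 2"
    using A6[THEN conjunct1] by blast
  assume "w \<in> L" "lab w = 1"
  note B = A7[THEN bspec, OF this(1), THEN mp, OF this(2)]
  show "mate_on L la (T w) \<and> T w w = 0" using B by blast
  note C = B[THEN conjunct2, THEN conjunct2]
  show "v \<in> L \<Longrightarrow> lab v = 0 \<or> rt v \<noteq> rt w \<Longrightarrow> T w v = M v"
    using C[THEN conjunct1] by blast
  show "v \<in> L \<Longrightarrow> lab v = 1 \<Longrightarrow> rt v = rt w \<Longrightarrow> v \<noteq> w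
      \<Longrightarrow> \<exists>y\<in>L. T w v = Suc y \<and> lab y = 2 \<and> rt y = rt w"
    using C[THEN conjunct2, THEN conjunct1] by blast
  show "v \<in> L \<Longrightarrow> lab v = 2 \<Longrightarrow> rt v = rt w
      \<Longrightarrow> \<exists>y\<in>L. T w v = Suc y \<and> lab y = 1 \<and> rt y = rt w"
    using C[THEN conjunct2, THEN conjunct2] by blast
qed

text \<open>The free vertex moves from \<open>u\<close> to \<open>y\<close> along the two edges of
  the path \<open>u\<close>, \<open>x\<close>, \<open>y\<close>.\<close>

lemma mate_on_rotate:
  assumes m: "mate_on L la m" and u: "u \<in> L" "x \<in> L" "u \<noteq> x" "la u x" "la x u" and "m u = 0" "m x = Suc y"
  shows "mate_on L la (m(x := Suc u, u := Suc x, y := 0))"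
proof -
  note y = mate_onD[OF m u(2) assms(8)]
  have yu: "y \<noteq> u" using y assms(7) by auto
  show ?thesis unfolding mate_on_def
  proof (intro ballI allI impI)
    fix a b assume a: "a \<in> L" and ab: "(m(x := Suc u, u := Suc x, y := 0)) a = Suc b"
    consider "a = x" "b = u" | "a = u" "b = x" | "a \<noteq> x" "a \<noteq> u" "a \<noteq> y" "m a = Suc b"
      using ab yu y by (auto split: if_splits)
    then show "b \<in> L \<and> b \<noteq> a \<and> la a b \<and> (m(x := Suc u, u := Suc x, y := 0)) b = Suc a"
    proof cases
      case 3
      note b = mate_onD[OF m a 3(4)]
      have "b \<noteq> x" "b \<noteq> u" "b \<noteq> y" using b(4) 3 assms(7,8) y(4) by auto
      then show ?thesis using b by simp
    qed (use u y yu in auto)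
  qed
qed

lemma forest_init:
  assumes m: "mate_on L la M" and lab: "\<And>v. v \<in> L \<Longrightarrow> lab v = (if M v = 0 then 1 else 0)"
    and rt: "\<And>v. v \<in> L \<Longrightarrow> M v = 0 \<Longrightarrow> rt v = v" and T: "\<And>w v. w \<in> L \<Longrightarrow> v \<in> L \<Longrightarrow> T w v = M v"
  shows "forest L la M lab rt T"
proof -
  have "mate_on L la (T w)" if "w \<in> L" for w
    using m T[OF that] unfolding mate_on_def by metis
  moreover have "v \<notin> L \<or> M v \<noteq> 0 \<or> w \<notin> L \<or> M w \<noteq> 0 \<or> rt v = rt w \<longrightarrow> v = w" if "v \<in> L" "M v = 0" "w \<in> L" "M w = 0" for v w
    using rt that by auto
  ultimately show ?thesis unfolding forest_def using m lab rt T by (auto split: if_splits)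
qed

text \<open>An unlabelled vertex is never free, and mates are labelled together, so the mate
  \<open>y\<close> of \<open>x\<close> is new as well. All matchings \<open>T w\<close> agree with
  \<open>M\<close> on unlabelled vertices. Hence \<open>T u\<close> can be rotated along
  \<open>u\<close>, \<open>x\<close>, \<open>y\<close> to leave \<open>y\<close> free, while the
  other matchings keep the edge from \<open>x\<close> to \<open>y\<close>.\<close>

lemma forest_grow:
  assumes F: "forest L la M lab rt T" and u: "u \<in> L" "lab u = 1" and x: "x \<in> L" "lab x = 0"
    and adj: "la u x" "la x u"
  obtains y where "y \<in> L" "M x = Suc y" "lab y = 0" "T u x = Suc y"
    "forest L la M (lab(x := 2, y := 1)) (rt(x := rt u, y := rt u))
      (T(y := (T u)(x := Suc u, u := Suc x, y := 0)))"
proof -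
  note D = forestD[OF F]
  have "M x \<noteq> 0" using D(3)[OF x(1)] x(2) by auto
  then obtain y where y: "M x = Suc y" using not0_implies_Suc by blast
  note yp = mate_onD[OF D(1) x(1) y]
  have laby: "lab y = 0"
  proof (rule ccontr)
    assume "lab y \<noteq> 0"
    then consider "lab y = 1" | "lab y = 2" using D(2)[OF yp(1)] by auto
    then show False
    proof cases
      case 1 then show False using D(6)[OF yp(1) 1 yp(4)] x by simp
    next
      case 2 then show False using D(5)[OF yp(1) 2] yp(4) x by auto
    qed
  qed
  have ne: "u \<noteq> x" "u \<noteq> y" "x \<noteq> y" using u x laby yp by auto
  have Tux: "T u x = Suc y" using D(8)[OF u x(1)] x y by simp
  have Tm: "T w x = Suc y" "T w y = Suc x" if "w \<in> L" "lab w = 1" for w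
    using D(8)[OF that x(1)] D(8)[OF that yp(1)] x laby y yp by auto
  let ?Ty = "(T u)(x := Suc u, u := Suc x, y := 0)"
  let ?lab = "lab(x := 2, y := 1)" and ?rt = "rt(x := rt u, y := rt u)" and ?T = "T(y := ?Ty)"
  have rot: "mate_on L la ?Ty"
    by (rule mate_on_rotate[OF conjunct1[OF D(7)[OF u]] u(1) x(1) ne(1) adj conjunct2[OF D(7)[OF u]] Tux])
  have rtu: "rt u \<in> L" "M (rt u) = 0" using D(4)[OF u(1)] u by auto
  have rne: "rt u \<noteq> x" "rt u \<noteq> y" using rtu y yp by auto
  have lab12: "lab v \<noteq> 0 \<Longrightarrow> v \<noteq> x \<and> v \<noteq> y" for v using x laby by auto
  have new: "mate_on L la (?T w) \<and> ?T w w = 0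
      \<and> (\<forall>v\<in>L. ?lab v = 0 \<or> ?rt v \<noteq> ?rt w \<longrightarrow> ?T w v = M v)
      \<and> (\<forall>v\<in>L. ?lab v = 1 \<and> ?rt v = ?rt w \<and> v \<noteq> w \<longrightarrow> (\<exists>y\<in>L. ?T w v = Suc y \<and> ?lab y = 2 \<and> ?rt y = ?rt w))
      \<and> (\<forall>v\<in>L. ?lab v = 2 \<and> ?rt v = ?rt w \<longrightarrow> (\<exists>y\<in>L. ?T w v = Suc y \<and> ?lab y = 1 \<and> ?rt y = ?rt w))"
    if w: "w \<in> L" "?lab w = 1" for w
  proof -
    \<comment> \<open>The new matching for \<open>y\<close> differs from \<open>T u\<close> only at
      \<open>u\<close>, \<open>x\<close> and \<open>y\<close>; with \<open>w'\<close> the new outer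
      vertex and the old ones are both reduced to the old forest.\<close>
    define w' where "w' = (if w = y then u else w)"
    have w': "w' \<in> L" "lab w' = 1" using w u ne by (auto simp: w'_def split: if_splits)
    have rw: "?rt w = rt w'" using w x ne by (auto simp: w'_def split: if_splits)
    have Tw: "v \<noteq> x \<Longrightarrow> v \<noteq> y \<Longrightarrow> (w = y \<Longrightarrow> v \<noteq> u) \<Longrightarrow> ?T w v = T w' v" for v
      by (simp add: w'_def)
    note Dw = D(8-10)[OF w']
    show ?thesis
    proof (intro conjI ballI impI)
      show "mate_on L la (?T w)" using rot D(7)[OF w'] by (cases "w = y") (simp_all add: w'_def)
      show "?T w w = 0" using D(7)[OF w'] by (cases "w = y") (simp_all add: w'_def)
    next
      fix v assume v: "v \<in> L" "?lab v = 0 \<or> ?rt v \<noteq> ?rt w"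
      show "?T w v = M v"
      proof (cases "v = x \<or> v = y")
        case True
        then have "w \<noteq> y" "rt u \<noteq> rt w'" using v(2) rw by (auto split: if_splits)
        then show ?thesis using True Tm[OF w'] y yp by (auto simp: w'_def)
      next
        case False
        then have "lab v = 0 \<or> rt v \<noteq> rt w'" using v(2) rw by simp
        moreover have "w = y \<Longrightarrow> v \<noteq> u" using calculation u by (auto simp: w'_def)
        ultimately show ?thesis using Tw[of v] Dw(1)[OF v(1)] False by simp
      qed
    next
      fix v assume v: "v \<in> L" "?lab v = 1 \<and> ?rt v = ?rt w \<and> v \<noteq> w"
      have vx: "v \<noteq> x" using v ne by (auto split: if_splits)
      show "\<exists>y\<in>L. ?T w v = Suc y \<and> ?lab y = 2 \<and> ?rt y = ?rt w"
      proof (cases "v = y")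
        case True
        then have "?T w v = Suc x" "rt u = rt w'" using v Tm[OF w'] rw ne by (auto simp: w'_def)
        moreover have "?lab x = 2" using ne by simp
        moreover have "?rt x = ?rt w" unfolding rw using ne calculation(2) by simp
        ultimately show ?thesis using x by blast
      next
        case False
        then have lv: "lab v = 1" "rt v = rt w'" using v vx rw by auto
        show ?thesis
        proof (cases "w = y \<and> v = u")
          case True
          then show ?thesis using x ne rw by (auto simp: w'_def)
        next
          case F: False
          then have "v \<noteq> w'" using v by (auto simp: w'_def)
          then obtain z where z: "z \<in> L" "T w' v = Suc z" "lab z = 2" "rt z = rt w'"
            using Dw(2)[OF v(1) lv] by auto
          then show ?thesis using Tw[of v] False F vx rw lab12[of z] by auto
        qed
      qed
    next
      fix v assume v: "v \<in> L" "?lab v = 2 \<and> ?rt v = ?rt w"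
      have vy: "v \<noteq> y" using v by auto
      show "\<exists>y\<in>L. ?T w v = Suc y \<and> ?lab y = 1 \<and> ?rt y = ?rt w"
      proof (cases "v = x")
        case True
        have rtu: "rt u = rt w'" using v True rw ne by auto
        show ?thesis
        proof (cases "w = y")
          case True': True
          then show ?thesis using True rtu rw u ne by auto
        next
          case False
          then show ?thesis using True rtu rw yp Tm[OF w'] by (auto simp: w'_def)
        qed
      next
        case False
        then have lv: "lab v = 2" "rt v = rt w'" using v vy rw by auto
        then obtain z where z: "z \<in> L" "T w' v = Suc z" "lab z = 1" "rt z = rt w'"
          using Dw(3)[OF v(1) lv] by auto
        have "v \<noteq> u" using lv u by auto
        then show ?thesis using z Tw[of v] False vy rw lab12[of z] by auto
      qed
    qed
  qed
  have "forest L la M ?lab ?rt ?T"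
    unfolding forest_def
  proof (intro conjI ballI)
    show "mate_on L la M" by (rule D(1))
    fix v assume v: "v \<in> L"
    show "?lab v = 0 \<or> ?lab v = 1 \<or> ?lab v = 2" using D(2)[OF v] by auto
    show "M v = 0 \<longrightarrow> ?lab v = 1 \<and> ?rt v = v" using D(3)[OF v] y yp by auto
    show "?lab v \<noteq> 0 \<longrightarrow> ?rt v \<in> L \<and> M (?rt v) = 0" using D(4)[OF v] rtu by auto
    show "?lab v = 2 \<longrightarrow> (\<exists>y\<in>L. M v = Suc y \<and> ?lab y = 1 \<and> ?rt y = ?rt v)"
    proof
      assume lv: "?lab v = 2"
      then have vy: "v \<noteq> y" by auto
      show "\<exists>y\<in>L. M v = Suc y \<and> ?lab y = 1 \<and> ?rt y = ?rt v"
      proof (cases "v = x")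
        case True
        then show ?thesis using y yp ne by auto
      next
        case False
        then obtain z where "z \<in> L" "M v = Suc z" "lab z = 1" "rt z = rt v"
          using D(5)[OF v] lv vy by auto
        then show ?thesis using lab12[of z] False vy by auto
      qed
    qed
    show "\<forall>z. ?lab v = 1 \<and> M v = Suc z \<longrightarrow> ?lab z = 2"
    proof (intro allI impI)
      fix z assume *: "?lab v = 1 \<and> M v = Suc z"
      then have vx: "v \<noteq> x" using ne by (auto split: if_splits)
      show "?lab z = 2"
      proof (cases "v = y")
        case True
        then show ?thesis using * yp ne by auto
      next
        case False
        then have "lab z = 2" using * vx D(6)[OF v] by auto
        then show ?thesis using lab12[of z] by auto
      qed
    qed
    show "?lab v = 1 \<longrightarrow> mate_on L la (?T v) \<and> ?T v v = 0
      \<and> (\<forall>v'\<in>L. ?lab v' = 0 \<or> ?rt v' \<noteq> ?rt v \<longrightarrow> ?T v v' = M v')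
      \<and> (\<forall>v'\<in>L. ?lab v' = 1 \<and> ?rt v' = ?rt v \<and> v' \<noteq> v \<longrightarrow> (\<exists>y\<in>L. ?T v v' = Suc y \<and> ?lab y = 2 \<and> ?rt y = ?rt v))
      \<and> (\<forall>v'\<in>L. ?lab v' = 2 \<and> ?rt v' = ?rt v \<longrightarrow> (\<exists>y\<in>L. ?T v v' = Suc y \<and> ?lab y = 1 \<and> ?rt y = ?rt v))"
      using new[OF v] by blast
  qed
  then show ?thesis using that[of y] yp y laby Tux by blast
qed

text \<open>The inner vertices form the barrier set; each outer vertex is an odd part of its own,
  with label \<open>Suc v\<close>, and the unlabelled vertices share the label 0. The mates of the
  inner vertices are exactly the outer vertices that are not free, which gives the required number
  of odd parts.\<close>

lemma forest_stuck:
  assumes F: "forest L la M lab rt T" and fin: "finite L"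
    and st: "\<And>u x. u \<in> L \<Longrightarrow> x \<in> L \<Longrightarrow> lab u = 1 \<Longrightarrow> la u x \<Longrightarrow> lab x = 2"
    and sym: "\<And>u x. la u x \<Longrightarrow> la x u"
  shows "barrier L la (card {v \<in> L. M v = 0}) {v \<in> L. lab v = 2} (\<lambda>v. if lab v = 1 then Suc v else 0)"
proof -
  note D = forestD[OF F]
  let ?O = "{v \<in> L. lab v = 2}" and ?R = "{v \<in> L. lab v = 1}" and ?F = "{v \<in> L. M v = 0}"
  let ?\<kappa> = "\<lambda>v. if lab v = 1 then Suc v else 0"
  have "?R = ?F \<union> (\<lambda>v. M v - 1) ` ?O"
  proof (intro equalityI subsetI)
    fix v assume v: "v \<in> ?R"
    show "v \<in> ?F \<union> (\<lambda>v. M v - 1) ` ?O"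
    proof (cases "M v")
      case (Suc y)
      have "lab y = 2" using D(6) v Suc by blast
      then show ?thesis using mate_onD[OF D(1) _ Suc] v by force
    qed (use v in simp)
  next
    fix v assume "v \<in> ?F \<union> (\<lambda>v. M v - 1) ` ?O"
    then show "v \<in> ?R" using D(3) D(5) by force
  qed
  moreover have "?F \<inter> (\<lambda>v. M v - 1) ` ?O = {}"
  proof -
    have False if v: "v \<in> L" "lab v = 2" "M (M v - 1) = 0" for v
    proof -
      obtain y where y: "M v = Suc y" using D(5)[OF v(1,2)] by auto
      then show False using mate_onD[OF D(1) v(1) y] v(3) by simp
    qed
    then show ?thesis by auto
  qed
  moreover have "inj_on (\<lambda>v. M v - 1) ?O"
  proof (rule inj_onI)
    fix v w assume v: "v \<in> ?O" "w \<in> ?O" and eq: "M v - 1 = M w - 1"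
    obtain y z where yz: "M v = Suc y" "M w = Suc z" using D(5) v by blast
    then show "v = w" using mate_onD(4)[OF D(1) _ yz(1)] mate_onD(4)[OF D(1) _ yz(2)] v eq by auto
  qed
  ultimately have R: "card ?R = card ?F + card ?O"
    using fin by (simp add: card_Un_disjoint card_image)
  have "Suc ` ?R \<subseteq> {j. odd (card (part L ?O ?\<kappa> j))}"
  proof
    fix j assume "j \<in> Suc ` ?R"
    then obtain v where v: "v \<in> L" "lab v = 1" "j = Suc v" by auto
    then have "part L ?O ?\<kappa> j = {v}" by (auto simp: part_def split: if_splits)
    then show "j \<in> {j. odd (card (part L ?O ?\<kappa> j))}" by simp
  qed
  moreover have "finite {j. odd (card (part L ?O ?\<kappa> j))}"
  proof (rule finite_subset)
    show "{j. odd (card (part L ?O ?\<kappa> j))} \<subseteq> ?\<kappa> ` L"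
    proof
      fix j assume "j \<in> {j. odd (card (part L ?O ?\<kappa> j))}"
      then have "part L ?O ?\<kappa> j \<noteq> {}" by auto
      then obtain v where "v \<in> L" "j = ?\<kappa> v" by (auto simp: part_def)
      then show "j \<in> ?\<kappa> ` L" by (rule rev_image_eqI)
    qed
  qed (use fin in simp)
  ultimately have "card (Suc ` ?R) \<le> card {j. odd (card (part L ?O ?\<kappa> j))}" by (rule card_mono[rotated])
  moreover have "card (Suc ` ?R) = card ?R" by (rule card_image) simp
  ultimately show ?thesis
    unfolding barrier_def using R st sym by auto
qed

text \<open>The matching \<open>T u\<close> leaves \<open>u\<close> free and departs from
  \<open>M\<close> only in the tree of \<open>u\<close>; likewise for \<open>x\<close>. As the trees
  are different, both changes can be made at once, and the edge from \<open>u\<close> to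
  \<open>x\<close> covers the two free vertices. No augmenting path has to be traced.\<close>

lemma forest_augment:
  assumes F: "forest L la M lab rt T" and fin: "finite L" and u: "u \<in> L" "lab u = 1" and x: "x \<in> L" "lab x = 1"
    and adj: "la u x" "la x u" and rt: "rt u \<noteq> rt x"
  defines "K \<equiv> \<lambda>v. if v = u then Suc x else if v = x then Suc u
    else if lab v \<noteq> 0 \<and> rt v = rt u then T u v else T x v"
  shows "mate_on L la K" "card {v \<in> L. K v = 0} + 2 = card {v \<in> L. M v = 0}"
proof -
  note D = forestD[OF F]
  note Tu = D(7)[OF u] and Tx = D(7)[OF x]
  have ux: "u \<noteq> x" using rt by auto
  have treeu: "T u v \<noteq> 0 \<and> (\<forall>y. T u v = Suc y \<longrightarrow> y \<in> L \<and> lab y \<noteq> 0 \<and> rt y = rt u)"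
    if "v \<in> L" "lab v \<noteq> 0" "rt v = rt u" "v \<noteq> u" for v
    using D(2)[OF that(1)] D(9)[OF u that(1)] D(10)[OF u that(1)] that by fastforce
  have treex: "T x v \<noteq> 0 \<and> (\<forall>y. T x v = Suc y \<longrightarrow> y \<in> L \<and> lab y \<noteq> 0 \<and> rt y = rt x)"
    if "v \<in> L" "lab v \<noteq> 0" "rt v = rt x" "v \<noteq> x" for v
    using D(2)[OF that(1)] D(9)[OF x that(1)] D(10)[OF x that(1)] that by fastforce
  \<comment> \<open>Edges of \<open>M\<close> do not leave a tree, so the two matchings can be
    patched together at the border of the tree of \<open>u\<close>.\<close>
  have Mtree: "lab z \<noteq> 0 \<Longrightarrow> lab v \<noteq> 0 \<and> rt v = rt z" if "v \<in> L" "M v = Suc z" for v z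
  proof -
    assume lz: "lab z \<noteq> 0"
    note z = mate_onD[OF D(1) that]
    consider "lab z = 1" | "lab z = 2" using D(2)[OF z(1)] lz by auto
    then show ?thesis
    proof cases
      case 1
      then have "lab v = 2" using D(6)[OF z(1) 1 z(4)] by simp
      then show ?thesis using D(5)[OF that(1)] that(2) by auto
    next
      case 2
      then show ?thesis using D(5)[OF z(1) 2] z(4) by auto
    qed
  qed
  show "mate_on L la K"
    unfolding mate_on_def
  proof (intro ballI allI impI)
    fix v z assume v: "v \<in> L" and vz: "K v = Suc z"
    consider (u) "v = u" | (x) "v = x" | (tu) "v \<noteq> u" "v \<noteq> x" "lab v \<noteq> 0" "rt v = rt u"
      | (o) "v \<noteq> u" "v \<noteq> x" "\<not> (lab v \<noteq> 0 \<and> rt v = rt u)" by blast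
    then show "z \<in> L \<and> z \<noteq> v \<and> la v z \<and> K z = Suc v"
    proof cases
      case u
      then show ?thesis using vz x adj ux by (auto simp: K_def)
    next
      case x
      then show ?thesis using vz u adj ux by (auto simp: K_def)
    next
      case tu
      then have Tv: "T u v = Suc z" using vz by (simp add: K_def)
      note z = mate_onD[OF conjunct1[OF Tu] v Tv]
      have "lab z \<noteq> 0" "rt z = rt u" using treeu[OF v tu(3,4,1)] Tv by auto
      moreover have "z \<noteq> u" using z(4) Tu by auto
      ultimately show ?thesis using z rt by (auto simp: K_def)
    next
      case o
      then have Tv: "T x v = Suc z" using vz by (auto simp: K_def split: if_splits)
      note z = mate_onD[OF conjunct1[OF Tx] v Tv]
      have "\<not> (lab z \<noteq> 0 \<and> rt z = rt u)"
      proof (cases "lab v \<noteq> 0 \<and> rt v = rt x")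
        case True
        then show ?thesis using treex[OF v _ _ o(2)] Tv rt by auto
      next
        case False
        then have "M v = Suc z" using D(8)[OF x v] Tv by auto
        then show ?thesis using Mtree[OF v] o(3) by auto
      qed
      moreover have "z \<noteq> x" using z(4) Tx by auto
      moreover have "z \<noteq> u" using calculation u by auto
      ultimately show ?thesis using z by (auto simp: K_def)
    qed
  qed
  let ?F = "{v \<in> L. M v = 0}"
  have r: "rt u \<in> ?F" "rt x \<in> ?F" using D(4)[OF u(1)] D(4)[OF x(1)] u x by auto
  have "{v \<in> L. K v = 0} = ?F - {rt u, rt x}"
  proof (intro equalityI subsetI)
    fix v assume "v \<in> {v \<in> L. K v = 0}"
    then have v: "v \<in> L" "K v = 0" by auto
    have Kux: "K u = Suc x" "K x = Suc u" using ux by (simp_all add: K_def)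
    then have ne: "v \<noteq> u" "v \<noteq> x" using v(2) by fastforce+
    have nu: "\<not> (lab v \<noteq> 0 \<and> rt v = rt u)"
    proof
      assume t: "lab v \<noteq> 0 \<and> rt v = rt u"
      then have "T u v = K v" using ne by (simp add: K_def)
      then show False using treeu[OF v(1)] t ne v(2) by metis
    qed
    have "K v = T x v" unfolding K_def using ne nu by auto
    then have T0: "T x v = 0" using v(2) by simp
    have nx: "\<not> (lab v \<noteq> 0 \<and> rt v = rt x)" using T0 ne treex[OF v(1)] by metis
    then have M0: "M v = 0" using D(8)[OF x v(1)] T0 by auto
    then show "v \<in> ?F - {rt u, rt x}" using D(3)[OF v(1)] nu nx v by auto
  next
    fix v assume "v \<in> ?F - {rt u, rt x}"
    then have v: "v \<in> L" "M v = 0" "v \<noteq> rt u" "v \<noteq> rt x" by auto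
    have lv: "lab v = 1" "rt v = v" using D(3)[OF v(1,2)] by auto
    then have "v \<noteq> u" "v \<noteq> x" using v by auto
    moreover have "T x v = M v" using D(8)[OF x v(1)] lv v by auto
    ultimately show "v \<in> {v \<in> L. K v = 0}" using v lv by (auto simp: K_def)
  qed
  then show "card {v \<in> L. K v = 0} + 2 = card ?F"
    using r rt fin card_Diff_subset[of "{rt u, rt x}" ?F] card_mono[of ?F "{rt u, rt x}"] by auto
qed

text \<open>The free sets of \<open>T u\<close> and \<open>M\<close> differ only in that
  \<open>u\<close> takes the place of \<open>rt u\<close>.\<close>

lemma free_tree:
  assumes F: "forest L la M lab rt T" and fin: "finite L" and u: "u \<in> L" "lab u = 1"
  shows "card {v \<in> L. T u v = 0} = card {v \<in> L. M v = 0}"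
proof -
  note D = forestD[OF F]
  have r: "rt u \<in> L" "M (rt u) = 0" using D(4)[OF u(1)] u by auto
  have eq: "{v \<in> L. T u v = 0} - {u} = {v \<in> L. M v = 0} - {rt u}"
  proof (intro equalityI subsetI)
    fix v assume "v \<in> {v \<in> L. T u v = 0} - {u}"
    then have v: "v \<in> L" "T u v = 0" "v \<noteq> u" by auto
    have nt: "lab v = 0 \<or> rt v \<noteq> rt u"
      using D(2)[OF v(1)] D(9)[OF u v(1)] D(10)[OF u v(1)] v by fastforce
    then have "M v = 0" using D(8)[OF u v(1)] v by simp
    then show "v \<in> {v \<in> L. M v = 0} - {rt u}" using nt D(3)[OF v(1)] D(3)[OF r] v by auto
  next
    fix v assume "v \<in> {v \<in> L. M v = 0} - {rt u}"
    then have v: "v \<in> L" "M v = 0" "v \<noteq> rt u" by auto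
    have "rt v = v" using D(3)[OF v(1,2)] by simp
    then show "v \<in> {v \<in> L. T u v = 0} - {u}" using D(8)[OF u v(1)] v by auto
  qed
  have "u \<in> {v \<in> L. T u v = 0}" "rt u \<in> {v \<in> L. M v = 0}" using D(7)[OF u] u r by auto
  moreover have "finite {v \<in> L. T u v = 0}" "finite {v \<in> L. M v = 0}" using fin by auto
  ultimately have "card {v \<in> L. T u v = 0} = Suc (card ({v \<in> L. T u v = 0} - {u}))"
    "card {v \<in> L. M v = 0} = Suc (card ({v \<in> L. M v = 0} - {rt u}))"
    by (simp_all only: card.remove)
  then show ?thesis unfolding eq by simp
qed

subsection \<open>Blossoms\<close>

text \<open>For an edge joining two outer vertices \<open>u\<close>, \<open>x\<close> of one tree, \<open>T u\<close> and \<open>T x\<close> differ on an even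
  alternating path from \<open>u\<close> to \<open>x\<close>, which the edge closes to an odd cycle. \<open>pos\<close> numbers the vertices of
  the path from 1 on.\<close>

definition walk ::
    "nat set \<Rightarrow> (nat \<Rightarrow> nat) \<Rightarrow> (nat \<Rightarrow> nat) \<Rightarrow> (nat \<Rightarrow> nat) \<Rightarrow> (nat \<Rightarrow> nat) \<Rightarrow> nat \<Rightarrow> (nat \<Rightarrow> nat) \<Rightarrow> nat \<Rightarrow> nat \<Rightarrow> bool" where
  "walk L lab rt Tu Tx u pos cur k \<longleftrightarrow> pos u = 1 \<and> pos cur = k \<and> odd k
   \<and> (\<forall>v. pos v \<noteq> 0 \<longrightarrow> v \<in> L \<and> pos v \<le> k \<and> rt v = rt u \<and> lab v = (if odd (pos v) then 1 else 2))
   \<and> (\<forall>v v'. pos v = pos v' \<and> pos v \<noteq> 0 \<longrightarrow> v = v')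
   \<and> (\<forall>v. odd (pos v) \<and> pos v < k \<longrightarrow> (\<exists>y. Tx v = Suc y \<and> pos y = Suc (pos v)))
   \<and> (\<forall>v. even (pos v) \<and> pos v \<noteq> 0 \<longrightarrow> (\<exists>y. Tx v = Suc y \<and> Suc (pos y) = pos v))
   \<and> (\<forall>v. even (pos v) \<and> pos v \<noteq> 0 \<longrightarrow> (\<exists>y. Tu v = Suc y \<and> pos y = Suc (pos v)))
   \<and> (\<forall>v. odd (pos v) \<and> pos v \<noteq> 1 \<longrightarrow> (\<exists>y. Tu v = Suc y \<and> Suc (pos y) = pos v))"

lemma walkD:
  assumes "walk L lab rt Tu Tx u pos cur k"
  shows "pos u = 1" "pos cur = k" "odd k"
    and "pos v \<noteq> 0 \<Longrightarrow> v \<in> L \<and> pos v \<le> k \<and> rt v = rt u \<and> lab v = (if odd (pos v) then 1 else 2)"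
    and "pos v = pos v' \<Longrightarrow> pos v \<noteq> 0 \<Longrightarrow> v = v'"
    and "odd (pos v) \<Longrightarrow> pos v < k \<Longrightarrow> \<exists>y. Tx v = Suc y \<and> pos y = Suc (pos v)"
    and "even (pos v) \<Longrightarrow> pos v \<noteq> 0 \<Longrightarrow> \<exists>y. Tx v = Suc y \<and> Suc (pos y) = pos v"
    and "even (pos v) \<Longrightarrow> pos v \<noteq> 0 \<Longrightarrow> \<exists>y. Tu v = Suc y \<and> pos y = Suc (pos v)"
    and "odd (pos v) \<Longrightarrow> pos v \<noteq> 1 \<Longrightarrow> \<exists>y. Tu v = Suc y \<and> Suc (pos y) = pos v"
  using assms unfolding walk_def by blast+

lemma walk_init:
  assumes "u \<in> L" "lab u = 1"
  shows "walk L lab rt Tu Tx u ((\<lambda>_. 0)(u := 1)) u 1"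
  using assms by (auto simp: walk_def)

text \<open>From the outer end \<open>cur\<close> the matching \<open>T x\<close> leads to an inner
  vertex \<open>y\<close>, and \<open>T u\<close> leads on to an outer vertex \<open>z\<close>; the
  path stops only at \<open>x\<close>, which \<open>T x\<close> leaves free. No vertex repeats: a
  vertex of the path other than \<open>u\<close> is matched back to its predecessor, so
  \<open>cur\<close> would have to precede \<open>y\<close>, or \<open>y\<close> to precede
  \<open>z\<close>, already on the old path.\<close>

lemma walk_step:
  assumes F: "forest L la M lab rt T" and u: "u \<in> L" "lab u = 1" and x: "x \<in> L" "lab x = 1" "rt x = rt u"
    and W: "walk L lab rt (T u) (T x) u pos cur k" and cur: "cur \<noteq> x"
  obtains y z where "T x cur = Suc y" "T u y = Suc z" "y \<in> L" "z \<in> L" "pos y = 0" "pos z = 0" "y \<noteq> z"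
    "walk L lab rt (T u) (T x) u (pos(y := k + 1, z := k + 2)) z (k + 2)"
proof -
  note D = forestD[OF F] and w = walkD[OF W]
  have k: "k \<noteq> 0" using w(3) by (cases k) auto
  have c: "cur \<in> L" "lab cur = 1" "rt cur = rt u" using w(2,3) w(4)[of cur] k by auto
  obtain y where y: "y \<in> L" "T x cur = Suc y" "lab y = 2" "rt y = rt x"
    using D(9)[OF x(1,2) c(1,2)] c x cur by auto
  have yc: "T x y = Suc cur" by (rule mate_onD(4)[OF conjunct1[OF D(7)[OF x(1,2)]] c(1) y(2)])
  have py: "pos y = 0"
  proof (rule ccontr)
    assume ny: "pos y \<noteq> 0"
    have "lab y = (if odd (pos y) then 1 else 2)" using w(4)[OF ny] by blast
    then have "even (pos y)" using y(3) by (cases "odd (pos y)") simp_all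
    from w(7)[OF this ny] obtain y' where "T x y = Suc y'" "Suc (pos y') = pos y" by blast
    then have "Suc k = pos y" using yc w(2) by simp
    then show False using w(4)[OF ny] by simp
  qed
  obtain z where z: "z \<in> L" "T u y = Suc z" "lab z = 1" "rt z = rt u"
    using D(10)[OF u y(1,3)] y x by auto
  have zy: "T u z = Suc y" by (rule mate_onD(4)[OF conjunct1[OF D(7)[OF u]] y(1) z(2)])
  have pz: "pos z = 0"
  proof (rule ccontr)
    assume nz: "pos z \<noteq> 0"
    have "lab z = (if odd (pos z) then 1 else 2)" using w(4)[OF nz] by blast
    then have o: "odd (pos z)" using z(3) by (cases "odd (pos z)") simp_all
    show False
    proof (cases "pos z = 1")
      case True
      then have "z = u" using w(5)[of z u] w(1) by simp
      then show False using zy D(7)[OF u] by simp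
    next
      case False
      from w(9)[OF o this] obtain y' where y': "T u z = Suc y'" "Suc (pos y') = pos z" by blast
      then have "pos z = 1" using zy py by simp
      then show False using False by simp
    qed
  qed
  have ne: "y \<noteq> z" using y z by auto
  have uyz: "u \<noteq> y" "u \<noteq> z" "cur \<noteq> y" "cur \<noteq> z" using w(1,2) py pz k by auto
  let ?p = "pos(y := k + 1, z := k + 2)"
  have old: "?p v = pos v" if "pos v \<noteq> 0" for v using that py pz by auto
  have le: "pos v \<le> k" for v using w(4)[of v] by (cases "pos v = 0") auto
  have "walk L lab rt (T u) (T x) u ?p z (k + 2)"
    unfolding walk_def
  proof (intro conjI allI impI)
    show "?p u = 1" using uyz w(1) by simp
    show "?p z = k + 2" by simp
    show "odd (k + 2)" using w(3) by simp
  next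
    fix v assume v: "?p v \<noteq> 0"
    have "v \<in> L \<and> ?p v \<le> k + 2 \<and> rt v = rt u \<and> lab v = (if odd (?p v) then 1 else 2)"
      using w(4)[of v] v y z x w(3) ne by (auto split: if_splits)
    then show "v \<in> L" "?p v \<le> k + 2" "rt v = rt u" "lab v = (if odd (?p v) then 1 else 2)" by blast+
  next
    fix v v' assume v: "?p v = ?p v' \<and> ?p v \<noteq> 0"
    show "v = v'" using v w(5)[of v v'] le[of v] le[of v'] by (auto split: if_splits)
  next
    fix v assume v: "odd (?p v) \<and> ?p v < k + 2"
    then have vyz: "v \<noteq> z" "v \<noteq> y" using w(3) ne by auto
    then have ov: "odd (pos v)" using v by simp
    show "\<exists>y'. T x v = Suc y' \<and> ?p y' = Suc (?p v)"
    proof (cases "pos v = k")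
      case True
      then have "v = cur" using w(5)[of v cur] w(2) k by simp
      then show ?thesis using y(2) True vyz ne by auto
    next
      case False
      then obtain y' where y': "T x v = Suc y'" "pos y' = Suc (pos v)" using w(6)[of v] ov le[of v] by auto
      then show ?thesis using old[of y'] vyz by auto
    qed
  next
    fix v assume v: "even (?p v) \<and> ?p v \<noteq> 0"
    then have vz: "v \<noteq> z" using w(3) by auto
    show "\<exists>y'. T x v = Suc y' \<and> Suc (?p y') = ?p v"
    proof (cases "v = y")
      case True
      then show ?thesis using yc uyz w(2) ne by auto
    next
      case False
      then obtain y' where y': "T x v = Suc y'" "Suc (pos y') = pos v" using w(7)[of v] v vz by auto
      have "pos y' \<noteq> 0"
      proof
        assume "pos y' = 0"
        then have "pos v = 1" using y'(2) by simp
        then show False using v vz False by simp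
      qed
      then show ?thesis using y' old[of y'] vz False by auto
    qed
  next
    fix v assume v: "even (?p v) \<and> ?p v \<noteq> 0"
    then have vz: "v \<noteq> z" using w(3) by auto
    show "\<exists>y'. T u v = Suc y' \<and> ?p y' = Suc (?p v)"
    proof (cases "v = y")
      case True
      then show ?thesis using z ne by auto
    next
      case False
      then obtain y' where y': "T u v = Suc y'" "pos y' = Suc (pos v)" using w(8)[of v] v vz by auto
      then show ?thesis using old[of y'] vz False by auto
    qed
  next
    fix v assume v: "odd (?p v) \<and> ?p v \<noteq> 1"
    show "\<exists>y'. T u v = Suc y' \<and> Suc (?p y') = ?p v"
    proof (cases "v = z")
      case True
      then show ?thesis using zy ne by auto
    next
      case False
      have vy: "v \<noteq> y" using v w(3) ne by auto
      then obtain y' where y': "T u v = Suc y'" "Suc (pos y') = pos v" using w(9)[of v] v False by auto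
      have "pos y' \<noteq> 0" using y' v vy False by auto
      then show ?thesis using y' old[of y'] vy False by auto
    qed
  qed
  then show ?thesis using that[of y z] y z py pz ne by blast
qed

text \<open>Without \<open>c\<close> the odd cycle becomes a path on an even number of vertices,
  which is matched alternately. \<open>Tx\<close> pairs the positions 1-2, 3-4 and so on,
  \<open>Tu\<close> the positions 2-3, 4-5 and so on. If \<open>c\<close> has an odd position,
  \<open>Tx\<close> serves before it and \<open>Tu\<close> after it. If the position is even,
  \<open>Tu\<close> serves before and \<open>Tx\<close> after it, which leaves over the ends
  \<open>u\<close> and \<open>x\<close>, and these are joined by the closing edge. Off the cycle
  \<open>Tu\<close> is kept.\<close>

definition blossom_mate ::
    "(nat \<Rightarrow> nat) \<Rightarrow> (nat \<Rightarrow> nat) \<Rightarrow> nat \<Rightarrow> nat \<Rightarrow> (nat \<Rightarrow> nat) \<Rightarrow> nat \<Rightarrow> nat \<Rightarrow> nat" where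
  "blossom_mate Tu Tx u x pos c b = (if pos b = 0 then Tu b else if b = c then 0
     else if odd (pos c) then (if pos b < pos c then Tx b else Tu b)
     else if b = u then Suc x else if b = x then Suc u else if pos b < pos c then Tu b else Tx b)"

lemma blossom_mate:
  assumes W: "walk L lab rt Tu Tx u pos x k" and Tu: "mate_on L la Tu" "Tu u = 0" and Tx: "mate_on L la Tx"
    and adj: "la u x" "la x u" "u \<noteq> x" and c: "pos c \<noteq> 0"
  shows "mate_on L la (blossom_mate Tu Tx u x pos c)"
    and "near_perfect {v. pos v \<noteq> 0} c (blossom_mate Tu Tx u x pos c)"
proof -
  note w = walkD[OF W]
  let ?K = "blossom_mate Tu Tx u x pos c"
  have uL: "u \<in> L" "x \<in> L" using w(4)[of u] w(4)[of x] w(1,2,3) by (auto intro: odd_pos)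
  have k0: "k \<noteq> 0" using w(3) by (cases k) auto
  have pu: "pos v = 1 \<longleftrightarrow> v = u" for v using w(5)[of v u] w(1) by auto
  have px: "pos v = k \<longleftrightarrow> v = x" for v using w(5)[of v x] w(2) k0 by auto
  have ck: "pos c \<le> k" using w(4)[OF c] by simp
  have in_b: "\<exists>z. ?K b = Suc z \<and> pos z \<noteq> 0 \<and> z \<in> L \<and> z \<noteq> b \<and> la b z \<and> ?K z = Suc b"
    if b: "pos b \<noteq> 0" "b \<noteq> c" for b
  proof -
    have bL: "b \<in> L" "pos b \<le> k" using w(4)[OF b(1)] by auto
    have pbc: "pos b \<noteq> pos c" using w(5)[of b c] b by auto
    show ?thesis
    proof (cases "odd (pos c)")
      case oc: True
      show ?thesis
      proof (cases "pos b < pos c")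
        case lt: True
        have Nb: "?K b = Tx b" using b oc lt by (simp add: blossom_mate_def)
        obtain z where z: "Tx b = Suc z" "pos z \<noteq> 0" "pos z < pos c"
        proof (cases "odd (pos b)")
          case True
          then obtain z where z: "Tx b = Suc z" "pos z = Suc (pos b)" using w(6)[of b] lt ck by auto
          have "pos z \<noteq> pos c" using z(2) True oc by (metis even_Suc)
          then show ?thesis using that[of z] z lt by simp
        next
          case False
          then obtain z where z: "Tx b = Suc z" "Suc (pos z) = pos b" using w(7)[of b] b by auto
          have "pos z \<noteq> 0" using z(2) False by (metis even_Suc even_zero)
          then show ?thesis using that[of z] z lt by simp
        qed
        note zp = mate_onD[OF Tx bL(1) z(1)]
        have "?K z = Tx z" using z oc by (auto simp: blossom_mate_def)
        then show ?thesis using Nb z zp by auto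
      next
        case ge: False
        have gt: "pos c < pos b" using ge pbc by simp
        have Nb: "?K b = Tu b" using b oc ge by (simp add: blossom_mate_def)
        obtain z where z: "Tu b = Suc z" "pos c < pos z"
        proof (cases "odd (pos b)")
          case True
          then have "pos b \<noteq> 1" using gt c by auto
          then obtain z where z: "Tu b = Suc z" "Suc (pos z) = pos b" using w(9)[of b] True by auto
          have "pos z \<noteq> pos c" using z(2) True oc by (metis even_Suc)
          then show ?thesis using that[of z] z gt by simp
        next
          case False
          then obtain z where z: "Tu b = Suc z" "pos z = Suc (pos b)" using w(8)[of b] b by auto
          then show ?thesis using that[of z] gt by simp
        qed
        note zp = mate_onD[OF Tu(1) bL(1) z(1)]
        have "?K z = Tu z" using z oc by (auto simp: blossom_mate_def)
        then show ?thesis using Nb z zp by auto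
      qed
    next
      case ec: False
      have c1: "pos c \<noteq> 1" "pos c \<noteq> k" using ec w(3) by auto
      then have cu: "c \<noteq> u" "c \<noteq> x" using pu px by auto
      have xu: "pos x \<noteq> 0" "pos u \<noteq> 0" using w(1,2) k0 by auto
      consider "b = u" | "b = x" | "b \<noteq> u" "b \<noteq> x" by blast
      then show ?thesis
      proof cases
        case 1
        then show ?thesis using cu xu adj uL ec by (auto simp: blossom_mate_def)
      next
        case 2
        then show ?thesis using cu xu adj uL ec by (auto simp: blossom_mate_def)
      next
        case 3
        have b1: "pos b \<noteq> 1" "pos b \<noteq> k" using 3 pu px by auto
        show ?thesis
        proof (cases "pos b < pos c")
          case lt: True
          have Nb: "?K b = Tu b" using b ec lt 3 by (simp add: blossom_mate_def)
          obtain z where z: "Tu b = Suc z" "pos z \<noteq> 0" "pos z < pos c" "pos z \<noteq> 1"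
          proof (cases "odd (pos b)")
            case True
            then obtain z where z: "Tu b = Suc z" "Suc (pos z) = pos b" using w(9)[of b] b1 by auto
            have "even (pos z)" using z(2) True by (metis even_Suc)
            moreover have "pos z \<noteq> 0" using z b1 by auto
            ultimately show ?thesis using that[of z] z lt by auto
          next
            case False
            then obtain z where z: "Tu b = Suc z" "pos z = Suc (pos b)" using w(8)[of b] b by auto
            have "pos z \<noteq> pos c" using z(2) False ec by (metis even_Suc)
            then show ?thesis using that[of z] z lt b by simp
          qed
          note zp = mate_onD[OF Tu(1) bL(1) z(1)]
          have "z \<noteq> u" "z \<noteq> x" using z pu px[of z] ck by auto
          then have "?K z = Tu z" using z ec by (auto simp: blossom_mate_def)
          then show ?thesis using Nb z zp by auto
        next
          case ge: False
          have gt: "pos c < pos b" using ge pbc by simp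
          have Nb: "?K b = Tx b" using b ec ge 3 by (simp add: blossom_mate_def)
          obtain z where z: "Tx b = Suc z" "pos c < pos z" "pos z \<noteq> k"
          proof (cases "odd (pos b)")
            case True
            then obtain z where z: "Tx b = Suc z" "pos z = Suc (pos b)" using w(6)[of b] b1 bL by auto
            have "pos z \<noteq> k" using z(2) True w(3) by (metis even_Suc)
            then show ?thesis using that[of z] z gt by simp
          next
            case False
            then obtain z where z: "Tx b = Suc z" "Suc (pos z) = pos b" using w(7)[of b] b by auto
            have "pos z \<noteq> pos c" using z(2) False ec by (metis even_Suc)
            then show ?thesis using that[of z] z gt bL by simp
          qed
          note zp = mate_onD[OF Tx bL(1) z(1)]
          have "z \<noteq> u" "z \<noteq> x" using z pu[of z] px c by auto
          then have "?K z = Tx z" using z ec by (auto simp: blossom_mate_def)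
          then show ?thesis using Nb z zp by auto
        qed
      qed
    qed
  qed
  have Nc: "?K c = 0" using c by (simp add: blossom_mate_def)
  show "near_perfect {v. pos v \<noteq> 0} c ?K"
    unfolding near_perfect_def using Nc in_b by blast
  show "mate_on L la ?K"
    unfolding mate_on_def
  proof (intro ballI allI impI)
    fix b z assume b: "b \<in> L" and bz: "?K b = Suc z"
    show "z \<in> L \<and> z \<noteq> b \<and> la b z \<and> ?K z = Suc b"
    proof (cases "pos b = 0")
      case False
      then show ?thesis using in_b[of b] bz Nc by force
    next
      case True
      then have Tb: "Tu b = Suc z" using bz by (simp add: blossom_mate_def)
      note zp = mate_onD[OF Tu(1) b Tb]
      \<comment> \<open>Except for \<open>u\<close>, which \<open>Tu\<close> leaves free, the
        vertices of the cycle are matched by \<open>Tu\<close> within the cycle; hence no mate of an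
        outside vertex lies on it.\<close>
      have "pos z = 0"
      proof (rule ccontr)
        assume nz: "pos z \<noteq> 0"
        have "z \<noteq> u" using zp Tu by auto
        then have "pos z \<noteq> 1" using pu by simp
        then obtain b' where "Tu z = Suc b'" "pos b' \<noteq> 0"
          using w(8)[of z] w(9)[of z] nz by (cases "odd (pos z)") fastforce+
        then show False using zp True by simp
      qed
      then show ?thesis using zp by (simp add: blossom_mate_def)
    qed
  qed
qed

subsection \<open>Matrices in memory\<close>

text \<open>Row \<open>a\<close> of an \<open>n \<times> n\<close> matrix starts at index \<open>a * n\<close>. There is no multiplication, so the array
  \<open>r\<close> holds these products.\<close>

text \<open>Bob's variables: \<open>m\<close> is his current matching and \<open>R\<close>, \<open>Q\<close>, \<open>w\<close> are the maps \<open>rep\<close>, \<open>Q\<close>, \<open>w\<close> of the current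
  contraction; \<open>M\<close> is the matching of the contracted graph and \<open>l\<close>, \<open>o\<close>, \<open>T\<close> are \<open>lab\<close>, \<open>rt\<close>, \<open>T\<close> of its
  forest. The edge from \<open>u\<close> to \<open>x\<close> is under inspection and \<open>e\<close> tells whether it joins two outer vertices.
  \<open>P\<close> is \<open>pos\<close>, and \<open>C\<close>, \<open>S\<close> hold the matchings built for a new blossom. A phase ends with \<open>g = 1\<close> if
  \<open>m\<close> was augmented and with \<open>g = 2\<close> if the forest got stuck.\<close>

abbreviation G2 :: "vname \<Rightarrow> aexp \<Rightarrow> aexp \<Rightarrow> aexp" where
  "G2 X a b \<equiv> Get X (Plus (Get ''r'' a) b)"

definition Eq :: "aexp \<Rightarrow> aexp \<Rightarrow> bexp" where
  "Eq a b = And (Not (Less a b)) (Not (Less b a))"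

lemma bval_Eq [simp]: "bval (Eq a b) s \<longleftrightarrow> aval a s = aval b s"
  by (auto simp: Eq_def)

abbreviation Set :: "vname \<Rightarrow> aexp \<Rightarrow> com" where
  "Set x a \<equiv> Put x (N 0) a"

definition mt :: "nat \<Rightarrow> state \<Rightarrow> vname \<Rightarrow> nat \<Rightarrow> nat \<Rightarrow> nat" where
  "mt n s X a b = s X (a * n + b)"

definition edge_rel :: "(nat \<times> nat) set \<Rightarrow> nat \<Rightarrow> nat \<Rightarrow> bool" where
  "edge_rel D a b \<longleftrightarrow> (a, b) \<in> D \<or> (b, a) \<in> D"

text \<open>What stays fixed while Bob computes. The value of \<open>h\<close> bounds the loop that
  clears a whole matrix.\<close>

definition bctx :: "nat \<Rightarrow> (nat \<times> nat) list \<Rightarrow> state \<Rightarrow> bool" where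
  "bctx n es s \<longleftrightarrow> s ''n'' 0 = n \<and> s ''h'' 0 = n * n \<and> (\<forall>a\<le>n. s ''r'' a = a * n)
     \<and> load_edges ''edges'' s @ load_edges ''msg'' s = es"

definition ctx_vars :: "vname set" where
  "ctx_vars = {''n'', ''h'', ''r'', ''edges_len'', ''edges_fst'', ''edges_snd'', ''msg_len'', ''msg_fst'', ''msg_snd''}"

lemma bctx_frame:
  assumes "bctx n es s" "frame X s t" "X \<inter> ctx_vars = {}"
  shows "bctx n es t"
proof -
  have "t y = s y" if "y \<in> ctx_vars" for y using assms(2,3) that by (auto simp: frame_def)
  then show ?thesis using assms(1) by (simp add: bctx_def load_edges_def ctx_vars_def)
qed

lemma bctxD:
  assumes "bctx n es s"
  shows "s ''n'' 0 = n" "s ''h'' 0 = n * n" "a \<le> n \<Longrightarrow> s ''r'' a = a * n"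
    "load_edges ''edges'' s @ load_edges ''msg'' s = es"
  using assms by (auto simp: bctx_def)

lemma mt_cong: "s' X = s X \<Longrightarrow> mt n s' X = mt n s X"
  by (simp add: mt_def fun_eq_iff)

lemma row_index:
  assumes "b < n"
  shows "(p * n \<le> a * n + b \<and> a * n + b < p * n + n) \<longleftrightarrow> a = (p :: nat)"
proof
  assume *: "p * n \<le> a * n + b \<and> a * n + b < p * n + n"
  have "(a * n + b) div n = a" using assms by simp
  moreover have "(a * n + b) div n = p"
    by (rule div_nat_eqI) (use * in \<open>auto simp: mult.commute\<close>)
  ultimately show "a = p" by simp
qed (use assms in auto)

lemma mt_fill:
  assumes "s' X = (\<lambda>k. if p * n \<le> k \<and> k < p * n + n then v (k - p * n) else s X k)" "b < n"
  shows "mt n s' X a b = (if a = p then v b else mt n s X a b)"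
  using row_index[OF assms(2), of p a] assms by (auto simp: mt_def)

lemma entry_index:
  assumes "b < n" "b' < n"
  shows "a * n + b = a' * n + b' \<longleftrightarrow> a = a' \<and> b = (b' :: nat)"
  using row_index[OF assms(1), of a' a] assms by auto

subsection \<open>Lifting a matching out of the contracted graph\<close>

text \<open>Evaluates \<open>lift_mate\<close> at \<open>i\<close>: \<open>y\<close> is the class of
  \<open>i\<close> and \<open>d\<close> the exposed vertex of that class.\<close>

definition lift_body :: "vname \<Rightarrow> com" where
  "lift_body src = Seq (Set ''y'' (Get ''R'' (V ''i'')))
    (Seq (If (Eq (Get src (V ''y'')) (N 0))
           (If (Eq (V ''y'') (V ''c'')) (Set ''d'' (V ''a'')) (Set ''d'' (V ''y'')))
           (Seq (Set ''z'' (Minus (Get src (V ''y'')) (N 1))) (Set ''d'' (Minus (G2 ''w'' (V ''y'') (V ''z'')) (N 1)))))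
    (If (Eq (V ''d'') (V ''i''))
       (If (Eq (Get src (V ''y'')) (N 0)) (Set ''t'' (N 0)) (Set ''t'' (G2 ''w'' (V ''z'') (V ''y''))))
       (Set ''t'' (G2 ''Q'' (V ''d'') (V ''i'')))))"

definition lift_prog :: "vname \<Rightarrow> vname \<Rightarrow> aexp \<Rightarrow> com" where
  "lift_prog src X off = Fill ''i'' ''n'' (lift_body src) X off ''t''"

lemma mods_lift_body [simp]: "mods (lift_body src) = {''y'', ''d'', ''z'', ''t''}"
  by (auto simp: lift_body_def)

lemma lift_body_val:
  assumes r: "\<And>a. a \<le> n \<Longrightarrow> u ''r'' a = a * n" and src: "src = ''M'' \<or> src = ''C''"
    and i: "u ''i'' 0 = b" "u ''R'' b < n"
    and e: "exposed (mt n u ''w'') (u src) (u ''c'' 0) (u ''a'' 0) (u ''R'' b) < n"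
    and z: "\<And>z. u src (u ''R'' b) = Suc z \<Longrightarrow> z < n"
  shows "run (lift_body src) u ''t'' 0
    = lift_mate (u ''R'') (mt n u ''Q'') (mt n u ''w'') (u src) (u ''c'' 0) (u ''a'' 0) b"
proof -
  have ns: "src \<noteq> ''y''" "src \<noteq> ''d''" "src \<noteq> ''z''" "src \<noteq> ''t''" using src by auto
  let ?y = "u ''R'' b" and ?c = "u ''c'' 0" and ?a = "u ''a'' 0"
  have ry: "u ''r'' ?y = ?y * n" using r i(2) by simp
  show ?thesis
  proof (cases "u src ?y")
    case 0
    let ?d = "if ?y = ?c then ?a else ?y"
    have d: "exposed (mt n u ''w'') (u src) ?c ?a ?y = ?d" using 0 by (simp add: exposed_def)
    then have "u ''r'' ?d = ?d * n" using r[of ?d] e by simp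
    moreover have "run (lift_body src) u ''t'' 0 = (if ?d = b then 0 else u ''Q'' (u ''r'' ?d + b))"
      using ns i 0 by (auto simp: lift_body_def)
    ultimately show ?thesis unfolding lift_mate_def Let_def d using 0 by (simp add: mt_def)
  next
    case (Suc z')
    let ?d = "u ''w'' (?y * n + z') - 1"
    have d: "exposed (mt n u ''w'') (u src) ?c ?a ?y = ?d" using Suc by (simp add: exposed_def mt_def)
    then have "u ''r'' ?d = ?d * n" using r[of ?d] e by simp
    moreover have "u ''r'' z' = z' * n" using r[of z'] z[OF Suc] by simp
    moreover have "run (lift_body src) u ''t'' 0 =
        (if ?d = b then u ''w'' (u ''r'' z' + ?y) else u ''Q'' (u ''r'' ?d + b))"
      using ns i Suc ry by (simp add: lift_body_def)
    ultimately show ?thesis unfolding lift_mate_def Let_def d using Suc by (simp add: mt_def)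
  qed
qed

lemma lift_runs:
  assumes W: "100 \<le> W" "n \<le> W" and c: "bctx n es s"
    and rep: "\<And>b. b < n \<Longrightarrow> s ''R'' b < n"
    and ex: "\<And>b. b < n \<Longrightarrow> exposed (mt n s ''w'') (s src) (s ''c'' 0) (s ''a'' 0) (s ''R'' b) < n"
    and z: "\<And>b z. b < n \<Longrightarrow> s src (s ''R'' b) = Suc z \<Longrightarrow> z < n"
    and src: "src = ''M'' \<or> src = ''C''" and X: "X = ''m'' \<or> X = ''S''"
    and off: "\<And>u. frame {''i'', X, ''y'', ''d'', ''z'', ''t''} s u \<Longrightarrow> aval off u = p"
  obtains s' where "runs (lift_prog src X off) s (W ^ 6) s'"
    "s' X = (\<lambda>k. if p \<le> k \<and> k < p + n then
       lift_mate (s ''R'') (mt n s ''Q'') (mt n s ''w'') (s src) (s ''c'' 0) (s ''a'' 0) (k - p) else s X k)"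
    "frame {''i'', X, ''y'', ''d'', ''z'', ''t''} s s'"
proof -
  let ?B = "lift_body src"
  note cD = bctxD[OF c]
  obtain s' where "runs (Fill ''i'' ''n'' ?B X off ''t'') s (W ^ 6) s'"
    "s' X = (\<lambda>k. if p \<le> k \<and> k < p + s ''n'' 0 then
       lift_mate (s ''R'') (mt n s ''Q'') (mt n s ''w'') (s src) (s ''c'' 0) (s ''a'' 0) (k - p) else s X k)"
    "frame (insert ''i'' (insert X (mods ?B))) s s'"
  proof (rule runs_Fill[where W = W and s = s and i = "''i''" and l = "''n''" and B = ?B and X = X and off = off
      and t = "''t''" and p = p and val = "lift_mate (s ''R'') (mt n s ''Q'') (mt n s ''w'') (s src) (s ''c'' 0) (s ''a'' 0)"])
    fix u assume "frame (insert ''i'' (insert X (mods ?B))) s u"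
    then show "aval off u = p" using off by simp
  next
    fix j u assume j: "j < s ''n'' 0" "u ''i'' 0 = j" and fr: "frame (insert ''i'' (insert X (mods ?B))) s u"
    have f: "u ''r'' = s ''r''" "u ''R'' = s ''R''" "u ''Q'' = s ''Q''" "u ''w'' = s ''w''" "u src = s src"
      "u ''c'' = s ''c''" "u ''a'' = s ''a''"
      using X src by (auto intro!: frameD[OF fr])
    have m: "mt n u ''Q'' = mt n s ''Q''" "mt n u ''w'' = mt n s ''w''" by (rule mt_cong; simp only: f)+
    have jn: "j < n" using j cD by simp
    show "run ?B u ''t'' 0
      = lift_mate (s ''R'') (mt n s ''Q'') (mt n s ''w'') (s src) (s ''c'' 0) (s ''a'' 0) j"
      unfolding f[symmetric] m[symmetric]
      by (rule lift_body_val[where u = u and src = src and b = j and n = n])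
        (use src j(2) cD(3) rep[OF jn] ex[OF jn] z[OF jn] in \<open>simp_all add: f m\<close>)
  qed (use W X src cD in \<open>auto simp: lift_body_def\<close>)
  then show ?thesis using that cD(1) by (simp add: lift_prog_def)
qed

subsection \<open>Edges of the contracted graph\<close>

lemma proper_edges_set: "proper_edges n es \<longleftrightarrow> (\<forall>e\<in>set es. fst e < n \<and> snd e < n \<and> fst e \<noteq> snd e)"
  by (auto simp: proper_edges_def all_set_conv_all_nth)

lemma witnesses_empty: "(\<And>x z. x < n \<Longrightarrow> z < n \<Longrightarrow> w x z = 0) \<Longrightarrow> witnesses n (edge_rel {}) rep w"
  by (auto simp: witnesses_def ladj_def edge_rel_def)

lemma ladj_insert:
  assumes "a < n" "b < n"
  shows "ladj n (edge_rel (insert (a, b) D)) rep x z \<longleftrightarrow> ladj n (edge_rel D) rep x z \<or>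
    (x \<noteq> z \<and> (x = rep a \<and> z = rep b \<or> x = rep b \<and> z = rep a))"
  using assms by (auto simp: ladj_def edge_rel_def)

text \<open>The two entries for a pair of classes are overwritten together, so they always belong to
  the same edge, even if several edges join the two classes.\<close>

lemma witnesses_insert:
  assumes w: "witnesses n (edge_rel D) rep w" and ab: "a < n" "b < n" "rep a < n" "rep b < n"
    and w': "\<And>x z. x < n \<Longrightarrow> z < n \<Longrightarrow> w' x z = (if rep a \<noteq> rep b \<and> x = rep a \<and> z = rep b then Suc a
      else if rep a \<noteq> rep b \<and> x = rep b \<and> z = rep a then Suc b else w x z)"
  shows "witnesses n (edge_rel (insert (a, b) D)) rep w'"
  unfolding witnesses_def
proof (intro allI impI conjI)
  fix x z assume x: "x < n" and z: "z < n"
  let ?new = "rep a \<noteq> rep b \<and> (x = rep a \<and> z = rep b \<or> x = rep b \<and> z = rep a)"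
  have wxz: "w x z \<noteq> 0 \<Longrightarrow> ladj n (edge_rel D) rep x z" using w x z unfolding witnesses_def by blast
  show "w' x z \<noteq> 0 \<Longrightarrow> ladj n (edge_rel (insert (a, b) D)) rep x z"
    using w'[OF x z] wxz unfolding ladj_insert[OF ab(1,2)] by (auto split: if_splits)
  assume l: "ladj n (edge_rel (insert (a, b) D)) rep x z"
  show "\<exists>a'<n. \<exists>b'<n. edge_rel (insert (a, b) D) a' b' \<and> rep a' = x \<and> rep b' = z \<and> w' x z = Suc a' \<and> w' z x = Suc b'"
  proof (cases ?new)
    case True
    then show ?thesis using ab w'[OF x z] w'[OF z x] by (auto simp: edge_rel_def)
  next
    case False
    then have "ladj n (edge_rel D) rep x z" using l unfolding ladj_insert[OF ab(1,2)] by auto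
    then obtain a' b' where "a' < n" "b' < n" "edge_rel D a' b'" "rep a' = x" "rep b' = z" "w x z = Suc a'" "w z x = Suc b'"
      using w x z unfolding witnesses_def by blast
    moreover have "w' x z = w x z" "w' z x = w z x" using False w'[OF x z] w'[OF z x] by auto
    ultimately show ?thesis by (auto simp: edge_rel_def)
  qed
qed

definition witness_body :: "vname \<Rightarrow> com" where
  "witness_body x = Seq (Set ''a'' (Get ''R'' (Get (x @ ''_fst'') (V ''i''))))
    (Seq (Set ''b'' (Get ''R'' (Get (x @ ''_snd'') (V ''i''))))
    (If (Eq (V ''a'') (V ''b'')) Skip
      (Seq (Put ''w'' (Plus (Get ''r'' (V ''a'')) (V ''b'')) (Plus (Get (x @ ''_fst'') (V ''i'')) (N 1)))
           (Put ''w'' (Plus (Get ''r'' (V ''b'')) (V ''a'')) (Plus (Get (x @ ''_snd'') (V ''i'')) (N 1))))))"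

lemma mods_witness_body [simp]: "mods (witness_body x) = {''a'', ''b'', ''w''}"
  by (auto simp: witness_body_def)

lemma witness_loop:
  assumes W: "100 \<le> W" "s (x @ ''_len'') 0 \<le> W" and x: "x = ''edges'' \<or> x = ''msg''"
    and c: "bctx n es s" and es: "proper_edges n (load_edges x s)"
    and rep: "\<And>b. b < n \<Longrightarrow> s ''R'' b < n"
    and w: "witnesses n (edge_rel D) (s ''R'') (mt n s ''w'')"
  obtains s' where "runs (For ''i'' (x @ ''_len'') (witness_body x)) s (W ^ 6) s'"
    "witnesses n (edge_rel (D \<union> set (load_edges x s))) (s ''R'') (mt n s' ''w'')"
    "frame {''i'', ''a'', ''b'', ''w''} s s'"
proof -
  let ?c = "witness_body x" and ?l = "x @ ''_len''"
  let ?J = "\<lambda>j t. witnesses n (edge_rel (D \<union> set (take j (load_edges x s)))) (s ''R'') (mt n t ''w'')"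
  note cD = bctxD[OF c]
  obtain s' where s': "runs (For ''i'' ?l ?c) s (W ^ 6) s'" "?J (s ?l 0) s'" "frame (insert ''i'' (mods ?c)) s s'"
  proof (rule runs_For[of W s ?l "''i''" ?c 1 6 ?J])
    show "?J 0 (s(''i'' := (s ''i'')(0 := 0)))" using w by (simp add: mt_def[abs_def])
  next
    fix j t assume t: "j < s ?l 0" "t ''i'' 0 = j" "frame (insert ''i'' (mods ?c)) s t" "?J j t"
    obtain a b where ab: "load_edges x s ! j = (a, b)" by force
    then have ab': "s (x @ ''_fst'') j = a" "s (x @ ''_snd'') j = b" using load_edges_nth[where x = x and s = s and i = j, OF t(1)] by auto
    have abn: "a < n" "b < n" using es t(1) ab by (auto simp: proper_edges_def)
    have f: "t ''r'' = s ''r''" "t ''R'' = s ''R''" "t (x @ ''_fst'') = s (x @ ''_fst'')"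
      "t (x @ ''_snd'') = s (x @ ''_snd'')"
      using x by (auto intro!: frameD[OF t(3)])
    let ?t' = "(run ?c t)(''i'' := (run ?c t ''i'')(0 := Suc j))"
    let ?ra = "s ''R'' a" and ?rb = "s ''R'' b"
    have r: "s ''r'' ?ra = ?ra * n" "s ''r'' ?rb = ?rb * n" using cD(3) rep abn by (simp_all add: less_imp_le)
    have w': "?t' ''w'' = (if ?ra = ?rb then t ''w'' else (t ''w'')(?ra * n + ?rb := Suc a, ?rb * n + ?ra := Suc b))"
      using x t(2) ab' r by (auto simp: witness_body_def f)
    have "set (take (Suc j) (load_edges x s)) = insert (a, b) (set (take j (load_edges x s)))"
      using t(1) ab by (simp add: take_Suc_conv_app_nth)
    moreover have "witnesses n (edge_rel (insert (a, b) (D \<union> set (take j (load_edges x s))))) (s ''R'') (mt n ?t' ''w'')"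
    proof (rule witnesses_insert[OF t(4) abn rep[OF abn(1)] rep[OF abn(2)]])
      fix y z assume yz: "y < n" "z < n"
      show "mt n ?t' ''w'' y z = (if ?ra \<noteq> ?rb \<and> y = ?ra \<and> z = ?rb then Suc a
          else if ?ra \<noteq> ?rb \<and> y = ?rb \<and> z = ?ra then Suc b else mt n t ''w'' y z)"
        unfolding mt_def w' using entry_index[of z n ?rb y ?ra] entry_index[of z n ?ra y ?rb] yz rep abn by auto
    qed
    ultimately have "?J (Suc j) ?t'" by simp
    moreover have "runs ?c t (W ^ 1) (run ?c t)" using W by (intro runs_line) (auto simp: witness_body_def)
    ultimately show "\<exists>t'. runs ?c t (W ^ 1) t' \<and>
      (frame (mods ?c) t t' \<longrightarrow> ?J (Suc j) (t'(''i'' := (t' ''i'')(0 := Suc j))))" by blast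
  qed (use W x in auto)
  then show ?thesis using that[of s'] by auto
qed

definition witness_prog :: com where
  "witness_prog = Seq (Fill ''i'' ''h'' (Set ''t'' (N 0)) ''w'' (N 0) ''t'')
    (Seq (For ''i'' ''edges_len'' (witness_body ''edges'')) (For ''i'' ''msg_len'' (witness_body ''msg'')))"

lemma witness_runs:
  assumes W: "100 \<le> W" "n * n \<le> W" "length es \<le> W" and c: "bctx n es s" and es: "proper_edges n es"
    and rep: "\<And>b. b < n \<Longrightarrow> s ''R'' b < n"
  obtains s' where "runs witness_prog s (W ^ 8) s'"
    "witnesses n (edge_rel (set es)) (s ''R'') (mt n s' ''w'')"
    "frame {''i'', ''a'', ''b'', ''w'', ''t''} s s'"
proof -
  note cD = bctxD[OF c]
  let ?B = "Set ''t'' (N 0)"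
  obtain s1 where s1: "runs (Fill ''i'' ''h'' ?B ''w'' (N 0) ''t'') s (W ^ 6) s1"
    "s1 ''w'' = (\<lambda>k. if 0 \<le> k \<and> k < 0 + s ''h'' 0 then 0 else s ''w'' k)"
    "frame (insert ''i'' (insert ''w'' (mods ?B))) s s1"
    by (rule runs_Fill[where W = W and s = s and i = "''i''" and l = "''h''" and B = ?B and X = "''w''" and off = "N 0"
      and t = "''t''" and p = 0 and val = "\<lambda>_. 0"]) (use W cD in auto)
  have c1: "bctx n es s1" by (rule bctx_frame[OF c s1(3)]) (auto simp: ctx_vars_def)
  have w1: "witnesses n (edge_rel {}) (s1 ''R'') (mt n s1 ''w'')"
  proof (rule witnesses_empty)
    fix x z assume "x < n" "z < n"
    then have "x * n + z < n * n" using row_index[of z n x x]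
      by (metis add_le_cancel_left less_le_trans mult_Suc Suc_leI mult_le_mono1 add.commute)
    then show "mt n s1 ''w'' x z = 0" using s1(2) cD by (simp add: mt_def)
  qed
  have len: "s ''edges_len'' 0 + s ''msg_len'' 0 = length es"
    using cD(4) length_append[of "load_edges ''edges'' s" "load_edges ''msg'' s"] by simp
  have ld: "load_edges ''edges'' s1 = load_edges ''edges'' s" "load_edges ''msg'' s1 = load_edges ''msg'' s"
    "s1 ''edges_len'' = s ''edges_len''" "s1 ''R'' = s ''R''"
    using s1(3) by (auto simp: frame_def load_edges_def)
  have pe: "proper_edges n (load_edges ''edges'' s)" "proper_edges n (load_edges ''msg'' s)"
    using es unfolding cD(4)[symmetric] proper_edges_set by auto
  obtain s2 where s2: "runs (For ''i'' ''edges_len'' (witness_body ''edges'')) s1 (W ^ 6) s2"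
    "witnesses n (edge_rel ({} \<union> set (load_edges ''edges'' s1))) (s1 ''R'') (mt n s2 ''w'')"
    "frame {''i'', ''a'', ''b'', ''w''} s1 s2"
    by (rule witness_loop[of W s1 "''edges''" n es "{}"]) (use W c1 w1 len ld pe rep in auto)
  have c2: "bctx n es s2" by (rule bctx_frame[OF c1 s2(3)]) (auto simp: ctx_vars_def)
  have ld2: "load_edges ''msg'' s2 = load_edges ''msg'' s" "s2 ''msg_len'' = s ''msg_len''" "s2 ''R'' = s ''R''"
    using s1(3) s2(3) by (auto simp: frame_def load_edges_def)
  obtain s3 where s3: "runs (For ''i'' ''msg_len'' (witness_body ''msg'')) s2 (W ^ 6) s3"
    "witnesses n (edge_rel (set (load_edges ''edges'' s) \<union> set (load_edges ''msg'' s2))) (s2 ''R'') (mt n s3 ''w'')"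
    "frame {''i'', ''a'', ''b'', ''w''} s2 s3"
    by (rule witness_loop[of W s2 "''msg''" n es "set (load_edges ''edges'' s)"])
      (use W c2 s2(2) len ld ld2 pe rep in auto)
  have eq: "set (load_edges ''edges'' s) \<union> set (load_edges ''msg'' s2) = set es"
    using ld2 cD(4) by (metis set_append)
  have "runs (Seq (For ''i'' ''edges_len'' (witness_body ''edges'')) (For ''i'' ''msg_len'' (witness_body ''msg''))) s1 (W ^ 7) s3"
    by (rule runs_Seq[OF s2(1) s3(1) W(1)]) auto
  from runs_Seq[OF s1(1) this W(1)] have "runs witness_prog s (W ^ 8) s3" by (simp add: witness_prog_def)
  moreover have "witnesses n (edge_rel (set es)) (s ''R'') (mt n s3 ''w'')" using s3(2) eq ld2 by simp
  moreover have "frame {''i'', ''a'', ''b'', ''w'', ''t''} s s3"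
    using s1(3) s2(3) s3(3) by (auto simp: frame_def)
  ultimately show ?thesis using that by blast
qed

subsection \<open>Growing the forest\<close>

definition init_prog :: com where
  "init_prog = For ''v'' ''n'' (Seq
    (If (And (Eq (Get ''R'' (V ''v'')) (V ''v'')) (Eq (Get ''M'' (V ''v'')) (N 0)))
      (Seq (Put ''l'' (V ''v'') (N 1)) (Put ''o'' (V ''v'') (V ''v''))) (Put ''l'' (V ''v'') (N 0)))
    (Fill ''i'' ''n'' (Set ''t'' (Get ''M'' (V ''i''))) ''T'' (Get ''r'' (V ''v'')) ''t''))"

lemma init_runs:
  assumes W: "100 \<le> W" "n \<le> W" and c: "bctx n es s"
  obtains s' where "runs init_prog s (W ^ 12) s'"
    "\<And>v. v < n \<Longrightarrow> s' ''l'' v = (if s ''R'' v = v \<and> s ''M'' v = 0 then 1 else 0)"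
    "\<And>v. v < n \<Longrightarrow> s ''R'' v = v \<Longrightarrow> s ''M'' v = 0 \<Longrightarrow> s' ''o'' v = v"
    "\<And>v b. v < n \<Longrightarrow> b < n \<Longrightarrow> mt n s' ''T'' v b = s ''M'' b"
    "frame {''v'', ''i'', ''t'', ''l'', ''o'', ''T''} s s'"
proof -
  note cD = bctxD[OF c]
  let ?c1 = "If (And (Eq (Get ''R'' (V ''v'')) (V ''v'')) (Eq (Get ''M'' (V ''v'')) (N 0)))
      (Seq (Put ''l'' (V ''v'') (N 1)) (Put ''o'' (V ''v'') (V ''v''))) (Put ''l'' (V ''v'') (N 0))"
  let ?B = "Set ''t'' (Get ''M'' (V ''i''))"
  let ?c2 = "Fill ''i'' ''n'' ?B ''T'' (Get ''r'' (V ''v'')) ''t''"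
  let ?c = "Seq ?c1 ?c2"
  let ?P = "\<lambda>v. s ''R'' v = v \<and> s ''M'' v = 0"
  let ?J = "\<lambda>j t. \<forall>v<j. t ''l'' v = (if ?P v then 1 else 0) \<and> (?P v \<longrightarrow> t ''o'' v = v) \<and> (\<forall>b<n. mt n t ''T'' v b = s ''M'' b)"
  obtain s' where s': "runs (For ''v'' ''n'' ?c) s (W ^ 12) s'" "?J (s ''n'' 0) s'" "frame (insert ''v'' (mods ?c)) s s'"
  proof (rule runs_For[of W s "''n''" "''v''" ?c 7 12 ?J])
    fix j t assume t: "j < s ''n'' 0" "t ''v'' 0 = j" "frame (insert ''v'' (mods ?c)) s t" "?J j t"
    have f: "t ''r'' = s ''r''" "t ''R'' = s ''R''" "t ''M'' = s ''M''" "t ''n'' = s ''n''" using t(3) by (auto simp: frame_def)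
    define t1 where "t1 = run ?c1 t"
    have t1: "t1 ''l'' = (t ''l'')(j := if ?P j then 1 else 0)" "t1 ''o'' = (if ?P j then (t ''o'')(j := j) else t ''o'')"
      "t1 ''T'' = t ''T''" "t1 ''v'' = t ''v''" "t1 ''r'' = t ''r''" "t1 ''M'' = t ''M''" "t1 ''n'' = t ''n''"
      using t(2) f by (auto simp: t1_def)
    have "t1 ''n'' 0 \<le> W" using t1 f cD W by simp
    then obtain t2 where t2: "runs ?c2 t1 (W ^ 6) t2"
      "t2 ''T'' = (\<lambda>k. if j * n \<le> k \<and> k < j * n + t1 ''n'' 0 then s ''M'' (k - j * n) else t1 ''T'' k)"
      "frame (insert ''i'' (insert ''T'' (mods ?B))) t1 t2"
    proof (rule runs_Fill[where W = W and s = t1 and i = "''i''" and l = "''n''" and B = ?B and X = "''T''"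
        and off = "Get ''r'' (V ''v'')" and t = "''t''" and p = "j * n" and val = "s ''M''", rotated])
      fix u assume "frame (insert ''i'' (insert ''T'' (mods ?B))) t1 u"
      then have "u ''r'' = t ''r''" "u ''v'' = t ''v''" using t1 by (simp_all add: frame_def)
      then show "aval (Get ''r'' (V ''v'')) u = j * n" using t(1,2) f cD by simp
    next
      fix i u assume "i < t1 ''n'' 0" "u ''i'' 0 = i" "frame (insert ''i'' (insert ''T'' (mods ?B))) t1 u"
      then show "run ?B u ''t'' 0 = s ''M'' i" using t1 f by (simp add: frame_def)
    qed (use W in auto)
    have T2: "mt n t2 ''T'' v b = (if v = j then s ''M'' b else mt n t ''T'' v b)" if "b < n" for v b
    proof -
      have "mt n t2 ''T'' v b = (if v = j then s ''M'' b else mt n t1 ''T'' v b)"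
        by (rule mt_fill[OF _ that]) (use t2(2) t1 f cD in simp)
      then show ?thesis using t1 by (simp add: mt_def)
    qed
    have "runs ?c1 t (W ^ 1) t1" unfolding t1_def using W by (intro runs_line) auto
    from runs_Seq[OF this t2(1) W(1)] have "runs ?c t (W ^ 7) t2" by simp
    moreover have "?J (Suc j) (t2(''v'' := (t2 ''v'')(0 := Suc j)))"
    proof (intro allI impI)
      fix v assume v: "v < Suc j"
      let ?t' = "t2(''v'' := (t2 ''v'')(0 := Suc j))"
      have l: "t2 ''l'' = t1 ''l''" "t2 ''o'' = t1 ''o''" using t2(3) by (simp_all add: frame_def)
      have "mt n ?t' ''T'' = mt n t2 ''T''" by (rule mt_cong) simp
      then have "\<forall>b<n. mt n ?t' ''T'' v b = s ''M'' b" using T2 t(4) v by (auto simp: less_Suc_eq)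
      moreover have "?t' ''l'' v = (if ?P v then 1 else 0)" "?P v \<longrightarrow> ?t' ''o'' v = v"
        using t(4) v by (auto simp: less_Suc_eq l t1)
      ultimately show "?t' ''l'' v = (if ?P v then 1 else 0) \<and> (?P v \<longrightarrow> ?t' ''o'' v = v) \<and>
        (\<forall>b<n. mt n ?t' ''T'' v b = s ''M'' b)" by blast
    qed
    ultimately show "\<exists>t'. runs ?c t (W ^ 7) t' \<and>
      (frame (mods ?c) t t' \<longrightarrow> ?J (Suc j) (t'(''v'' := (t' ''v'')(0 := Suc j))))" by blast
  qed (use W cD in auto)
  have "frame {''v'', ''i'', ''t'', ''l'', ''o'', ''T''} s s'" using s'(3) by (auto simp: frame_def)
  then show ?thesis using that[of s'] s'(1,2) cD(1) by (auto simp: init_prog_def)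
qed

text \<open>The scan position is reset at the end, because the new outer vertex \<open>y\<close> may
  come before it in the order of the scan.\<close>

definition grow_prog :: com where
  "grow_prog = Seq (Set ''y'' (Minus (G2 ''T'' (V ''u'') (V ''x'')) (N 1)))
    (Seq (Put ''l'' (V ''x'') (N 2)) (Seq (Put ''l'' (V ''y'') (N 1))
    (Seq (Put ''o'' (V ''x'') (Get ''o'' (V ''u''))) (Seq (Put ''o'' (V ''y'') (Get ''o'' (V ''u'')))
    (Seq (Fill ''i'' ''n'' (Set ''t'' (G2 ''T'' (V ''u'') (V ''i''))) ''T'' (Get ''r'' (V ''y'')) ''t'')
    (Seq (Put ''T'' (Plus (Get ''r'' (V ''y'')) (V ''x'')) (Plus (V ''u'') (N 1)))
    (Seq (Put ''T'' (Plus (Get ''r'' (V ''y'')) (V ''u'')) (Plus (V ''x'') (N 1)))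
    (Seq (Put ''T'' (Plus (Get ''r'' (V ''y'')) (V ''y'')) (N 0))
    (Seq (Set ''u'' (N 0)) (Set ''x'' (N 0)))))))))))"

lemma mods_grow: "mods grow_prog = {''y'', ''l'', ''o'', ''i'', ''T'', ''t'', ''u'', ''x''}"
  by (auto simp: grow_prog_def)

lemma grow_runs:
  assumes W: "100 \<le> W" "n \<le> W" and c: "bctx n es s"
    and ux: "s ''u'' 0 = u" "s ''x'' 0 = x" "u < n" "x < n" and T: "mt n s ''T'' u x = Suc y" and y: "y < n"
    and ne: "y \<noteq> u" "x \<noteq> u" "x \<noteq> y"
  obtains s' where "runs grow_prog s (W ^ 17) s'"
    "s' ''l'' = (s ''l'')(x := 2, y := 1)" "s' ''o'' = (s ''o'')(x := s ''o'' u, y := s ''o'' u)"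
    "\<And>v b. v < n \<Longrightarrow> b < n \<Longrightarrow> mt n s' ''T'' v b =
      ((mt n s ''T'')(y := (mt n s ''T'' u)(x := Suc u, u := Suc x, y := 0))) v b"
    "s' ''u'' 0 = 0" "s' ''x'' 0 = 0"
    "frame {''y'', ''l'', ''o'', ''i'', ''T'', ''t'', ''u'', ''x''} s s'"
proof -
  note cD = bctxD[OF c]
  let ?B = "Set ''t'' (G2 ''T'' (V ''u'') (V ''i''))"
  let ?c1 = "Seq (Set ''y'' (Minus (G2 ''T'' (V ''u'') (V ''x'')) (N 1)))
    (Seq (Put ''l'' (V ''x'') (N 2)) (Seq (Put ''l'' (V ''y'') (N 1))
    (Seq (Put ''o'' (V ''x'') (Get ''o'' (V ''u''))) (Put ''o'' (V ''y'') (Get ''o'' (V ''u''))))))"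
  let ?c2 = "Fill ''i'' ''n'' ?B ''T'' (Get ''r'' (V ''y'')) ''t''"
  let ?c3 = "Seq (Put ''T'' (Plus (Get ''r'' (V ''y'')) (V ''x'')) (Plus (V ''u'') (N 1)))
    (Seq (Put ''T'' (Plus (Get ''r'' (V ''y'')) (V ''u'')) (Plus (V ''x'') (N 1)))
    (Seq (Put ''T'' (Plus (Get ''r'' (V ''y'')) (V ''y'')) (N 0))
    (Seq (Set ''u'' (N 0)) (Set ''x'' (N 0)))))"
  have ru: "s ''r'' u = u * n" "s ''r'' y = y * n" using cD ux y by simp_all
  have T': "s ''T'' (u * n + x) = Suc y" using T by (simp add: mt_def)
  define t1 where "t1 = run ?c1 s"
  have t1: "t1 ''y'' 0 = y" "t1 ''l'' = (s ''l'')(x := 2, y := 1)"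
    "t1 ''o'' = (s ''o'')(x := s ''o'' u, y := s ''o'' u)"
    "t1 ''T'' = s ''T''" "t1 ''u'' = s ''u''" "t1 ''x'' = s ''x''" "t1 ''r'' = s ''r''" "t1 ''n'' = s ''n''"
    using ux ru T' ne by (auto simp: t1_def fun_eq_iff)
  have "t1 ''n'' 0 \<le> W" using t1 cD W by simp
  then obtain t2 where t2: "runs ?c2 t1 (W ^ 6) t2"
    "t2 ''T'' = (\<lambda>k. if y * n \<le> k \<and> k < y * n + t1 ''n'' 0 then mt n s ''T'' u (k - y * n) else t1 ''T'' k)"
    "frame (insert ''i'' (insert ''T'' (mods ?B))) t1 t2"
  proof (rule runs_Fill[where W = W and s = t1 and i = "''i''" and l = "''n''" and B = ?B and X = "''T''"
      and off = "Get ''r'' (V ''y'')" and t = "''t''" and p = "y * n" and val = "mt n s ''T'' u", rotated])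
    fix v assume "frame (insert ''i'' (insert ''T'' (mods ?B))) t1 v"
    then have "v ''r'' = s ''r''" "v ''y'' 0 = y" using t1 by (simp_all add: frame_def)
    then show "aval (Get ''r'' (V ''y'')) v = y * n" using ru by simp
  next
    fix i v assume i: "i < t1 ''n'' 0" "v ''i'' 0 = i" and fr: "frame (insert ''i'' (insert ''T'' (mods ?B))) t1 v"
      and eq: "\<forall>k. k < y * n \<or> y * n + i \<le> k \<longrightarrow> v ''T'' k = t1 ''T'' k"
    have f: "v ''r'' = s ''r''" "v ''u'' 0 = u" using fr t1 ux by (simp_all add: frame_def)
    have "i < n" using i t1 cD by simp
    \<comment> \<open>Row \<open>u\<close> is read while row \<open>y\<close> of the same array is
      written; the two rows are disjoint.\<close>
    then have "\<not> (y * n \<le> u * n + i \<and> u * n + i < y * n + n)" using row_index[of i n y u] ne by auto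
    then have "u * n + i < y * n \<or> y * n + n \<le> u * n + i" unfolding de_Morgan_conj not_le not_less .
    then have "u * n + i < y * n \<or> y * n + i \<le> u * n + i" using \<open>i < n\<close> by linarith
    then have "v ''T'' (u * n + i) = s ''T'' (u * n + i)" unfolding t1(4)[symmetric] using eq by blast
    then show "run ?B v ''t'' 0 = mt n s ''T'' u i" using f ru i by (simp add: mt_def)
  qed (use W in auto)
  have f2: "t2 ''y'' = t1 ''y''" "t2 ''l'' = t1 ''l''" "t2 ''o'' = t1 ''o''" "t2 ''u'' = s ''u''" "t2 ''x'' = s ''x''"
    "t2 ''r'' = s ''r''"
    using t2(3) t1 by (simp_all add: frame_def)
  define s' where "s' = run ?c3 t2"
  have T3: "s' ''T'' = (t2 ''T'')(y * n + x := Suc u, y * n + u := Suc x, y * n + y := 0)"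
    using f2 t1(1) ux ru by (simp add: s'_def)
  have mt3: "mt n s' ''T'' v b = ((mt n s ''T'')(y := (mt n s ''T'' u)(x := Suc u, u := Suc x, y := 0))) v b"
    if "v < n" "b < n" for v b
  proof -
    have "mt n t2 ''T'' v b = (if v = y then mt n s ''T'' u b else mt n t1 ''T'' v b)"
      by (rule mt_fill[OF _ that(2)]) (use t2(2) t1 cD in simp)
    then have "mt n t2 ''T'' v b = (if v = y then mt n s ''T'' u b else mt n s ''T'' v b)"
      using t1 by (simp add: mt_def)
    then show ?thesis unfolding mt_def T3
      using entry_index[OF that(2) ux(4), of v y] entry_index[OF that(2) ux(3), of v y] entry_index[OF that(2) y, of v y]
      by (auto simp: mt_def)
  qed
  have r: "runs ?c3 t2 (W ^ 1) s'" unfolding s'_def using W by (intro runs_line) auto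
  have q7: "runs (Seq ?c2 ?c3) t1 (W ^ 7) s'" by (rule runs_Seq[OF t2(1) r W(1)]) auto
  have "runs grow_prog s (W ^ 17) s'"
  proof -
    let ?b1 = "Set ''y'' (Minus (G2 ''T'' (V ''u'') (V ''x'')) (N 1))" and ?b2 = "Put ''l'' (V ''x'') (N 2)"
    let ?b3 = "Put ''l'' (V ''y'') (N 1)" and ?b4 = "Put ''o'' (V ''x'') (Get ''o'' (V ''u''))"
    let ?b5 = "Put ''o'' (V ''y'') (Get ''o'' (V ''u''))"
    let ?a1 = "run ?b1 s" let ?a2 = "run ?b2 ?a1" let ?a3 = "run ?b3 ?a2" let ?a4 = "run ?b4 ?a3"
    have e: "run ?b5 ?a4 = t1" by (simp add: t1_def)
    have rb: "runs ?b1 s (W ^ 1) ?a1" "runs ?b2 ?a1 (W ^ 1) ?a2" "runs ?b3 ?a2 (W ^ 1) ?a3" "runs ?b4 ?a3 (W ^ 1) ?a4"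
      "runs ?b5 ?a4 (W ^ 1) t1"
      unfolding e[symmetric] using W by (intro runs_line; simp)+
    have "runs (Seq ?b5 (Seq ?c2 ?c3)) ?a4 (W ^ 8) s'" by (rule runs_Seq[OF rb(5) q7 W(1)]) auto
    from runs_Seq[OF rb(4) this W(1), of 9] have "runs (Seq ?b4 (Seq ?b5 (Seq ?c2 ?c3))) ?a3 (W ^ 9) s'" by simp
    from runs_Seq[OF rb(3) this W(1), of 10] have "runs (Seq ?b3 (Seq ?b4 (Seq ?b5 (Seq ?c2 ?c3)))) ?a2 (W ^ 10) s'" by simp
    from runs_Seq[OF rb(2) this W(1), of 11]
    have "runs (Seq ?b2 (Seq ?b3 (Seq ?b4 (Seq ?b5 (Seq ?c2 ?c3))))) ?a1 (W ^ 11) s'" by simp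
    from runs_Seq[OF rb(1) this W(1), of 17] show ?thesis by (simp only: grow_prog_def)
  qed
  moreover have "s' ''l'' = (s ''l'')(x := 2, y := 1)" "s' ''o'' = (s ''o'')(x := s ''o'' u, y := s ''o'' u)"
    "s' ''u'' 0 = 0" "s' ''x'' 0 = 0" using f2 t1 by (simp_all add: s'_def)
  moreover have "frame {''y'', ''l'', ''o'', ''i'', ''T'', ''t'', ''u'', ''x''} s s'"
    using runs_frame[OF calculation(1)] by (simp add: mods_grow)
  ultimately show ?thesis using that mt3 by blast
qed

lemma runs_If_True:
  "bval b s \<Longrightarrow> runs c s (W ^ k) s' \<Longrightarrow> 100 \<le> W \<Longrightarrow> k < m \<Longrightarrow> runs (If b c d) s (W ^ m) s'"
  using runs_If by blast

lemma runs_If_False: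
  "\<not> bval b s \<Longrightarrow> runs d s (W ^ k) s' \<Longrightarrow> 100 \<le> W \<Longrightarrow> k < m \<Longrightarrow> runs (If b c d) s (W ^ m) s'"
  using runs_If by blast

lemma mate_on_cong:
  assumes c: "\<And>x. x \<in> L \<Longrightarrow> m' x = m x" and m: "mate_on L a m"
  shows "mate_on L a m'"
  unfolding mate_on_def
proof (intro ballI allI impI)
  fix x y assume x: "x \<in> L" and xy: "m' x = Suc y"
  have "m x = Suc y" using c[OF x] xy by simp
  note y = mate_onD[OF m x this]
  show "y \<in> L \<and> y \<noteq> x \<and> a x y \<and> m' y = Suc x" unfolding c[OF y(1)] using y by blast
qed

lemma forest_cong:
  assumes F: "forest L la M lab rt T" and T: "\<And>w v. w \<in> L \<Longrightarrow> v \<in> L \<Longrightarrow> T' w v = T w v"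
  shows "forest L la M lab rt T'"
proof -
  have "mate_on L la (T' w) \<longleftrightarrow> mate_on L la (T w)" if "w \<in> L" for w
    using mate_on_cong[of L "T' w" "T w" la] mate_on_cong[of L "T w" "T' w" la] T[OF that] by auto
  note me = this and D = forestD[OF F]
  have "mate_on L la (T' w) \<and> T' w w = 0
      \<and> (\<forall>v\<in>L. lab v = 0 \<or> rt v \<noteq> rt w \<longrightarrow> T' w v = M v)
      \<and> (\<forall>v\<in>L. lab v = 1 \<and> rt v = rt w \<and> v \<noteq> w \<longrightarrow> (\<exists>y\<in>L. T' w v = Suc y \<and> lab y = 2 \<and> rt y = rt w))
      \<and> (\<forall>v\<in>L. lab v = 2 \<and> rt v = rt w \<longrightarrow> (\<exists>y\<in>L. T' w v = Suc y \<and> lab y = 1 \<and> rt y = rt w))"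
    if w: "w \<in> L" "lab w = 1" for w
  proof (intro conjI ballI impI)
    show "mate_on L la (T' w)" "T' w w = 0" using D(7)[OF w] me[OF w(1)] T[OF w(1) w(1)] by simp_all
  next
    fix v assume v: "v \<in> L" "lab v = 0 \<or> rt v \<noteq> rt w"
    show "T' w v = M v" unfolding T[OF w(1) v(1)] by (rule D(8)[OF w v])
  next
    fix v assume v: "v \<in> L" and "lab v = 1 \<and> rt v = rt w \<and> v \<noteq> w"
    then show "\<exists>y\<in>L. T' w v = Suc y \<and> lab y = 2 \<and> rt y = rt w"
      unfolding T[OF w(1) v] using D(9)[OF w v] by blast
  next
    fix v assume v: "v \<in> L" and "lab v = 2 \<and> rt v = rt w"
    then show "\<exists>y\<in>L. T' w v = Suc y \<and> lab y = 1 \<and> rt y = rt w"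
      unfolding T[OF w(1) v] using D(10)[OF w v] by blast
  qed
  then show ?thesis unfolding forest_def
    using D(1) D(2) D(3) D(4) D(5) D(6) by (intro conjI ballI) blast+
qed

lemma live_cong: "(\<And>a. a < n \<Longrightarrow> rep' a = rep a) \<Longrightarrow> live n rep' = live n rep"
  by (auto simp: live_def)

lemma rep_ok_cong: "(\<And>a. a < n \<Longrightarrow> rep' a = rep a) \<Longrightarrow> rep_ok n rep \<Longrightarrow> rep_ok n rep'"
  unfolding rep_ok_def using live_cong[of n rep' rep] by simp

lemma ladj_cong:
  assumes "\<And>a. a < n \<Longrightarrow> rep' a = rep a"
  shows "ladj n ad rep' = ladj n ad rep"
  unfolding ladj_def using assms by (intro ext) metis

lemma class_matchings_cong:
  assumes "\<And>a. a < n \<Longrightarrow> rep' a = rep a" "class_matchings n ad rep Q"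
  shows "class_matchings n ad rep' Q"
  unfolding class_matchings_def
proof (intro allI impI)
  fix a b assume "a < n" "b < n" "rep' b = rep' a \<and> b \<noteq> a"
  then obtain c where "c < n" "Q a b = Suc c" "rep c = rep a" "c \<noteq> a" "c \<noteq> b" "ad b c" "Q a c = Suc b"
    using class_matchingsD[OF assms(2), of a b] assms(1) by metis
  then show "\<exists>c<n. Q a b = Suc c \<and> rep' c = rep' a \<and> c \<noteq> a \<and> c \<noteq> b \<and> ad b c \<and> Q a c = Suc b"
    using assms(1) \<open>a < n\<close> by auto
qed

lemma lift_mate_cong:
  assumes "K' (rep b) = K (rep b)"
  shows "lift_mate rep Q w K' cur a b = lift_mate rep Q w K cur a b"
  using assms by (simp add: lift_mate_def exposed_def Let_def)

lemma edge_rel_sym: "edge_rel D a b \<Longrightarrow> edge_rel D b a"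
  by (auto simp: edge_rel_def)

lemma edge_rel_irrefl: "proper_edges n es \<Longrightarrow> \<not> edge_rel (set es) a a"
  by (auto simp: proper_edges_set edge_rel_def)

lemma ladj_sym: "ladj n (edge_rel D) rep x z \<Longrightarrow> ladj n (edge_rel D) rep z x"
  unfolding ladj_def using edge_rel_sym by blast

lemma ladj_live: "rep_ok n rep \<Longrightarrow> ladj n ad rep x z \<Longrightarrow> x \<in> live n rep \<and> z \<in> live n rep"
  by (auto simp: ladj_def rep_ok_def)

definition scan_body :: com where
  "scan_body = If (And (Eq (Get ''l'' (V ''u'')) (N 1)) (And (Less (N 0) (G2 ''w'' (V ''u'') (V ''x''))) (Less (Get ''l'' (V ''x'')) (N 2))))
     (If (Eq (Get ''l'' (V ''x'')) (N 0)) grow_prog (Set ''e'' (N 1)))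
     (Seq (Set ''x'' (Plus (V ''x'') (N 1))) (If (Less (V ''x'') (V ''n'')) Skip
       (Seq (Set ''x'' (N 0)) (Set ''u'' (Plus (V ''u'') (N 1))))))"

definition scan_prog :: com where
  "scan_prog = Seq (Set ''u'' (N 0)) (Seq (Set ''x'' (N 0)) (Seq (Set ''e'' (N 0))
     (While (And (Less (V ''e'') (N 1)) (Less (V ''u'') (V ''n''))) scan_body)))"

definition state_forest :: "nat \<Rightarrow> (nat \<Rightarrow> nat \<Rightarrow> bool) \<Rightarrow> state \<Rightarrow> bool" where
  "state_forest n ad s \<longleftrightarrow>
     forest (live n (s ''R'')) (ladj n ad (s ''R'')) (s ''M'') (s ''l'') (s ''o'') (mt n s ''T'')
     \<and> (\<forall>v<n. v \<notin> live n (s ''R'') \<longrightarrow> s ''l'' v = 0)"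

text \<open>Among the pairs before the current position in lexicographic order, outer vertices have
  only inner neighbours. When all pairs have been passed, this is the hypothesis of
  \<open>forest_stuck\<close>.\<close>

definition scanned :: "nat \<Rightarrow> state \<Rightarrow> bool" where
  "scanned n t \<longleftrightarrow> (\<forall>a<n. \<forall>b<n. (a < t ''u'' 0 \<or> a = t ''u'' 0 \<and> b < t ''x'' 0) \<longrightarrow>
     t ''l'' a = 1 \<longrightarrow> mt n t ''w'' a b \<noteq> 0 \<longrightarrow> t ''l'' b = 2)"

definition event :: "nat \<Rightarrow> state \<Rightarrow> bool" where
  "event n t \<longleftrightarrow> t ''u'' 0 < n \<and> t ''x'' 0 < n \<and> t ''l'' (t ''u'' 0) = 1 \<and> t ''l'' (t ''x'' 0) = 1
     \<and> mt n t ''w'' (t ''u'' 0) (t ''x'' 0) \<noteq> 0"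

lemma mods_scan_body: "mods scan_body = {''y'', ''l'', ''o'', ''i'', ''T'', ''t'', ''u'', ''x'', ''e''}"
  by (auto simp: scan_body_def mods_grow)

text \<open>The final alternative mirrors the summands of the measure in \<open>scan_runs\<close>:
  fewer unlabelled vertices, or a later position, or a raised flag.\<close>

lemma scan_step:
  assumes W: "100 \<le> W" "n \<le> W" and c: "bctx n es s" and rep: "rep_ok n (s ''R'')"
    and w: "witnesses n (edge_rel (set es)) (s ''R'') (mt n s ''w'')"
    and F: "state_forest n (edge_rel (set es)) s"
    and ux: "s ''u'' 0 < n" "s ''x'' 0 < n" and e: "s ''e'' 0 = 0" and sc: "scanned n s"
  obtains s' where "runs scan_body s (W ^ 19) s'" "state_forest n (edge_rel (set es)) s'"
    "s' ''u'' 0 \<le> n" "s' ''u'' 0 < n \<Longrightarrow> s' ''x'' 0 < n" "scanned n s'"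
    "s' ''e'' 0 = 0 \<or> s' ''e'' 0 = 1 \<and> event n s'"
    "card {v \<in> live n (s ''R''). s' ''l'' v = 0} < card {v \<in> live n (s ''R''). s ''l'' v = 0} \<or>
     s' ''l'' = s ''l'' \<and> (s' ''u'' 0 * n + s' ''x'' 0 = Suc (s ''u'' 0 * n + s ''x'' 0) \<and> s' ''e'' 0 = 0 \<or>
       s' ''u'' 0 * n + s' ''x'' 0 = s ''u'' 0 * n + s ''x'' 0 \<and> s' ''e'' 0 = 1)"
proof -
  note cD = bctxD[OF c]
  let ?ad = "edge_rel (set es)"
  let ?L = "live n (s ''R'')" and ?la = "ladj n ?ad (s ''R'')"
  define u x where "u = s ''u'' 0" and "x = s ''x'' 0"
  note uxd = u_def[symmetric] x_def[symmetric]
  have uxn: "u < n" "x < n" using ux by (simp_all add: uxd)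
  have ru: "s ''r'' u = u * n" using cD uxn by simp
  have FF: "forest ?L ?la (s ''M'') (s ''l'') (s ''o'') (mt n s ''T'')"
    and F0: "\<And>v. v < n \<Longrightarrow> v \<notin> ?L \<Longrightarrow> s ''l'' v = 0" using F by (auto simp: state_forest_def)
  let ?b = "And (Eq (Get ''l'' (V ''u'')) (N 1)) (And (Less (N 0) (G2 ''w'' (V ''u'') (V ''x''))) (Less (Get ''l'' (V ''x'')) (N 2)))"
  let ?c1 = "If (Eq (Get ''l'' (V ''x'')) (N 0)) grow_prog (Set ''e'' (N 1))"
  let ?c2 = "Seq (Set ''x'' (Plus (V ''x'') (N 1))) (If (Less (V ''x'') (V ''n'')) Skip
       (Seq (Set ''x'' (N 0)) (Set ''u'' (Plus (V ''u'') (N 1)))))"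
  have b: "bval ?b s \<longleftrightarrow> s ''l'' u = 1 \<and> mt n s ''w'' u x \<noteq> 0 \<and> s ''l'' x < 2"
    by (simp add: uxd ru mt_def)
  have sb: "scan_body = If ?b ?c1 ?c2" by (simp add: scan_body_def)
  show ?thesis
  proof (cases "bval ?b s")
    case True
    then have lu: "s ''l'' u = 1" and wux: "mt n s ''w'' u x \<noteq> 0" and lx: "s ''l'' x < 2" using b by auto
    have la: "?la u x" using w wux uxn unfolding witnesses_def by blast
    have uL: "u \<in> ?L" "x \<in> ?L" using ladj_live[OF rep la] by auto
    have nux: "u \<noteq> x" using la by (simp add: ladj_def)
    show ?thesis
    proof (cases "s ''l'' x = 0")
      case x0: True
      obtain y where y: "y \<in> ?L" "s ''M'' x = Suc y" "s ''l'' y = 0" "mt n s ''T'' u x = Suc y"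
        "forest ?L ?la (s ''M'') ((s ''l'')(x := 2, y := 1)) ((s ''o'')(x := s ''o'' u, y := s ''o'' u))
          ((mt n s ''T'')(y := (mt n s ''T'' u)(x := Suc u, u := Suc x, y := 0)))"
        using forest_grow[OF FF uL(1) lu uL(2) x0 la ladj_sym[OF la]] by blast
      have ne: "y \<noteq> u" "x \<noteq> u" "x \<noteq> y"
        using y lu nux mate_onD(2)[OF forestD(1)[OF FF] uL(2) y(2)] by auto
      obtain s' where s': "runs grow_prog s (W ^ 17) s'"
        "s' ''l'' = (s ''l'')(x := 2, y := 1)" "s' ''o'' = (s ''o'')(x := s ''o'' u, y := s ''o'' u)"
        "\<And>v b. v < n \<Longrightarrow> b < n \<Longrightarrow> mt n s' ''T'' v b =
          ((mt n s ''T'')(y := (mt n s ''T'' u)(x := Suc u, u := Suc x, y := 0))) v b"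
        "s' ''u'' 0 = 0" "s' ''x'' 0 = 0"
        "frame {''y'', ''l'', ''o'', ''i'', ''T'', ''t'', ''u'', ''x''} s s'"
        using grow_runs[OF W c u_def[symmetric] x_def[symmetric] uxn y(4) live_lt(1)[OF y(1)] ne] by blast
      have f: "s' ''R'' = s ''R''" "s' ''M'' = s ''M''" "s' ''e'' = s ''e''" using s'(7) by (auto simp: frame_def)
      have "runs ?c1 s (W ^ 18) s'" by (rule runs_If_True[OF _ s'(1) W(1)]) (use x0 uxd in auto)
      then have r: "runs scan_body s (W ^ 19) s'" unfolding sb by (rule runs_If_True[OF True _ W(1)]) simp
      have "forest ?L ?la (s ''M'') (s' ''l'') (s' ''o'') (mt n s' ''T'')"
        unfolding s'(2,3) by (rule forest_cong[OF y(5)]) (use s'(4) live_lt(1) in blast)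
      then have sf: "state_forest n ?ad s'"
        using F0 uL y(1) by (auto simp: state_forest_def f s'(2))
      have "{v \<in> ?L. s' ''l'' v = 0} \<subset> {v \<in> ?L. s ''l'' v = 0}"
        using x0 y(3) uL by (auto simp: s'(2) split: if_splits)
      then have "card {v \<in> ?L. s' ''l'' v = 0} < card {v \<in> ?L. s ''l'' v = 0}" by (intro psubset_card_mono) auto
      then show ?thesis using that[of s'] r sf s'(5,6) e f ux by (auto simp: scanned_def)
    next
      case x1: False
      then have lx1: "s ''l'' x = 1" using lx by simp
      define s' where "s' = run (Set ''e'' (N 1)) s"
      have f: "s' ''e'' 0 = 1" "\<And>y. y \<noteq> ''e'' \<Longrightarrow> s' y = s y" by (simp_all add: s'_def)
      have f': "s' ''R'' = s ''R''" "s' ''M'' = s ''M''" "s' ''l'' = s ''l''" "s' ''o'' = s ''o''" "s' ''T'' = s ''T''"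
         "s' ''u'' = s ''u''" "s' ''x'' = s ''x''" "s' ''w'' = s ''w''" using f(2) by auto
      have "runs (Set ''e'' (N 1)) s (W ^ 1) s'" unfolding s'_def using W by (intro runs_line) auto
      from runs_If_False[OF _ this W(1)] have "runs ?c1 s (W ^ 18) s'" using x1 uxd by simp
      then have r: "runs scan_body s (W ^ 19) s'" unfolding sb by (rule runs_If_True[OF True _ W(1)]) simp
      have m: "mt n s' ''T'' = mt n s ''T''" "mt n s' ''w'' = mt n s ''w''" by (rule mt_cong; simp only: f')+
      have "state_forest n ?ad s'" "scanned n s'"
        using F sc by (simp_all add: state_forest_def scanned_def f' m)
      moreover have "event n s'" using uxn lu lx1 wux by (simp add: event_def f' m uxd)
      ultimately show ?thesis using that[of s'] r f(1) f' ux by simp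
    qed
  next
    case False
    define s' where "s' = run ?c2 s"
    have f: "s' ''R'' = s ''R''" "s' ''M'' = s ''M''" "s' ''l'' = s ''l''" "s' ''o'' = s ''o''" "s' ''T'' = s ''T''"
      "s' ''w'' = s ''w''" "s' ''e'' = s ''e''" by (simp_all add: s'_def)
    have m: "mt n s' ''T'' = mt n s ''T''" "mt n s' ''w'' = mt n s ''w''" by (rule mt_cong; simp only: f)+
    have n: "s' ''u'' 0 = (if Suc x < n then u else Suc u)" "s' ''x'' 0 = (if Suc x < n then Suc x else 0)"
      using cD by (auto simp: s'_def uxd)
    have "runs ?c2 s (W ^ 1) s'" unfolding s'_def using W by (intro runs_line) auto
    then have r: "runs scan_body s (W ^ 19) s'" unfolding sb by (rule runs_If_False[OF False _ W(1)]) simp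
    have "scanned n s'"
      unfolding scanned_def
    proof (intro allI impI)
      fix a b assume ab: "a < n" "b < n" "a < s' ''u'' 0 \<or> a = s' ''u'' 0 \<and> b < s' ''x'' 0"
        "s' ''l'' a = 1" "mt n s' ''w'' a b \<noteq> 0"
      have bL: "b \<in> ?L" using w ab ladj_live[OF rep, of ?ad a b] unfolding witnesses_def by (simp add: m)
      show "s' ''l'' b = 2"
      proof (cases "a = u \<and> b = x")
        case True
        then have "\<not> s ''l'' b < 2" using False[unfolded b] ab by (simp add: f m)
        then show ?thesis using forestD(2)[OF FF bL] by (auto simp: f)
      next
        case ne: False
        then have "a < u \<or> a = u \<and> b < x" using ab(1-3) uxn n by (auto split: if_splits)
        then have "a < s ''u'' 0 \<or> a = s ''u'' 0 \<and> b < s ''x'' 0" unfolding u_def x_def .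
        moreover have "s ''l'' a = 1" "mt n s ''w'' a b \<noteq> 0" using ab(4,5) unfolding f m .
        ultimately show ?thesis using sc ab(1,2) unfolding scanned_def f by blast
      qed
    qed
    moreover have "state_forest n ?ad s'" using F by (simp add: state_forest_def f m)
    moreover have "s' ''u'' 0 * n + s' ''x'' 0 = Suc (s ''u'' 0 * n + s ''x'' 0)"
    proof (cases "Suc x < n")
      case False
      then have "n = Suc x" using uxn by simp
      then show ?thesis using n by (simp add: uxd)
    qed (simp add: n uxd)
    ultimately show ?thesis using that[of s'] r n uxn e by (simp add: f)
  qed
qed

lemma scan_runs:
  assumes W: "100 \<le> W" "n * n \<le> W" and c: "bctx n es s" and rep: "rep_ok n (s ''R'')"
    and w: "witnesses n (edge_rel (set es)) (s ''R'') (mt n s ''w'')"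
    and F: "state_forest n (edge_rel (set es)) s"
  obtains s' where "runs scan_prog s (W ^ 30) s'" "state_forest n (edge_rel (set es)) s'"
    "s' ''e'' 0 = 0 \<and> (\<forall>a<n. \<forall>b<n. s' ''l'' a = 1 \<longrightarrow> mt n s' ''w'' a b \<noteq> 0 \<longrightarrow> s' ''l'' b = 2)
      \<or> s' ''e'' 0 = 1 \<and> event n s'"
    "frame {''y'', ''l'', ''o'', ''i'', ''T'', ''t'', ''u'', ''x'', ''e''} s s'"
proof -
  note cD = bctxD[OF c]
  let ?ad = "edge_rel (set es)"
  have nW: "n \<le> W" using W(2) by (cases n) auto
  let ?i1 = "Set ''u'' (N 0)" and ?i2 = "Set ''x'' (N 0)" and ?i3 = "Set ''e'' (N 0)"
  let ?b = "And (Less (V ''e'') (N 1)) (Less (V ''u'') (V ''n''))"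
  define s1 s2 s3 where "s1 = run ?i1 s" and "s2 = run ?i2 s1" and "s3 = run ?i3 s2"
  have f3: "s3 ''u'' 0 = 0" "s3 ''x'' 0 = 0" "s3 ''e'' 0 = 0" "\<And>y. y \<notin> {''u'', ''x'', ''e''} \<Longrightarrow> s3 y = s y"
    by (simp_all add: s1_def s2_def s3_def)
  have fr3: "frame {''u'', ''x'', ''e''} s s3" using f3(4) by (simp add: frame_def)
  have f3': "s3 ''R'' = s ''R''" "s3 ''M'' = s ''M''" "s3 ''l'' = s ''l''" "s3 ''o'' = s ''o''" "s3 ''T'' = s ''T''"
    "s3 ''w'' = s ''w''" using f3(4) by auto
  have m3: "mt n s3 ''T'' = mt n s ''T''" "mt n s3 ''w'' = mt n s ''w''" by (rule mt_cong; simp only: f3')+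
  let ?L = "live n (s ''R'')"
  let ?c = "\<lambda>t. card {v \<in> ?L. t ''l'' v = 0}"
  let ?I = "\<lambda>t. state_forest n ?ad t \<and> t ''u'' 0 \<le> n \<and> (t ''u'' 0 < n \<longrightarrow> t ''x'' 0 < n) \<and> scanned n t
    \<and> (t ''e'' 0 = 0 \<or> t ''e'' 0 = 1 \<and> event n t)"
  \<comment> \<open>Labelling new vertices resets the position, hence the weight: the other two
    summands together never exceed \<open>n * n + 1\<close>.\<close>
  let ?\<mu> = "\<lambda>t. ?c t * (n * n + 2) + (n * n - (t ''u'' 0 * n + t ''x'' 0)) + (1 - t ''e'' 0)"
  obtain s' where s': "runs (While ?b scan_body) s3 (W ^ 26) s'" "?I s'" "\<not> bval ?b s'" "frame (mods scan_body) s3 s'"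
  proof (rule runs_While[of ?I s3 W ?\<mu> 4 19 26 scan_body ?b])
    show "?I s3" using F f3 by (auto simp: state_forest_def scanned_def f3' m3)
    have "?c s3 \<le> n" using card_mono[of "{..<n}" "{v \<in> ?L. s3 ''l'' v = 0}"] by (auto simp: live_def)
    then have "?\<mu> s3 \<le> n * (n * n + 2) + n * n + 1" by (intro add_mono mult_mono) auto
    also have "\<dots> \<le> W * (2 * W) + W + W" using W nW by (intro add_mono mult_mono) auto
    also have "\<dots> \<le> 4 * W ^ 2" using W by (simp add: power2_eq_square)
    also have "\<dots> \<le> W ^ 2 * W ^ 2"
      using mult_le_mono[of 4 W 1 W] W by (intro mult_right_mono) (auto simp: power2_eq_square)
    finally show "?\<mu> s3 \<le> W ^ 4" by (simp add: power_add[symmetric])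
  next
    fix t assume t: "?I t" "frame (mods scan_body) s3 t" "bval ?b t"
    have fr: "frame {''y'', ''l'', ''o'', ''i'', ''T'', ''t'', ''u'', ''x'', ''e''} s t"
      by (rule frame_trans[OF fr3 t(2)]) (auto simp: mods_scan_body)
    have ct: "bctx n es t" by (rule bctx_frame[OF c fr]) (simp add: ctx_vars_def)
    have ft: "t ''R'' = s ''R''" "t ''w'' = s ''w''" using fr by (simp_all add: frame_def)
    have mw: "mt n t ''w'' = mt n s ''w''" by (rule mt_cong; simp only: ft)
    have e0: "t ''e'' 0 = 0" and un: "t ''u'' 0 < n" using t(3) bctxD(1)[OF ct] by simp_all
    obtain t' where t': "runs scan_body t (W ^ 19) t'" "state_forest n ?ad t'" "t' ''u'' 0 \<le> n"
      "t' ''u'' 0 < n \<Longrightarrow> t' ''x'' 0 < n" "scanned n t'" "t' ''e'' 0 = 0 \<or> t' ''e'' 0 = 1 \<and> event n t'"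
      "?c t' < ?c t \<or>
       t' ''l'' = t ''l'' \<and> (t' ''u'' 0 * n + t' ''x'' 0 = Suc (t ''u'' 0 * n + t ''x'' 0) \<and> t' ''e'' 0 = 0 \<or>
         t' ''u'' 0 * n + t' ''x'' 0 = t ''u'' 0 * n + t ''x'' 0 \<and> t' ''e'' 0 = 1)"
      by (rule scan_step[OF W(1) nW ct]) (use t(1) e0 un rep w in \<open>auto simp: ft mw\<close>)
    have "t ''u'' 0 * n + t ''x'' 0 < n * n"
    proof -
      have "t ''u'' 0 * n + t ''x'' 0 < Suc (t ''u'' 0) * n" using t(1) un by simp
      also have "\<dots> \<le> n * n" using un by (intro mult_right_mono) auto
      finally show ?thesis .
    qed
    moreover have "?\<mu> t' < ?\<mu> t" if "?c t' < ?c t"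
    proof -
      have "(?c t' + 1) * (n * n + 2) \<le> ?c t * (n * n + 2)" using that by (intro mult_right_mono) auto
      then show ?thesis by simp
    qed
    ultimately have "?\<mu> t' < ?\<mu> t" using t'(7) e0 by auto
    then show "\<exists>t'. runs scan_body t (W ^ 19) t' \<and> (frame (mods scan_body) t t' \<longrightarrow> ?I t' \<and> ?\<mu> t' < ?\<mu> t)"
      using t' by blast
  qed (use W in auto)
  have rb: "runs ?i1 s (W ^ 1) s1" "runs ?i2 s1 (W ^ 1) s2" "runs ?i3 s2 (W ^ 1) s3"
    unfolding s1_def s2_def s3_def using W by (intro runs_line; simp)+
  from runs_Seq[OF rb(3) s'(1) W(1), of 27] have "runs (Seq ?i3 (While ?b scan_body)) s2 (W ^ 27) s'" by simp
  from runs_Seq[OF rb(2) this W(1), of 28] have "runs (Seq ?i2 (Seq ?i3 (While ?b scan_body))) s1 (W ^ 28) s'" by simp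
  from runs_Seq[OF rb(1) this W(1), of 30] have r: "runs scan_prog s (W ^ 30) s'" by (simp add: scan_prog_def)
  have fr: "frame {''y'', ''l'', ''o'', ''i'', ''T'', ''t'', ''u'', ''x'', ''e''} s s'"
    by (rule frame_trans[OF fr3 s'(4)]) (auto simp: mods_scan_body)
  have "s' ''n'' 0 = n" using fr cD by (simp add: frame_def)
  then have "s' ''e'' 0 = 1 \<and> event n s' \<or> s' ''e'' 0 = 0 \<and> n \<le> s' ''u'' 0" using s'(2,3) by auto
  moreover have "\<forall>a<n. \<forall>b<n. s' ''l'' a = 1 \<longrightarrow> mt n s' ''w'' a b \<noteq> 0 \<longrightarrow> s' ''l'' b = 2" if "n \<le> s' ''u'' 0"
  proof (intro allI impI)
    fix a b assume a: "a < n" "b < n" "s' ''l'' a = 1" "mt n s' ''w'' a b \<noteq> 0"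
    have "scanned n s'" using s'(2) by blast
    moreover have "a < s' ''u'' 0" using a(1) that by simp
    ultimately show "s' ''l'' b = 2" using a unfolding scanned_def by blast
  qed
  ultimately have "s' ''e'' 0 = 0 \<and> (\<forall>a<n. \<forall>b<n. s' ''l'' a = 1 \<longrightarrow> mt n s' ''w'' a b \<noteq> 0 \<longrightarrow> s' ''l'' b = 2)
      \<or> s' ''e'' 0 = 1 \<and> event n s'" by blast
  then show ?thesis using that[OF r _ _ fr] s'(2) by blast
qed

subsection \<open>Augmenting\<close>

text \<open>The situation when the scan has found an edge between two outer vertices, from which Bob
  either augments or contracts.\<close>

definition level_ok :: "nat \<Rightarrow> (nat \<times> nat) list \<Rightarrow> state \<Rightarrow> bool" where
  "level_ok n es s \<longleftrightarrow> bctx n es s \<and> proper_edges n es \<and> rep_ok n (s ''R'')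
     \<and> witnesses n (edge_rel (set es)) (s ''R'') (mt n s ''w'')
     \<and> class_matchings n (edge_rel (set es)) (s ''R'') (mt n s ''Q'')
     \<and> state_forest n (edge_rel (set es)) s \<and> event n s"

lemma level_okD:
  assumes "level_ok n es s"
  shows "bctx n es s" "rep_ok n (s ''R'')"
    "witnesses n (edge_rel (set es)) (s ''R'') (mt n s ''w'')"
    "class_matchings n (edge_rel (set es)) (s ''R'') (mt n s ''Q'')"
    "forest (live n (s ''R'')) (ladj n (edge_rel (set es)) (s ''R'')) (s ''M'') (s ''l'') (s ''o'') (mt n s ''T'')"
    "s ''u'' 0 \<in> live n (s ''R'')" "s ''x'' 0 \<in> live n (s ''R'')"
    "s ''l'' (s ''u'' 0) = 1" "s ''l'' (s ''x'' 0) = 1"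
    "ladj n (edge_rel (set es)) (s ''R'') (s ''u'' 0) (s ''x'' 0)"
    "ladj n (edge_rel (set es)) (s ''R'') (s ''x'' 0) (s ''u'' 0)"
    "\<And>a. \<not> edge_rel (set es) a a"
proof -
  show w: "witnesses n (edge_rel (set es)) (s ''R'') (mt n s ''w'')" and r: "rep_ok n (s ''R'')"
    using assms by (simp_all add: level_ok_def)
  have e: "event n s" using assms by (simp add: level_ok_def)
  then show l: "ladj n (edge_rel (set es)) (s ''R'') (s ''u'' 0) (s ''x'' 0)"
    using w unfolding witnesses_def event_def by blast
  show "s ''u'' 0 \<in> live n (s ''R'')" "s ''x'' 0 \<in> live n (s ''R'')" using ladj_live[OF r l] by auto
  show "ladj n (edge_rel (set es)) (s ''R'') (s ''x'' 0) (s ''u'' 0)" by (rule ladj_sym[OF l])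
  show "s ''l'' (s ''u'' 0) = 1" "s ''l'' (s ''x'' 0) = 1" using e by (simp_all add: event_def)
  show "bctx n es s" "class_matchings n (edge_rel (set es)) (s ''R'') (mt n s ''Q'')"
    "forest (live n (s ''R'')) (ladj n (edge_rel (set es)) (s ''R'')) (s ''M'') (s ''l'') (s ''o'') (mt n s ''T'')"
    using assms by (simp_all add: level_ok_def state_forest_def)
  show "\<And>a. \<not> edge_rel (set es) a a" using assms edge_rel_irrefl by (auto simp: level_ok_def)
qed

definition augment_body :: com where
  "augment_body = If (Eq (V ''i'') (V ''u'')) (Set ''t'' (Plus (V ''x'') (N 1)))
     (If (Eq (V ''i'') (V ''x'')) (Set ''t'' (Plus (V ''u'') (N 1)))
     (If (And (Less (N 0) (Get ''l'' (V ''i''))) (Eq (Get ''o'' (V ''i'')) (Get ''o'' (V ''u''))))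
       (Set ''t'' (G2 ''T'' (V ''u'') (V ''i''))) (Set ''t'' (G2 ''T'' (V ''x'') (V ''i'')))))"

definition augment_prog :: com where
  "augment_prog = Seq (Fill ''i'' ''n'' augment_body ''M'' (N 0) ''t'')
     (Seq (Set ''c'' (V ''u'')) (Seq (Set ''a'' (V ''u''))
     (Seq (lift_prog ''M'' ''m'' (N 0)) (Set ''g'' (N 1)))))"

lemma mods_augment_body [simp]: "mods augment_body = {''t''}"
  by (simp add: augment_body_def)

lemma augment_runs:
  assumes W: "100 \<le> W" "n * n \<le> W" and ok: "level_ok n es s" and o: "s ''o'' (s ''u'' 0) \<noteq> s ''o'' (s ''x'' 0)"
  obtains s' where "runs augment_prog s (W ^ 12) s'" "mate_on {..<n} (edge_rel (set es)) (s' ''m'')"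
    "card {v \<in> {..<n}. s' ''m'' v = 0} + 2 = card {v \<in> live n (s ''R''). s ''M'' v = 0}"
    "s' ''g'' 0 = 1"
proof -
  note D = level_okD[OF ok] and cD = bctxD[OF level_okD(1)[OF ok]]
  have nW: "n \<le> W" using W(2) by (cases n) auto
  define u x where "u = s ''u'' 0" and "x = s ''x'' 0"
  note uxd = u_def[symmetric] x_def[symmetric]
  let ?L = "live n (s ''R'')" and ?la = "ladj n (edge_rel (set es)) (s ''R'')"
  define K where "K = (\<lambda>v. if v = u then Suc x else if v = x then Suc u
    else if s ''l'' v \<noteq> 0 \<and> s ''o'' v = s ''o'' u then mt n s ''T'' u v else mt n s ''T'' x v)"
  have K: "mate_on ?L ?la K" "card {v \<in> ?L. K v = 0} + 2 = card {v \<in> ?L. s ''M'' v = 0}"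
    unfolding K_def u_def x_def by (rule forest_augment[OF D(5) finite_live D(6,8,7,9,10,11) o])+
  have uL: "u \<in> ?L" "x \<in> ?L" using D by (simp_all add: uxd)
  then have un: "u < n" "x < n" "s ''R'' u = u" by (auto simp: live_def)
  have ru: "s ''r'' u = u * n" "s ''r'' x = x * n" using cD un by simp_all
  obtain s1 where s1: "runs (Fill ''i'' ''n'' augment_body ''M'' (N 0) ''t'') s (W ^ 6) s1"
    "s1 ''M'' = (\<lambda>k. if 0 \<le> k \<and> k < 0 + s ''n'' 0 then K (k - 0) else s ''M'' k)"
    "frame (insert ''i'' (insert ''M'' (mods augment_body))) s s1"
  proof (rule runs_Fill[where W = W and s = s and i = "''i''" and l = "''n''" and B = augment_body and X = "''M''"
      and off = "N 0" and t = "''t''" and p = 0 and val = K])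
    fix j v assume j: "j < s ''n'' 0" "v ''i'' 0 = j" and fr: "frame (insert ''i'' (insert ''M'' (mods augment_body))) s v"
    have f: "v ''u'' = s ''u''" "v ''x'' = s ''x''" "v ''l'' = s ''l''" "v ''o'' = s ''o''" "v ''T'' = s ''T''" "v ''r'' = s ''r''"
      by (auto intro!: frameD[OF fr])
    have f0: "v ''u'' 0 = u" "v ''x'' 0 = x" unfolding f uxd by (rule refl)+
    show "run augment_body v ''t'' 0 = K j"
      unfolding K_def mt_def using j(2) f(3-6) f0 ru by (auto simp: augment_body_def)
  qed (use W nW cD in \<open>auto simp: augment_body_def\<close>)
  \<comment> \<open>With \<open>c\<close> and \<open>a\<close> both equal to \<open>u\<close>, the
    vertex prescribed for the class of \<open>u\<close> is its representative, so the expansion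
    treats all classes alike.\<close>
  let ?i1 = "Set ''c'' (V ''u'')" and ?i2 = "Set ''a'' (V ''u'')" and ?i3 = "Set ''g'' (N 1)"
  define s2 s3 where "s2 = run ?i1 s1" and "s3 = run ?i2 s2"
  have fr3: "frame {''i'', ''M'', ''t'', ''c'', ''a''} s s3"
    using s1(3) by (auto simp: s2_def s3_def frame_def)
  have s1u: "s1 ''u'' 0 = u" using s1(3) by (simp add: frame_def uxd)
  have ca: "s3 ''c'' 0 = u" "s3 ''a'' 0 = u" using s1u by (simp_all add: s2_def s3_def)
  have M3: "s3 ''M'' b = K b" if "b < n" for b
    using s1(2) cD that by (simp add: s2_def s3_def)
  have f3: "s3 ''R'' = s ''R''" "s3 ''w'' = s ''w''" "s3 ''Q'' = s ''Q''" by (auto intro!: frameD[OF fr3])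
  have m3: "mt n s3 ''w'' = mt n s ''w''" "mt n s3 ''Q'' = mt n s ''Q''" by (rule mt_cong; simp only: f3)+
  have c3: "bctx n es s3" by (rule bctx_frame[OF D(1) fr3]) (simp add: ctx_vars_def)
  have K3: "mate_on ?L ?la (s3 ''M'')" by (rule mate_on_cong[OF _ K(1)]) (use M3 live_lt in auto)
  have rl: "s ''R'' b \<in> ?L" if "b < n" for b using D(2) that by (simp add: rep_ok_def)
  obtain s4 where s4: "runs (lift_prog ''M'' ''m'' (N 0)) s3 (W ^ 6) s4"
    "s4 ''m'' = (\<lambda>k. if 0 \<le> k \<and> k < 0 + n then
       lift_mate (s3 ''R'') (mt n s3 ''Q'') (mt n s3 ''w'') (s3 ''M'') (s3 ''c'' 0) (s3 ''a'' 0) (k - 0) else s3 ''m'' k)"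
    "frame {''i'', ''m'', ''y'', ''d'', ''z'', ''t''} s3 s4"
  proof (rule lift_runs[OF W(1) nW c3, where src = "''M''" and X = "''m''" and off = "N 0" and p = 0])
    fix b assume b: "b < n"
    show "s3 ''R'' b < n" using rl[OF b] live_lt by (simp add: f3)
    show "exposed (mt n s3 ''w'') (s3 ''M'') (s3 ''c'' 0) (s3 ''a'' 0) (s3 ''R'' b) < n"
      unfolding f3 m3 ca by (rule exposed_props(1)[OF D(2,3) K3 un(1,3) rl[OF b]])
    fix z assume "s3 ''M'' (s3 ''R'' b) = Suc z"
    then show "z < n" using mate_onD(1)[OF K3 rl[OF b]] live_lt(1) by (simp add: f3)
  qed auto
  let ?D = "lift_mate (s ''R'') (mt n s ''Q'') (mt n s ''w'') (s3 ''M'') u u"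
  have m4: "s4 ''m'' b = ?D b" if "b < n" for b using that by (simp add: s4(2) f3 m3 ca)
  note L = lift_mate_props[OF D(2,3,4) K3 un(1,3) D(12)]
  define s5 where "s5 = run ?i3 s4"
  have s5: "s5 ''m'' = s4 ''m''" "s5 ''g'' 0 = 1" by (simp_all add: s5_def)
  have rb: "runs ?i1 s1 (W ^ 1) s2" "runs ?i2 s2 (W ^ 1) s3" "runs ?i3 s4 (W ^ 1) s5"
    unfolding s2_def s3_def s5_def using W by (intro runs_line; simp)+
  from runs_Seq[OF s4(1) rb(3) W(1), of 7]
  have "runs (Seq (lift_prog ''M'' ''m'' (N 0)) ?i3) s3 (W ^ 7) s5" by simp
  from runs_Seq[OF rb(2) this W(1), of 8]
  have "runs (Seq ?i2 (Seq (lift_prog ''M'' ''m'' (N 0)) ?i3)) s2 (W ^ 8) s5" by simp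
  from runs_Seq[OF rb(1) this W(1), of 9]
  have "runs (Seq ?i1 (Seq ?i2 (Seq (lift_prog ''M'' ''m'' (N 0)) ?i3))) s1 (W ^ 9) s5" by simp
  from runs_Seq[OF s1(1) this W(1), of 12] have "runs augment_prog s (W ^ 12) s5" by (simp add: augment_prog_def)
  moreover have "mate_on {..<n} (edge_rel (set es)) (s5 ''m'')"
    by (rule mate_on_cong[OF _ L(1)]) (use m4 s5 in auto)
  moreover have "{v \<in> {..<n}. s5 ''m'' v = 0} = {v \<in> {..<n}. ?D v = 0}" using m4 s5 by auto
  then have "card {v \<in> {..<n}. s5 ''m'' v = 0} = card {x \<in> ?L. s3 ''M'' x = 0}" using L(4) by simp
  moreover have "{x \<in> ?L. s3 ''M'' x = 0} = {x \<in> ?L. K x = 0}" using M3 live_lt by auto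
  ultimately show ?thesis using that[of s5] s5 K(2) by simp
qed

subsection \<open>Contracting a blossom\<close>

lemma runs_rows:
  assumes W: "100 \<le> W" "n \<le> W" and n: "s ''n'' 0 = n"
    and v: "v \<notin> mods c" "''n'' \<notin> mods c" "v \<noteq> ''n''" "X \<noteq> v" and k: "k + 5 < m"
    and b: "\<And>j t. j < n \<Longrightarrow> t v 0 = j \<Longrightarrow> frame (insert v (mods c)) s t \<Longrightarrow> bval be t \<longleftrightarrow> P j"
    and step: "\<And>j t. j < n \<Longrightarrow> P j \<Longrightarrow> t v 0 = j \<Longrightarrow> frame (insert v (mods c)) s t \<Longrightarrow>
      \<exists>t'. runs c t (W ^ k) t' \<and> (\<forall>a<n. \<forall>b<n. mt n t' X a b = (if a = j then val j b else mt n t X a b))"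
  obtains s' where "runs (For v ''n'' (If be c Skip)) s (W ^ m) s'"
    "\<And>a b. a < n \<Longrightarrow> b < n \<Longrightarrow> mt n s' X a b = (if P a then val a b else mt n s X a b)"
    "frame (insert v (mods c)) s s'"
proof -
  let ?c = "If be c Skip"
  let ?J = "\<lambda>j t. \<forall>a<n. \<forall>b<n. mt n t X a b = (if P a \<and> a < j then val a b else mt n s X a b)"
  obtain s' where s': "runs (For v ''n'' ?c) s (W ^ m) s'" "?J (s ''n'' 0) s'" "frame (insert v (mods ?c)) s s'"
  proof (rule runs_For[of W s "''n''" v ?c "k + 1" m ?J])
    show "?J 0 (s(v := (s v)(0 := 0)))" using v by (simp add: mt_def)
  next
    fix j t assume t: "j < s ''n'' 0" "t v 0 = j" "frame (insert v (mods ?c)) s t" "?J j t"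
    have fr: "frame (insert v (mods c)) s t" using t(3) by simp
    have jn: "j < n" using t(1) n by simp
    have cong: "mt n (t'(v := z)) X = mt n t' X" for t' z by (rule mt_cong) (use v in simp)
    show "\<exists>t'. runs ?c t (W ^ (k + 1)) t' \<and>
      (frame (mods ?c) t t' \<longrightarrow> ?J (Suc j) (t'(v := (t' v)(0 := Suc j))))"
    proof (cases "P j")
      case True
      then obtain t' where t': "runs c t (W ^ k) t'"
        "\<forall>a<n. \<forall>b<n. mt n t' X a b = (if a = j then val j b else mt n t X a b)"
        using step[OF jn _ t(2) fr] by blast
      have "runs ?c t (W ^ (k + 1)) t'" by (rule runs_If_True[OF _ t'(1) W(1)]) (use b[OF jn t(2) fr] True in auto)
      moreover have "?J (Suc j) (t'(v := (t' v)(0 := Suc j)))"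
        unfolding cong using t'(2) t(4) True by (auto simp: less_Suc_eq)
      ultimately show ?thesis by blast
    next
      case False
      have "runs Skip t (W ^ 0) t" using exec.Skip[of t] by (auto simp: runs_def)
      then have "runs ?c t (W ^ (k + 1)) t"
        by (rule runs_If_False[where k = 0, rotated]) (use W b[OF jn t(2) fr] False in auto)
      moreover have "?J (Suc j) (t(v := (t v)(0 := Suc j)))"
        unfolding cong using t(4) False by (auto simp: less_Suc_eq)
      ultimately show ?thesis by blast
    qed
  qed (use W n v k in auto)
  show ?thesis using that[OF s'(1)] s'(2,3) n by simp
qed

definition walk_body :: com where
  "walk_body = Seq (Set ''y'' (Minus (G2 ''T'' (V ''x'') (V ''c'')) (N 1)))
     (Seq (Put ''P'' (V ''y'') (Plus (V ''k'') (N 1)))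
     (Seq (Set ''c'' (Minus (G2 ''T'' (V ''u'') (V ''y'')) (N 1)))
     (Seq (Set ''k'' (Plus (V ''k'') (N 2))) (Put ''P'' (V ''c'') (V ''k'')))))"

definition walk_prog :: com where
  "walk_prog = Seq (Fill ''i'' ''n'' (Set ''t'' (N 0)) ''P'' (N 0) ''t'')
     (Seq (Seq (Put ''P'' (V ''u'') (N 1)) (Seq (Set ''k'' (N 1)) (Set ''c'' (V ''u''))))
     (While (Not (Eq (V ''c'') (V ''x''))) walk_body))"

text \<open>Only the first \<open>n\<close> cells of \<open>P\<close> are cleared, whereas
  \<open>walk\<close> speaks about all numbers.\<close>

definition posf :: "nat \<Rightarrow> state \<Rightarrow> nat \<Rightarrow> nat" where
  "posf n s v = (if v < n then s ''P'' v else 0)"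

lemma walk_runs:
  assumes W: "100 \<le> W" "n * n \<le> W" and ok: "level_ok n es s" and o: "s ''o'' (s ''x'' 0) = s ''o'' (s ''u'' 0)"
  obtains s' k where "runs walk_prog s (W ^ 9) s'"
    "walk (live n (s ''R'')) (s ''l'') (s ''o'') (mt n s ''T'' (s ''u'' 0)) (mt n s ''T'' (s ''x'' 0)) (s ''u'' 0) (posf n s') (s ''x'' 0) k"
    "frame {''i'', ''P'', ''t'', ''k'', ''c'', ''y''} s s'"
proof -
  note D = level_okD[OF ok] and cD = bctxD[OF level_okD(1)[OF ok]]
  have nW: "n \<le> W" using W(2) by (cases n) auto
  define u x where "u = s ''u'' 0" and "x = s ''x'' 0"
  note uxd = u_def[symmetric] x_def[symmetric]
  let ?L = "live n (s ''R'')"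
  let ?Tu = "mt n s ''T'' u" and ?Tx = "mt n s ''T'' x"
  have uL: "u \<in> ?L" "x \<in> ?L" "s ''l'' u = 1" "s ''l'' x = 1" "s ''o'' x = s ''o'' u" using D o by (simp_all add: uxd)
  then have un: "u < n" "x < n" by (auto simp: live_def)
  have ru: "s ''r'' u = u * n" "s ''r'' x = x * n" using cD un by simp_all
  let ?B = "Set ''t'' (N 0)"
  obtain s1 where s1: "runs (Fill ''i'' ''n'' ?B ''P'' (N 0) ''t'') s (W ^ 6) s1"
    "s1 ''P'' = (\<lambda>k. if 0 \<le> k \<and> k < 0 + s ''n'' 0 then 0 else s ''P'' k)"
    "frame (insert ''i'' (insert ''P'' (mods ?B))) s s1"
    by (rule runs_Fill[where W = W and s = s and i = "''i''" and l = "''n''" and B = ?B and X = "''P''" and off = "N 0"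
      and t = "''t''" and p = 0 and val = "\<lambda>_. 0"]) (use W nW cD in auto)
  let ?i = "Seq (Put ''P'' (V ''u'') (N 1)) (Seq (Set ''k'' (N 1)) (Set ''c'' (V ''u'')))"
  define s2 where "s2 = run ?i s1"
  have s1u: "s1 ''u'' 0 = u" using s1(3) by (simp add: frame_def uxd)
  have s2: "s2 ''P'' = (s1 ''P'')(u := 1)" "s2 ''k'' 0 = 1" "s2 ''c'' 0 = u" using s1u by (auto simp: s2_def)
  have p2: "posf n s2 = (\<lambda>_. 0)(u := 1)" using s1(2) cD un by (auto simp: posf_def s2)
  have fr2: "frame {''i'', ''P'', ''t'', ''k'', ''c''} s s2" using s1(3) by (auto simp: s2_def frame_def)
  let ?I = "\<lambda>t. walk ?L (s ''l'') (s ''o'') ?Tu ?Tx u (posf n t) (t ''c'' 0) (t ''k'' 0)"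
  let ?\<mu> = "\<lambda>t. card {v \<in> ?L. posf n t v = 0}"
  have mw: "mods walk_body = {''y'', ''P'', ''c'', ''k''}" by (auto simp: walk_body_def)
  let ?b = "Not (Eq (V ''c'') (V ''x''))"
  obtain s' where s': "runs (While ?b walk_body) s2 (W ^ 5) s'" "?I s'" "\<not> bval ?b s'" "frame (mods walk_body) s2 s'"
  proof (rule runs_While[of ?I s2 W ?\<mu> 1 1 5 walk_body ?b])
    show "?I s2" unfolding p2 s2 by (rule walk_init) (use uL in auto)
    have "?\<mu> s2 \<le> n" using card_mono[of "{..<n}" "{v \<in> ?L. posf n s2 v = 0}"] by (auto simp: live_def)
    then show "?\<mu> s2 \<le> W ^ 1" using nW by simp
  next
    fix t assume t: "?I t" "frame (mods walk_body) s2 t" "bval ?b t"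
    have fr: "frame {''i'', ''P'', ''t'', ''k'', ''c'', ''y''} s t"
      by (rule frame_trans[OF fr2 t(2)]) (auto simp: mw)
    have ft: "t ''x'' 0 = x" "t ''u'' 0 = u" "t ''r'' = s ''r''" "t ''T'' = s ''T''"
      using fr by (simp_all add: frame_def uxd)
    obtain y z where yz: "?Tx (t ''c'' 0) = Suc y" "?Tu y = Suc z" "y \<in> ?L" "z \<in> ?L" "posf n t y = 0" "posf n t z = 0" "y \<noteq> z"
      "walk ?L (s ''l'') (s ''o'') ?Tu ?Tx u ((posf n t)(y := t ''k'' 0 + 1, z := t ''k'' 0 + 2)) z (t ''k'' 0 + 2)"
      by (rule walk_step[OF D(5) uL(1,3,2,4,5) t(1)]) (use t(3) ft in auto)
    have yzn: "y < n" "z < n" using yz live_lt(1) by auto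
    define t' where "t' = run walk_body t"
    have t': "t' ''P'' = (t ''P'')(y := t ''k'' 0 + 1, z := t ''k'' 0 + 2)" "t' ''c'' 0 = z" "t' ''k'' 0 = t ''k'' 0 + 2"
      using yz ft ru by (simp_all add: t'_def walk_body_def mt_def)
    have p: "posf n t' = (posf n t)(y := t ''k'' 0 + 1, z := t ''k'' 0 + 2)"
      using yzn by (auto simp: posf_def t')
    have "runs walk_body t (W ^ 1) t'" unfolding t'_def using W by (intro runs_line) (auto simp: walk_body_def)
    moreover have "?I t'" using yz(8) by (simp add: p t')
    moreover have "{v \<in> ?L. posf n t' v = 0} \<subset> {v \<in> ?L. posf n t v = 0}"
      using yz by (auto simp: p split: if_splits)
    then have "?\<mu> t' < ?\<mu> t" by (intro psubset_card_mono) auto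
    ultimately show "\<exists>t'. runs walk_body t (W ^ 1) t' \<and> (frame (mods walk_body) t t' \<longrightarrow> ?I t' \<and> ?\<mu> t' < ?\<mu> t)" by blast
  qed (use W in auto)
  have fr: "frame {''i'', ''P'', ''t'', ''k'', ''c'', ''y''} s s'"
    by (rule frame_trans[OF fr2 s'(4)]) (auto simp: mw)
  have r2: "runs ?i s1 (W ^ 1) s2" unfolding s2_def using W by (intro runs_line) auto
  from runs_Seq[OF r2 s'(1) W(1), of 7]
  have "runs (Seq ?i (While ?b walk_body)) s1 (W ^ 7) s'" by simp
  from runs_Seq[OF s1(1) this W(1), of 9] have r: "runs walk_prog s (W ^ 9) s'" by (simp add: walk_prog_def)
  have "s' ''x'' 0 = x" using fr by (simp add: frame_def uxd)
  then have "s' ''c'' 0 = x" using s'(3) by simp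
  then show ?thesis using that[OF r _ fr] s'(2) by (simp add: uxd)
qed

definition level_vars :: "vname set" where
  "level_vars = ctx_vars \<union> {''R'', ''w'', ''Q'', ''M'', ''l'', ''o'', ''T'', ''u'', ''x''}"

lemma level_ok_frame:
  assumes ok: "level_ok n es s" and fr: "frame X s t" and X: "X \<inter> level_vars = {}"
  shows "level_ok n es t"
proof -
  have f: "t ''R'' = s ''R''" "t ''w'' = s ''w''" "t ''Q'' = s ''Q''" "t ''M'' = s ''M''" "t ''l'' = s ''l''"
    "t ''o'' = s ''o''" "t ''T'' = s ''T''" "t ''u'' = s ''u''" "t ''x'' = s ''x''"
    using X by (auto simp: level_vars_def intro!: frameD[OF fr])
  have m: "mt n t ''w'' = mt n s ''w''" "mt n t ''Q'' = mt n s ''Q''" "mt n t ''T'' = mt n s ''T''"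
    by (rule mt_cong; simp only: f)+
  have "bctx n es t" by (rule bctx_frame[OF level_okD(1)[OF ok] fr]) (use X in \<open>auto simp: level_vars_def\<close>)
  then show ?thesis using ok by (simp add: level_ok_def state_forest_def event_def f m)
qed

text \<open>Evaluates \<open>blossom_mate\<close> at \<open>i\<close>. The label of \<open>c\<close>
  stands in for the parity of its position, the outer vertices of the cycle being those at odd
  positions.\<close>

definition blossom_body :: com where
  "blossom_body = If (Eq (Get ''P'' (V ''i'')) (N 0)) (Set ''t'' (G2 ''T'' (V ''u'') (V ''i'')))
    (If (Eq (V ''i'') (V ''c'')) (Set ''t'' (N 0))
    (If (Eq (Get ''l'' (V ''c'')) (N 1))
      (If (Less (Get ''P'' (V ''i'')) (Get ''P'' (V ''c'')))
        (Set ''t'' (G2 ''T'' (V ''x'') (V ''i''))) (Set ''t'' (G2 ''T'' (V ''u'') (V ''i''))))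
    (If (Eq (V ''i'') (V ''u'')) (Set ''t'' (Plus (V ''x'') (N 1)))
    (If (Eq (V ''i'') (V ''x'')) (Set ''t'' (Plus (V ''u'') (N 1)))
      (If (Less (Get ''P'' (V ''i'')) (Get ''P'' (V ''c'')))
        (Set ''t'' (G2 ''T'' (V ''u'') (V ''i''))) (Set ''t'' (G2 ''T'' (V ''x'') (V ''i''))))))))"

lemma mods_blossom_body [simp]: "mods blossom_body = {''t''}"
  by (simp add: blossom_body_def)

definition blossom_row :: com where
  "blossom_row = For ''a'' ''n'' (If (Eq (Get ''R'' (V ''a'')) (V ''c'')) (lift_prog ''C'' ''S'' (Get ''r'' (V ''a''))) Skip)"

text \<open>The new rows are collected in \<open>S\<close>, because expanding the remaining rows
  still reads the old \<open>Q\<close>.\<close>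

definition blossom_rows :: com where
  "blossom_rows = For ''c'' ''n'' (If (Less (N 0) (Get ''P'' (V ''c'')))
     (Seq (Fill ''i'' ''n'' blossom_body ''C'' (N 0) ''t'') blossom_row) Skip)"

definition copy_rows :: com where
  "copy_rows = For ''a'' ''n'' (If (Less (N 0) (Get ''P'' (Get ''R'' (V ''a''))))
     (Fill ''i'' ''n'' (Set ''t'' (G2 ''S'' (V ''a'') (V ''i''))) ''Q'' (Get ''r'' (V ''a'')) ''t'') Skip)"

definition clear_body :: com where
  "clear_body = If (Less (N 0) (Get ''P'' (V ''i''))) (Set ''t'' (N 0)) (Set ''t'' (G2 ''T'' (V ''u'') (V ''i'')))"

definition merge_body :: com where
  "merge_body = If (Less (N 0) (Get ''P'' (Get ''R'' (V ''i'')))) (Set ''t'' (V ''u'')) (Set ''t'' (Get ''R'' (V ''i'')))"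

text \<open>The renaming of \<open>R\<close> comes last, because \<open>blossom_rows\<close> and
  \<open>copy_rows\<close> refer to the old classes.\<close>

definition contract_prog :: com where
  "contract_prog = Seq blossom_rows (Seq copy_rows
     (Seq (Fill ''i'' ''n'' clear_body ''M'' (N 0) ''t'') (Fill ''i'' ''n'' merge_body ''R'' (N 0) ''t'')))"

lemma mods_lift_prog [simp]: "mods (lift_prog src X off) = {''i'', X, ''y'', ''d'', ''z'', ''t''}"
  by (auto simp: lift_prog_def)

lemma mods_blossom_row [simp]: "mods blossom_row = {''a'', ''i'', ''S'', ''y'', ''d'', ''z'', ''t''}"
  by (simp add: blossom_row_def)

lemma mods_blossom_rows: "mods blossom_rows = {''c'', ''i'', ''C'', ''t'', ''a'', ''S'', ''y'', ''d'', ''z''}"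
  by (auto simp: blossom_rows_def)

lemma blossom_rows_runs:
  assumes W: "100 \<le> W" "n * n \<le> W" and ok: "level_ok n es s"
    and wk: "walk (live n (s ''R'')) (s ''l'') (s ''o'') (mt n s ''T'' (s ''u'' 0)) (mt n s ''T'' (s ''x'' 0)) (s ''u'' 0) (posf n s) (s ''x'' 0) k"
  defines "Kc \<equiv> blossom_mate (mt n s ''T'' (s ''u'' 0)) (mt n s ''T'' (s ''x'' 0)) (s ''u'' 0) (s ''x'' 0) (posf n s)"
  obtains s' where "runs blossom_rows s (W ^ 20) s'"
    "\<And>a b. a < n \<Longrightarrow> b < n \<Longrightarrow> posf n s (s ''R'' a) \<noteq> 0 \<Longrightarrow> mt n s' ''S'' a b
      = lift_mate (s ''R'') (mt n s ''Q'') (mt n s ''w'') (Kc (s ''R'' a)) (s ''R'' a) a b"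
    "frame {''c'', ''i'', ''C'', ''t'', ''a'', ''S'', ''y'', ''d'', ''z''} s s'"
proof -
  note D = level_okD[OF ok] and cD = bctxD[OF level_okD(1)[OF ok]] and w = walkD[OF wk]
  have nW: "n \<le> W" using W(2) by (cases n) auto
  let ?L = "live n (s ''R'')" and ?la = "ladj n (edge_rel (set es)) (s ''R'')"
  define u x where "u = s ''u'' 0" and "x = s ''x'' 0"
  note uxd = u_def[symmetric] x_def[symmetric]
  have uL: "u \<in> ?L" "x \<in> ?L" using D by (simp_all add: uxd)
  then have un: "u < n" "x < n" by (auto simp: live_def)
  have ru: "s ''r'' u = u * n" "s ''r'' x = x * n" using cD un by simp_all
  have rl: "s ''R'' b \<in> ?L" if "b < n" for b using D(2) that by (simp add: rep_ok_def)
  have ne: "s ''u'' 0 \<noteq> s ''x'' 0" using D(10) by (simp add: ladj_def)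
  have Kc: "mate_on ?L ?la (Kc c)" if "posf n s c \<noteq> 0" for c
    unfolding Kc_def
    by (rule blossom_mate(1)[OF wk _ _ _ D(10,11) ne that])
      (use forestD(7)[OF D(5) D(6,8)] forestD(7)[OF D(5) D(7,9)] in auto)
  define E where "E a b = lift_mate (s ''R'') (mt n s ''Q'') (mt n s ''w'') (Kc (s ''R'' a)) (s ''R'' a) a b" for a b
  let ?c = "Seq (Fill ''i'' ''n'' blossom_body ''C'' (N 0) ''t'') blossom_row"
  let ?be = "Less (N 0) (Get ''P'' (V ''c''))"
  let ?J = "\<lambda>j t. \<forall>a<n. \<forall>b<n. s ''R'' a < j \<and> posf n s (s ''R'' a) \<noteq> 0 \<longrightarrow> mt n t ''S'' a b = E a b"
  obtain s' where s': "runs (For ''c'' ''n'' (If ?be ?c Skip)) s (W ^ 20) s'" "?J (s ''n'' 0) s'"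
    "frame (insert ''c'' (mods (If ?be ?c Skip))) s s'"
  proof (rule runs_For[of W s "''n''" "''c''" "If ?be ?c Skip" 15 20 ?J])
    fix j t assume t: "j < s ''n'' 0" "t ''c'' 0 = j" "frame (insert ''c'' (mods (If ?be ?c Skip))) s t" "?J j t"
    have fr: "frame {''c'', ''i'', ''C'', ''t'', ''a'', ''S'', ''y'', ''d'', ''z''} s t"
      by (rule frame_mono[OF t(3)]) auto
    have jn: "j < n" using t(1) cD by simp
    have f: "t ''P'' = s ''P''" "t ''R'' = s ''R''" "t ''l'' = s ''l''" "t ''T'' = s ''T''" "t ''u'' = s ''u''" "t ''x'' = s ''x''"
      "t ''r'' = s ''r''" "t ''n'' = s ''n''"
      by (auto intro!: frameD[OF fr])
    have cong: "mt n (t'(''c'' := z)) ''S'' = mt n t' ''S''" for t' z by (rule mt_cong) simp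
    have be: "bval ?be t \<longleftrightarrow> posf n s j \<noteq> 0" using t(2) jn by (simp add: posf_def f)
    show "\<exists>t'. runs (If ?be ?c Skip) t (W ^ 15) t' \<and>
      (frame (mods (If ?be ?c Skip)) t t' \<longrightarrow> ?J (Suc j) (t'(''c'' := (t' ''c'')(0 := Suc j))))"
    proof (cases "posf n s j = 0")
      case True
      have "runs Skip t (W ^ 0) t" using exec.Skip[of t] by (auto simp: runs_def)
      then have "runs (If ?be ?c Skip) t (W ^ 15) t"
        by (rule runs_If_False[where k = 0, rotated]) (use W be True in auto)
      moreover have "?J (Suc j) (t(''c'' := (t ''c'')(0 := Suc j)))"
      proof (intro allI impI)
        fix a b assume ab: "a < n" "b < n" "s ''R'' a < Suc j \<and> posf n s (s ''R'' a) \<noteq> 0"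
        then have "s ''R'' a \<noteq> j" using True by auto
        then show "mt n (t(''c'' := (t ''c'')(0 := Suc j))) ''S'' a b = E a b"
          unfolding cong using ab t(4) by simp
      qed
      ultimately show ?thesis by blast
    next
      case pj: False
      have lj: "s ''l'' j = (if odd (posf n s j) then 1 else 2)" using w(4)[OF pj] by blast
      have nt: "t ''n'' 0 \<le> W" using cD nW f by simp
      obtain t1 where t1: "runs (Fill ''i'' ''n'' blossom_body ''C'' (N 0) ''t'') t (W ^ 6) t1"
        "t1 ''C'' = (\<lambda>k. if 0 \<le> k \<and> k < 0 + t ''n'' 0 then Kc j (k - 0) else t ''C'' k)"
        "frame (insert ''i'' (insert ''C'' (mods blossom_body))) t t1"
      proof (rule runs_Fill[where W = W and s = t and i = "''i''" and l = "''n''" and B = blossom_body and X = "''C''"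
          and off = "N 0" and t = "''t''" and p = 0 and val = "Kc j"])
        fix i v assume i: "i < t ''n'' 0" "v ''i'' 0 = i" and fv: "frame (insert ''i'' (insert ''C'' (mods blossom_body))) t v"
        have g: "v ''P'' = t ''P''" "v ''l'' = t ''l''" "v ''T'' = t ''T''" "v ''u'' = t ''u''" "v ''x'' = t ''x''"
          "v ''r'' = t ''r''" "v ''c'' = t ''c''"
          by (auto intro!: frameD[OF fv])
        have g0: "v ''u'' 0 = u" "v ''x'' 0 = x" "v ''c'' 0 = j" unfolding g f uxd using t(2) by simp_all
        have "i < n" using i(1) cD f by simp
        then have p: "posf n s i = s ''P'' i" "posf n s j = s ''P'' j" using jn by (simp_all add: posf_def)
        have "run blossom_body v ''t'' 0 = (if s ''P'' i = 0 then s ''T'' (u * n + i) else if i = j then 0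
          else if s ''l'' j = 1 then (if s ''P'' i < s ''P'' j then s ''T'' (x * n + i) else s ''T'' (u * n + i))
          else if i = u then Suc x else if i = x then Suc u
          else if s ''P'' i < s ''P'' j then s ''T'' (u * n + i) else s ''T'' (x * n + i))"
          using i(2) g0 g(1-3,6) f ru by (simp add: blossom_body_def)
        also have "\<dots> = Kc j i"
          unfolding Kc_def blossom_mate_def p uxd lj mt_def by simp
        finally show "run blossom_body v ''t'' 0 = Kc j i" .
      qed (use W nt in \<open>auto simp: blossom_body_def\<close>)
      have fr1: "frame {''c'', ''i'', ''C'', ''t'', ''a'', ''S'', ''y'', ''d'', ''z''} s t1"
        by (rule frame_trans[OF fr t1(3)]) auto
      have c1: "bctx n es t1" by (rule bctx_frame[OF D(1) fr1]) (simp add: ctx_vars_def)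
      have f1: "t1 ''R'' = s ''R''" "t1 ''w'' = s ''w''" "t1 ''Q'' = s ''Q''" by (auto intro!: frameD[OF fr1])
      have m1: "mt n t1 ''w'' = mt n s ''w''" "mt n t1 ''Q'' = mt n s ''Q''" by (rule mt_cong; simp only: f1)+
      have j1: "t1 ''c'' 0 = j" using t1(3) t(2) by (simp add: frame_def)
      have C1: "t1 ''C'' b = Kc j b" if "b < n" for b using t1(2) that cD f by simp
      have K1: "mate_on ?L ?la (t1 ''C'')" by (rule mate_on_cong[OF _ Kc[OF pj]]) (use C1 live_lt in auto)
      let ?b2 = "Eq (Get ''R'' (V ''a'')) (V ''c'')"
      let ?c2 = "lift_prog ''C'' ''S'' (Get ''r'' (V ''a''))"
      obtain t2 where t2: "runs (For ''a'' ''n'' (If ?b2 ?c2 Skip)) t1 (W ^ 12) t2"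
        "\<And>a b. a < n \<Longrightarrow> b < n \<Longrightarrow> mt n t2 ''S'' a b = (if s ''R'' a = j then E a b else mt n t1 ''S'' a b)"
        "frame (insert ''a'' (mods ?c2)) t1 t2"
      proof (rule runs_rows[where W = W and n = n and s = t1 and v = "''a''" and c = ?c2 and be = ?b2 and X = "''S''"
          and k = 6 and m = 12 and P = "\<lambda>a. s ''R'' a = j" and val = E])
        show "t1 ''n'' 0 = n" using bctxD[OF c1] by simp
      next
        fix a v assume a: "a < n" "v ''a'' 0 = a" and fv: "frame (insert ''a'' (mods ?c2)) t1 v"
        have "v ''R'' = t1 ''R''" "v ''c'' = t1 ''c''" by (auto intro!: frameD[OF fv])
        then show "bval ?b2 v \<longleftrightarrow> s ''R'' a = j" using a f1 j1 by simp
      next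
        fix a v assume a: "a < n" "s ''R'' a = j" "v ''a'' 0 = a" and fv: "frame (insert ''a'' (mods ?c2)) t1 v"
        have g: "v ''R'' = s ''R''" "v ''w'' = t1 ''w''" "v ''Q'' = t1 ''Q''" "v ''C'' = t1 ''C''" "v ''c'' = t1 ''c''"
          using f1 by (auto simp: frameD[OF fv])
        have mg: "mt n v ''w'' = mt n s ''w''" "mt n v ''Q'' = mt n s ''Q''"
          unfolding m1[symmetric] by (rule mt_cong; simp only: g)+
        have g0: "v ''c'' 0 = j" using g j1 by simp
        have frv: "frame {''c'', ''i'', ''C'', ''t'', ''a'', ''S'', ''y'', ''d'', ''z''} s v"
          by (rule frame_trans[OF fr1 fv]) auto
        have cv: "bctx n es v" by (rule bctx_frame[OF D(1) frv]) (simp add: ctx_vars_def)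
        obtain v' where v': "runs ?c2 v (W ^ 6) v'"
          "v' ''S'' = (\<lambda>k. if a * n \<le> k \<and> k < a * n + n then
             lift_mate (v ''R'') (mt n v ''Q'') (mt n v ''w'') (v ''C'') (v ''c'' 0) (v ''a'' 0) (k - a * n) else v ''S'' k)"
          "frame {''i'', ''S'', ''y'', ''d'', ''z'', ''t''} v v'"
        proof (rule lift_runs[OF W(1) nW cv, where src = "''C''" and X = "''S''" and off = "Get ''r'' (V ''a'')" and p = "a * n"])
          fix b assume b: "b < n"
          show "v ''R'' b < n" using rl[OF b] live_lt by (simp add: g)
          show "exposed (mt n v ''w'') (v ''C'') (v ''c'' 0) (v ''a'' 0) (v ''R'' b) < n"
            unfolding g(1,4) mg g0 a(3) by (rule exposed_props(1)[OF D(2,3) K1 a(1,2) rl[OF b]])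
          fix z assume "v ''C'' (v ''R'' b) = Suc z"
          then show "z < n" using mate_onD(1)[OF K1 rl[OF b]] live_lt(1) by (simp add: g)
        next
          fix q assume fq: "frame {''i'', ''S'', ''y'', ''d'', ''z'', ''t''} v q"
          have "q ''r'' = v ''r''" "q ''a'' = v ''a''" by (auto intro!: frameD[OF fq])
          then show "aval (Get ''r'' (V ''a'')) q = a * n" using a bctxD(3)[OF cv, of a] by simp
        qed auto
        have "mt n v' ''S'' a' b = (if a' = a then E a b else mt n v ''S'' a' b)" if "b < n" for a' b
        proof -
          have "mt n v' ''S'' a' b = (if a' = a then
            lift_mate (v ''R'') (mt n v ''Q'') (mt n v ''w'') (v ''C'') (v ''c'' 0) (v ''a'' 0) b else mt n v ''S'' a' b)"
            by (rule mt_fill[where v = "lift_mate (v ''R'') (mt n v ''Q'') (mt n v ''w'') (v ''C'') (v ''c'' 0) (v ''a'' 0)", OF _ that])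
              (rule v'(2))
          moreover have "lift_mate (v ''R'') (mt n v ''Q'') (mt n v ''w'') (v ''C'') (v ''c'' 0) (v ''a'' 0) b
            = lift_mate (s ''R'') (mt n s ''Q'') (mt n s ''w'') (t1 ''C'') j a b"
            unfolding g mg a(3) j1 by (rule refl)
          moreover have "\<dots> = lift_mate (s ''R'') (mt n s ''Q'') (mt n s ''w'') (Kc j) j a b"
            by (rule lift_mate_cong) (rule C1[OF live_lt(1)[OF rl[OF that]]])
          moreover have "\<dots> = E a b" unfolding E_def a(2) by (rule refl)
          ultimately show ?thesis by simp
        qed
        then show "\<exists>t'. runs ?c2 v (W ^ 6) t' \<and> (\<forall>a'<n. \<forall>b<n. mt n t' ''S'' a' b = (if a' = a then E a b else mt n v ''S'' a' b))"
          using v'(1) by blast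
      qed (use W nW in auto)
      have "runs ?c t (W ^ 13) t2"
        unfolding blossom_row_def by (rule runs_Seq[OF t1(1) t2(1) W(1)]) auto
      then have "runs (If ?be ?c Skip) t (W ^ 15) t2" by (rule runs_If_True[rotated]) (use W be pj in auto)
      moreover have "?J (Suc j) (t2(''c'' := (t2 ''c'')(0 := Suc j)))"
      proof (intro allI impI)
        fix a b assume ab: "a < n" "b < n" "s ''R'' a < Suc j \<and> posf n s (s ''R'' a) \<noteq> 0"
        have "t1 ''S'' = t ''S''" by (rule frameD[OF t1(3)]) simp
        then have "mt n t1 ''S'' = mt n t ''S''" by (rule mt_cong)
        then show "mt n (t2(''c'' := (t2 ''c'')(0 := Suc j))) ''S'' a b = E a b"
          unfolding cong t2(2)[OF ab(1,2)] using ab t(4) by auto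
      qed
      ultimately show ?thesis by blast
    qed
  qed (use W cD nW in auto)
  have "frame {''c'', ''i'', ''C'', ''t'', ''a'', ''S'', ''y'', ''d'', ''z''} s s'" by (rule frame_mono[OF s'(3)]) auto
  moreover have "mt n s' ''S'' a b = E a b" if "a < n" "b < n" "posf n s (s ''R'' a) \<noteq> 0" for a b
    using s'(2) that rl[OF that(1)] live_lt(1) cD(1) by auto
  ultimately show ?thesis using that s'(1) unfolding blossom_rows_def E_def by blast
qed

text \<open>The contracted graph inherits \<open>T u\<close> instead of \<open>M\<close>, because
  \<open>T u\<close> leaves free the vertex \<open>u\<close> to which the cycle shrinks; the number
  of free vertices is the same. The transfer of barriers is an implication, so that it composes over
  successive contractions.\<close>

lemma contract_runs:
  assumes W: "100 \<le> W" "n * n \<le> W" and ok: "level_ok n es s"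
    and wk: "walk (live n (s ''R'')) (s ''l'') (s ''o'') (mt n s ''T'' (s ''u'' 0)) (mt n s ''T'' (s ''x'' 0)) (s ''u'' 0) (posf n s) (s ''x'' 0) k"
    and f: "f = card {v \<in> live n (s ''R''). s ''M'' v = 0}"
  obtains s' where "runs contract_prog s (W ^ 25) s'" "rep_ok n (s' ''R'')"
    "class_matchings n (edge_rel (set es)) (s' ''R'') (mt n s' ''Q'')"
    "mate_on (live n (s' ''R'')) (ladj n (edge_rel (set es)) (s' ''R'')) (s' ''M'')"
    "card {v \<in> live n (s' ''R''). s' ''M'' v = 0} = f"
    "\<And>A \<kappa>. barrier (live n (s' ''R'')) (ladj n (edge_rel (set es)) (s' ''R'')) f A \<kappa> \<Longrightarrow>
      \<exists>A \<kappa>. barrier (live n (s ''R'')) (ladj n (edge_rel (set es)) (s ''R'')) f A \<kappa>"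
    "card (live n (s' ''R'')) < card (live n (s ''R''))"
    "frame {''c'', ''i'', ''C'', ''t'', ''a'', ''S'', ''y'', ''d'', ''z'', ''Q'', ''M'', ''R''} s s'"
proof -
  note D = level_okD[OF ok] and cD = bctxD[OF level_okD(1)[OF ok]] and w = walkD[OF wk]
  have nW: "n \<le> W" using W(2) by (cases n) auto
  let ?ad = "edge_rel (set es)"
  let ?L = "live n (s ''R'')" and ?la = "ladj n ?ad (s ''R'')"
  define u x where "u = s ''u'' 0" and "x = s ''x'' 0"
  note uxd = u_def[symmetric] x_def[symmetric]
  let ?pos = "posf n s" and ?Tu = "mt n s ''T'' u" and ?Tx = "mt n s ''T'' x"
  have uL: "u \<in> ?L" "x \<in> ?L" using D by (simp_all add: uxd)
  then have un: "u < n" "x < n" by (auto simp: live_def)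
  have ru: "s ''r'' u = u * n" using cD un by simp
  have rl: "s ''R'' b \<in> ?L" if "b < n" for b using D(2) that by (simp add: rep_ok_def)
  have rn: "s ''R'' b < n" if "b < n" for b using rl[OF that] live_lt by simp
  have nux: "u \<noteq> x" using D(10) by (simp add: ladj_def uxd)
  have Tu: "mate_on ?L ?la ?Tu" "?Tu u = 0" and Tx: "mate_on ?L ?la ?Tx"
    using forestD(7)[OF D(5) D(6,8)] forestD(7)[OF D(5) D(7,9)] by (simp_all add: uxd)
  define C where "C = {v. ?pos v \<noteq> 0}"
  have C: "C \<subseteq> ?L" "u \<in> C" using w(4) w(1) by (auto simp: C_def uxd)
  have xC: "x \<in> C" using w(2,3) by (auto simp: C_def uxd intro: odd_pos)
  have B: "mate_on ?L ?la (blossom_mate ?Tu ?Tx u x ?pos c) \<and> near_perfect C c (blossom_mate ?Tu ?Tx u x ?pos c)"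
    if "c \<in> C" for c
    unfolding C_def using blossom_mate[OF wk[unfolded uxd] Tu Tx D(10,11)[unfolded uxd] nux] that by (simp add: C_def)
  \<comment> \<open>Since \<open>u\<close> has position 1, every other vertex of the cycle comes
    after it and is matched by \<open>Tu\<close>.\<close>
  have "blossom_mate ?Tu ?Tx u x ?pos u b = ?Tu b" for b
    using w(1) Tu(2) by (auto simp: blossom_mate_def uxd)
  then have "blossom_mate ?Tu ?Tx u x ?pos u = ?Tu" by (rule ext)
  then have Cu: "near_perfect C u ?Tu" using B[OF C(2)] by simp
  obtain s1 where s1: "runs blossom_rows s (W ^ 20) s1"
    "\<And>a b. a < n \<Longrightarrow> b < n \<Longrightarrow> ?pos (s ''R'' a) \<noteq> 0 \<Longrightarrow> mt n s1 ''S'' a b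
      = lift_mate (s ''R'') (mt n s ''Q'') (mt n s ''w'') (blossom_mate ?Tu ?Tx u x ?pos (s ''R'' a)) (s ''R'' a) a b"
    "frame {''c'', ''i'', ''C'', ''t'', ''a'', ''S'', ''y'', ''d'', ''z''} s s1"
    using blossom_rows_runs[OF W ok wk] unfolding uxd by metis
  have c1: "bctx n es s1" by (rule bctx_frame[OF D(1) s1(3)]) (simp add: ctx_vars_def)
  have f1: "s1 ''P'' = s ''P''" "s1 ''R'' = s ''R''" "s1 ''Q'' = s ''Q''" "s1 ''T'' = s ''T''" "s1 ''u'' = s ''u''"
    by (auto intro!: frameD[OF s1(3)])
  let ?B2 = "Set ''t'' (G2 ''S'' (V ''a'') (V ''i''))"
  let ?b2 = "Less (N 0) (Get ''P'' (Get ''R'' (V ''a'')))"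
  let ?c2 = "Fill ''i'' ''n'' ?B2 ''Q'' (Get ''r'' (V ''a'')) ''t''"
  obtain s2 where s2: "runs (For ''a'' ''n'' (If ?b2 ?c2 Skip)) s1 (W ^ 12) s2"
    "\<And>a b. a < n \<Longrightarrow> b < n \<Longrightarrow> mt n s2 ''Q'' a b = (if s ''R'' a \<in> C then mt n s1 ''S'' a b else mt n s1 ''Q'' a b)"
    "frame (insert ''a'' (mods ?c2)) s1 s2"
  proof (rule runs_rows[where W = W and n = n and s = s1 and v = "''a''" and c = ?c2 and be = ?b2 and X = "''Q''"
      and k = 6 and m = 12 and P = "\<lambda>a. s ''R'' a \<in> C" and val = "mt n s1 ''S''"])
    show "s1 ''n'' 0 = n" using bctxD[OF c1] by simp
  next
    fix a v assume a: "a < n" "v ''a'' 0 = a" and fv: "frame (insert ''a'' (mods ?c2)) s1 v"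
    have "v ''R'' = s1 ''R''" "v ''P'' = s1 ''P''" by (auto intro!: frameD[OF fv])
    then show "bval ?b2 v \<longleftrightarrow> s ''R'' a \<in> C" using a f1 rn[OF a(1)] by (simp add: C_def posf_def)
  next
    fix a v assume a: "a < n" "s ''R'' a \<in> C" "v ''a'' 0 = a" and fv: "frame (insert ''a'' (mods ?c2)) s1 v"
    have cv: "bctx n es v" by (rule bctx_frame[OF c1 fv]) (simp add: ctx_vars_def)
    have "v ''n'' 0 \<le> W" using bctxD(1)[OF cv] nW by simp
    then obtain v' where v': "runs ?c2 v (W ^ 6) v'"
      "v' ''Q'' = (\<lambda>k. if a * n \<le> k \<and> k < a * n + v ''n'' 0 then mt n s1 ''S'' a (k - a * n) else v ''Q'' k)"
      "frame (insert ''i'' (insert ''Q'' (mods ?B2))) v v'"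
    proof (rule runs_Fill[where W = W and s = v and i = "''i''" and l = "''n''" and B = ?B2 and X = "''Q''"
        and off = "Get ''r'' (V ''a'')" and t = "''t''" and p = "a * n" and val = "mt n s1 ''S'' a", rotated])
      fix q assume fq: "frame (insert ''i'' (insert ''Q'' (mods ?B2))) v q"
      have "q ''r'' = v ''r''" "q ''a'' = v ''a''" by (auto intro!: frameD[OF fq])
      then show "aval (Get ''r'' (V ''a'')) q = a * n" using a bctxD(3)[OF cv, of a] by simp
    next
      fix i q assume i: "q ''i'' 0 = i" and fq: "frame (insert ''i'' (insert ''Q'' (mods ?B2))) v q"
      have "q ''r'' = v ''r''" "q ''a'' = v ''a''" "q ''S'' = v ''S''" by (auto intro!: frameD[OF fq])
      moreover have "v ''S'' = s1 ''S''" by (auto intro!: frameD[OF fv])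
      ultimately show "run ?B2 q ''t'' 0 = mt n s1 ''S'' a i"
        using a i bctxD(3)[OF cv, of a] by (simp add: mt_def)
    qed (use W in auto)
    have "mt n v' ''Q'' a' b = (if a' = a then mt n s1 ''S'' a b else mt n v ''Q'' a' b)" if "b < n" for a' b
      by (rule mt_fill[where v = "mt n s1 ''S'' a", OF _ that]) (use v'(2) bctxD(1)[OF cv] in simp)
    then show "\<exists>t'. runs ?c2 v (W ^ 6) t' \<and> (\<forall>a'<n. \<forall>b<n. mt n t' ''Q'' a' b = (if a' = a then mt n s1 ''S'' a b else mt n v ''Q'' a' b))"
      using v'(1) by blast
  qed (use W nW in auto)
  have r2: "runs copy_rows s1 (W ^ 12) s2" using s2(1) by (simp add: copy_rows_def)
  have fr2: "frame {''c'', ''i'', ''C'', ''t'', ''a'', ''S'', ''y'', ''d'', ''z'', ''Q''} s s2"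
    by (rule frame_trans[OF s1(3) s2(3)]) auto
  have c2: "bctx n es s2" by (rule bctx_frame[OF D(1) fr2]) (simp add: ctx_vars_def)
  have f2: "s2 ''P'' = s ''P''" "s2 ''R'' = s ''R''" "s2 ''T'' = s ''T''" "s2 ''u'' = s ''u''" "s2 ''r'' = s ''r''"
    by (auto intro!: frameD[OF fr2])
  have n2: "s2 ''n'' 0 \<le> W" using bctxD(1)[OF c2] nW by simp
  obtain s3 where s3: "runs (Fill ''i'' ''n'' clear_body ''M'' (N 0) ''t'') s2 (W ^ 6) s3"
    "s3 ''M'' = (\<lambda>k. if 0 \<le> k \<and> k < 0 + s2 ''n'' 0 then (if k - 0 \<in> C then 0 else ?Tu (k - 0)) else s2 ''M'' k)"
    "frame (insert ''i'' (insert ''M'' (mods clear_body))) s2 s3"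
  proof (rule runs_Fill[where W = W and s = s2 and i = "''i''" and l = "''n''" and B = clear_body and X = "''M''"
      and off = "N 0" and t = "''t''" and p = 0 and val = "\<lambda>i. if i \<in> C then 0 else ?Tu i"])
    fix i v assume i: "i < s2 ''n'' 0" "v ''i'' 0 = i" and fv: "frame (insert ''i'' (insert ''M'' (mods clear_body))) s2 v"
    have g: "v ''P'' = s ''P''" "v ''T'' = s ''T''" "v ''u'' = s ''u''" "v ''r'' = s ''r''"
      unfolding f2[symmetric] by (auto simp: clear_body_def intro!: frameD[OF fv])
    have "i < n" using i bctxD(1)[OF c2] by simp
    then have p: "i \<in> C \<longleftrightarrow> s ''P'' i \<noteq> 0" by (simp add: C_def posf_def)
    show "run clear_body v ''t'' 0 = (if i \<in> C then 0 else ?Tu i)"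
      using i(2) ru unfolding p by (simp add: clear_body_def g uxd mt_def)
  qed (use W n2 in \<open>auto simp: clear_body_def\<close>)
  have fr3: "frame {''c'', ''i'', ''C'', ''t'', ''a'', ''S'', ''y'', ''d'', ''z'', ''Q'', ''M''} s s3"
    by (rule frame_trans[OF fr2 s3(3)]) (auto simp: clear_body_def)
  have c3: "bctx n es s3" by (rule bctx_frame[OF D(1) fr3]) (simp add: ctx_vars_def)
  have n3: "s3 ''n'' 0 \<le> W" using bctxD(1)[OF c3] nW by simp
  have f3: "s3 ''P'' = s ''P''" "s3 ''R'' = s ''R''" "s3 ''u'' = s ''u''"
    by (auto intro!: frameD[OF fr3])
  have M3: "s3 ''M'' b = (if b \<in> C then 0 else ?Tu b)" if "b < n" for b
    using s3(2) bctxD(1)[OF c2] that by simp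
  obtain s4 where s4: "runs (Fill ''i'' ''n'' merge_body ''R'' (N 0) ''t'') s3 (W ^ 6) s4"
    "s4 ''R'' = (\<lambda>k. if 0 \<le> k \<and> k < 0 + s3 ''n'' 0 then contract C u (s ''R'') (k - 0) else s3 ''R'' k)"
    "frame (insert ''i'' (insert ''R'' (mods merge_body))) s3 s4"
  proof (rule runs_Fill[where W = W and s = s3 and i = "''i''" and l = "''n''" and B = merge_body and X = "''R''"
      and off = "N 0" and t = "''t''" and p = 0 and val = "contract C u (s ''R'')"])
    fix i v assume i: "i < s3 ''n'' 0" "v ''i'' 0 = i" and fv: "frame (insert ''i'' (insert ''R'' (mods merge_body))) s3 v"
      and eq: "\<forall>k. k < 0 \<or> 0 + i \<le> k \<longrightarrow> v ''R'' k = s3 ''R'' k"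
    have g: "v ''P'' = s ''P''" "v ''u'' = s ''u''"
      unfolding f3[symmetric] by (auto simp: merge_body_def intro!: frameD[OF fv])
    have R: "v ''R'' i = s ''R'' i" using eq f3 by simp
    have "i < n" using i bctxD(1)[OF c3] by simp
    then have p: "s ''R'' i \<in> C \<longleftrightarrow> s ''P'' (s ''R'' i) \<noteq> 0" using rn by (simp add: C_def posf_def)
    show "run merge_body v ''t'' 0 = contract C u (s ''R'') i"
      using i(2) R unfolding contract_def p by (simp add: merge_body_def g uxd)
  qed (use W n3 in \<open>auto simp: merge_body_def\<close>)
  have R4: "s4 ''R'' a = contract C u (s ''R'') a" if "a < n" for a
    using s4(2) bctxD(1)[OF c3] that by simp
  have fr4: "frame {''c'', ''i'', ''C'', ''t'', ''a'', ''S'', ''y'', ''d'', ''z'', ''Q'', ''M'', ''R''} s s4"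
    by (rule frame_trans[OF fr3 s4(3)]) (auto simp: merge_body_def)
  have Q34: "s3 ''Q'' = s2 ''Q''" by (rule frameD[OF s3(3)]) (simp add: clear_body_def)
  have "s4 ''Q'' = s3 ''Q''" "s4 ''M'' = s3 ''M''" by (auto simp: merge_body_def intro!: frameD[OF s4(3)])
  then have f4: "s4 ''Q'' = s2 ''Q''" "s4 ''M'' = s3 ''M''" using Q34 by simp_all
  have Q4: "mt n s4 ''Q'' = mt n s2 ''Q''" by (rule mt_cong) (rule f4)
  have Q1: "mt n s1 ''Q'' = mt n s ''Q''" by (rule mt_cong) (rule f1)
  have r: "runs contract_prog s (W ^ 25) s4"
  proof -
    from runs_Seq[OF s3(1) s4(1) W(1), of 7]
    have "runs (Seq (Fill ''i'' ''n'' clear_body ''M'' (N 0) ''t'') (Fill ''i'' ''n'' merge_body ''R'' (N 0) ''t'')) s2 (W ^ 7) s4" by simp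
    from runs_Seq[OF r2 this W(1), of 13]
    have "runs (Seq copy_rows (Seq (Fill ''i'' ''n'' clear_body ''M'' (N 0) ''t'') (Fill ''i'' ''n'' merge_body ''R'' (N 0) ''t''))) s1 (W ^ 13) s4" by simp
    from runs_Seq[OF s1(1) this W(1), of 25] show ?thesis by (simp add: contract_prog_def)
  qed
  let ?rep' = "contract C u (s ''R'')"
  have lv: "live n (s4 ''R'') = live n ?rep'" by (rule live_cong) (rule R4)
  have la: "ladj n ?ad (s4 ''R'') = ladj n ?ad ?rep'" by (rule ladj_cong) (rule R4)
  have L': "live n ?rep' = ?L - (C - {u})" by (rule live_contract[OF D(2) C])
  have "class_matchings n ?ad ?rep' (mt n s4 ''Q'')"
  proof (rule class_matchings_contract[OF D(2,3,4) D(12) C B])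
    fix a b assume "a < n" "b < n" "s ''R'' a \<in> C"
    then show "mt n s4 ''Q'' a b = lift_mate (s ''R'') (mt n s ''Q'') (mt n s ''w'') (blossom_mate ?Tu ?Tx u x ?pos (s ''R'' a)) (s ''R'' a) a b"
      unfolding Q4 using s2(2) s1(2) by (simp add: C_def)
  next
    fix a b assume "a < n" "b < n" "s ''R'' a \<notin> C"
    then show "mt n s4 ''Q'' a b = mt n s ''Q'' a b" unfolding Q4 using s2(2) Q1 by simp
  qed auto
  then have cm: "class_matchings n ?ad (s4 ''R'') (mt n s4 ''Q'')" by (rule class_matchings_cong[rotated]) (rule R4)
  have M4: "s4 ''M'' v = (if v \<in> C then 0 else ?Tu v)" if "v \<in> live n ?rep'" for v
    using M3[OF live_lt(1)[OF that]] f4 by simp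
  have mm: "mate_on (live n (s4 ''R'')) (ladj n ?ad (s4 ''R'')) (s4 ''M'')"
    unfolding lv la by (rule mate_on_cong[OF _ mate_on_contract[OF D(2) C Tu(1) Cu]]) (rule M4)
  have "{v \<in> live n ?rep'. s4 ''M'' v = 0} = {v \<in> live n ?rep'. (if v \<in> C then 0 else ?Tu v) = 0}"
    using M4 by auto
  also have "\<dots> = {v \<in> ?L. ?Tu v = 0}" by (rule free_contract[OF D(2) C Cu])
  also have "card \<dots> = f" unfolding f u_def by (rule free_tree[OF D(5) finite_live D(6,8)])
  finally have fc: "card {v \<in> live n (s4 ''R''). s4 ''M'' v = 0} = f" unfolding lv .
  have fT: "f = card {v \<in> ?L. ?Tu v = 0}" unfolding f u_def by (rule free_tree[OF D(5) finite_live D(6,8), symmetric])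
  have br: "\<exists>A \<kappa>. barrier ?L ?la f A \<kappa>" if "barrier (live n (s4 ''R'')) (ladj n ?ad (s4 ''R'')) f A \<kappa>" for A \<kappa>
    by (rule barrier_contract[OF D(2) C Tu(1) Cu that[unfolded lv la] fT])
  have "live n (s4 ''R'') \<subset> ?L" unfolding lv L' using xC nux C by auto
  then have "card (live n (s4 ''R'')) < card ?L" by (intro psubset_card_mono) auto
  moreover have "rep_ok n (s4 ''R'')" by (rule rep_ok_cong[OF _ rep_ok_contract[OF D(2) C]]) (rule R4)
  ultimately show ?thesis using that r cm mm fc br fr4 by blast
qed

subsection \<open>Maximum matching\<close>

definition level_prog :: com where
  "level_prog = Seq witness_prog (Seq init_prog (Seq scan_prog (If (Less (N 0) (V ''e''))
     (If (Eq (Get ''o'' (V ''x'')) (Get ''o'' (V ''u''))) (Seq walk_prog contract_prog) augment_prog)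
     (Set ''g'' (N 2)))))"

definition phase_prog :: com where
  "phase_prog = Seq (Fill ''i'' ''n'' (Set ''t'' (V ''i'')) ''R'' (N 0) ''t'')
     (Seq (Fill ''i'' ''n'' (Set ''t'' (Get ''m'' (V ''i''))) ''M'' (N 0) ''t'')
     (Seq (Set ''g'' (N 0)) (While (Less (V ''g'') (N 1)) level_prog)))"

definition matching_prog :: com where
  "matching_prog = Seq (Set ''f'' (N 1)) (While (Less (N 0) (V ''f''))
     (Seq phase_prog (If (Less (N 1) (V ''g'')) (Set ''f'' (N 0)) Skip)))"

definition rows_prog :: com where
  "rows_prog = Seq (For ''i'' ''n'' (Put ''r'' (Plus (V ''i'') (N 1)) (Plus (Get ''r'' (V ''i'')) (V ''n''))))
     (Set ''h'' (Get ''r'' (V ''n'')))"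

definition output_prog :: com where
  "output_prog = For ''i'' ''n'' (If (Less (Plus (V ''i'') (N 1)) (Get ''m'' (V ''i'')))
     (Seq (Put ''out_fst'' (V ''out_len'') (V ''i''))
     (Seq (Put ''out_snd'' (V ''out_len'') (Minus (Get ''m'' (V ''i'')) (N 1)))
       (Put ''out_len'' (N 0) (Plus (V ''out_len'') (N 1))))) Skip)"

definition bob :: com where
  "bob = Seq rows_prog (Seq matching_prog output_prog)"

definition work_vars :: "vname set" where
  "work_vars = {''a'', ''b'', ''c'', ''d'', ''e'', ''f'', ''g'', ''i'', ''k'', ''l'', ''m'', ''o'', ''t'', ''u'', ''v'', ''w'',
     ''x'', ''y'', ''z'', ''C'', ''M'', ''P'', ''Q'', ''R'', ''S'', ''T''}"

lemma mods_level: "mods level_prog \<subseteq> work_vars - {''f''}"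
  by (auto simp: level_prog_def witness_prog_def init_prog_def scan_prog_def mods_scan_body walk_prog_def walk_body_def
    contract_prog_def mods_blossom_rows copy_rows_def clear_body_def merge_body_def augment_prog_def work_vars_def)

lemma mods_phase: "mods phase_prog \<subseteq> work_vars - {''f''}"
  using mods_level by (auto simp: phase_prog_def work_vars_def)

lemma work_ctx: "X \<subseteq> work_vars \<Longrightarrow> X \<inter> ctx_vars = {}"
  by (auto simp: work_vars_def ctx_vars_def)

text \<open>The last conjunct stands for the whole history of contractions: a barrier found at this
  level can be carried back to the uncontracted graph.\<close>

definition level_inv :: "nat \<Rightarrow> (nat \<times> nat) list \<Rightarrow> nat \<Rightarrow> state \<Rightarrow> bool" where
  "level_inv n es f s \<longleftrightarrow> bctx n es s \<and> rep_ok n (s ''R'')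
     \<and> class_matchings n (edge_rel (set es)) (s ''R'') (mt n s ''Q'')
     \<and> mate_on (live n (s ''R'')) (ladj n (edge_rel (set es)) (s ''R'')) (s ''M'')
     \<and> card {v \<in> live n (s ''R''). s ''M'' v = 0} = f
     \<and> ((\<exists>A \<kappa>. barrier (live n (s ''R'')) (ladj n (edge_rel (set es)) (s ''R'')) f A \<kappa>) \<longrightarrow>
        (\<exists>A \<kappa>. barrier {..<n} (edge_rel (set es)) f A \<kappa>))"

lemma level_runs:
  assumes W: "100 \<le> W" "n * n \<le> W" "length es \<le> W" and es: "proper_edges n es"
    and inv: "level_inv n es f s"
  obtains s' where "runs level_prog s (W ^ 40) s'"
    "level_inv n es f s' \<and> card (live n (s' ''R'')) < card (live n (s ''R'')) \<and> s' ''g'' = s ''g'' \<and> s' ''m'' = s ''m''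
     \<or> s' ''g'' 0 = 1 \<and> mate_on {..<n} (edge_rel (set es)) (s' ''m'') \<and> card {v \<in> {..<n}. s' ''m'' v = 0} + 2 = f
     \<or> s' ''g'' 0 = 2 \<and> s' ''m'' = s ''m'' \<and> (\<exists>A \<kappa>. barrier {..<n} (edge_rel (set es)) f A \<kappa>)"
proof -
  let ?ad = "edge_rel (set es)"
  let ?L = "live n (s ''R'')" and ?la = "ladj n ?ad (s ''R'')"
  have c: "bctx n es s" and rep: "rep_ok n (s ''R'')" and Q: "class_matchings n ?ad (s ''R'') (mt n s ''Q'')"
    and M: "mate_on ?L ?la (s ''M'')" and f: "card {v \<in> ?L. s ''M'' v = 0} = f"
    and br: "(\<exists>A \<kappa>. barrier ?L ?la f A \<kappa>) \<Longrightarrow> \<exists>A \<kappa>. barrier {..<n} ?ad f A \<kappa>"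
    using inv by (auto simp: level_inv_def)
  have nW: "n \<le> W" using W(2) by (cases n) auto
  have rn: "s ''R'' b < n" if "b < n" for b using rep that live_lt(1) by (auto simp: rep_ok_def)
  obtain s1 where s1: "runs witness_prog s (W ^ 8) s1" "witnesses n ?ad (s ''R'') (mt n s1 ''w'')"
    "frame {''i'', ''a'', ''b'', ''w'', ''t''} s s1"
    using witness_runs[OF W c es rn] by blast
  have c1: "bctx n es s1" by (rule bctx_frame[OF c s1(3)]) (simp add: ctx_vars_def)
  have f1: "s1 ''R'' = s ''R''" "s1 ''M'' = s ''M''" by (auto intro!: frameD[OF s1(3)])
  obtain s2 where s2: "runs init_prog s1 (W ^ 12) s2"
    "\<And>v. v < n \<Longrightarrow> s2 ''l'' v = (if s1 ''R'' v = v \<and> s1 ''M'' v = 0 then 1 else 0)"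
    "\<And>v. v < n \<Longrightarrow> s1 ''R'' v = v \<Longrightarrow> s1 ''M'' v = 0 \<Longrightarrow> s2 ''o'' v = v"
    "\<And>v b. v < n \<Longrightarrow> b < n \<Longrightarrow> mt n s2 ''T'' v b = s1 ''M'' b"
    "frame {''v'', ''i'', ''t'', ''l'', ''o'', ''T''} s1 s2"
    using init_runs[OF W(1) nW c1] by blast
  have c2: "bctx n es s2" by (rule bctx_frame[OF c1 s2(5)]) (simp add: ctx_vars_def)
  have f2: "s2 ''R'' = s ''R''" "s2 ''M'' = s ''M''" "s2 ''w'' = s1 ''w''"
    unfolding f1[symmetric] by (auto intro!: frameD[OF s2(5)])
  have w2: "mt n s2 ''w'' = mt n s1 ''w''" by (rule mt_cong) (rule f2)
  have sf: "state_forest n ?ad s2"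
    unfolding state_forest_def f2
  proof (intro conjI allI impI)
    show "forest ?L ?la (s ''M'') (s2 ''l'') (s2 ''o'') (mt n s2 ''T'')"
      by (rule forest_init[OF M]) (use s2(2-4) live_lt in \<open>auto simp: f1\<close>)
    fix v assume "v < n" "v \<notin> ?L"
    then show "s2 ''l'' v = 0" using s2(2) by (simp add: f1 live_def)
  qed
  obtain s3 where s3: "runs scan_prog s2 (W ^ 30) s3" "state_forest n ?ad s3"
    "s3 ''e'' 0 = 0 \<and> (\<forall>a<n. \<forall>b<n. s3 ''l'' a = 1 \<longrightarrow> mt n s3 ''w'' a b \<noteq> 0 \<longrightarrow> s3 ''l'' b = 2)
      \<or> s3 ''e'' 0 = 1 \<and> event n s3"
    "frame {''y'', ''l'', ''o'', ''i'', ''T'', ''t'', ''u'', ''x'', ''e''} s2 s3"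
    by (rule scan_runs[OF W(1,2) c2 _ _ sf]) (use rep s1(2) in \<open>simp_all add: f2 w2\<close>)
  have fr3: "frame {''i'', ''a'', ''b'', ''w'', ''t'', ''v'', ''l'', ''o'', ''T'', ''y'', ''u'', ''x'', ''e''} s s3"
  proof -
    have "frame {''i'', ''a'', ''b'', ''w'', ''t'', ''v'', ''l'', ''o'', ''T''} s s2"
      by (rule frame_trans[OF s1(3) s2(5)]) auto
    then show ?thesis by (rule frame_trans[OF _ s3(4)]) auto
  qed
  have c3: "bctx n es s3" by (rule bctx_frame[OF c fr3]) (simp add: ctx_vars_def)
  have f3: "s3 ''R'' = s ''R''" "s3 ''M'' = s ''M''" "s3 ''Q'' = s ''Q''" "s3 ''g'' = s ''g''" "s3 ''m'' = s ''m''"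
    by (auto intro!: frameD[OF fr3])
  have w3: "mt n s3 ''w'' = mt n s1 ''w''" unfolding w2[symmetric] by (rule mt_cong) (auto intro!: frameD[OF s3(4)])
  have Q3: "mt n s3 ''Q'' = mt n s ''Q''" by (rule mt_cong) (rule f3)
  have wit: "witnesses n ?ad (s3 ''R'') (mt n s3 ''w'')" using s1(2) by (simp add: f3 w3)
  let ?if = "If (Less (N 0) (V ''e''))
     (If (Eq (Get ''o'' (V ''x'')) (Get ''o'' (V ''u''))) (Seq walk_prog contract_prog) augment_prog) (Set ''g'' (N 2))"
  have fin: "runs level_prog s (W ^ 40) s'" if "runs ?if s3 (W ^ 28) s'" for s'
  proof -
    from runs_Seq[OF s3(1) that W(1), of 31] have "runs (Seq scan_prog ?if) s2 (W ^ 31) s'" by simp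
    from runs_Seq[OF s2(1) this W(1), of 32] have "runs (Seq init_prog (Seq scan_prog ?if)) s1 (W ^ 32) s'" by simp
    from runs_Seq[OF s1(1) this W(1), of 40] show ?thesis by (simp add: level_prog_def)
  qed
  from s3(3) show ?thesis
  proof (elim disjE conjE)
    assume e: "s3 ''e'' 0 = 0" and st: "\<forall>a<n. \<forall>b<n. s3 ''l'' a = 1 \<longrightarrow> mt n s3 ''w'' a b \<noteq> 0 \<longrightarrow> s3 ''l'' b = 2"
    define s4 where "s4 = run (Set ''g'' (N 2)) s3"
    have "runs (Set ''g'' (N 2)) s3 (W ^ 1) s4" unfolding s4_def using W by (intro runs_line) auto
    then have "runs ?if s3 (W ^ 28) s4" by (rule runs_If_False[rotated]) (use e W in auto)
    note r = fin[OF this]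
    have g: "s4 ''g'' 0 = 2" "s4 ''m'' = s ''m''" using f3 by (simp_all add: s4_def)
    have F: "forest ?L ?la (s ''M'') (s3 ''l'') (s3 ''o'') (mt n s3 ''T'')"
      using s3(2) by (simp add: state_forest_def f3)
    have "barrier ?L ?la (card {v \<in> ?L. s ''M'' v = 0}) {v \<in> ?L. s3 ''l'' v = 2} (\<lambda>v. if s3 ''l'' v = 1 then Suc v else 0)"
    proof (rule forest_stuck[OF F finite_live])
      fix a b assume a: "a \<in> ?L" "b \<in> ?L" "s3 ''l'' a = 1" "?la a b"
      then have "a < n" "b < n" using live_lt(1) by auto
      moreover from this a(4) have "mt n s3 ''w'' a b \<noteq> 0" using wit unfolding witnesses_def f3 by fastforce
      ultimately show "s3 ''l'' b = 2" using st a(3) by blast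
    qed (rule ladj_sym)
    then have "\<exists>A \<kappa>. barrier {..<n} ?ad f A \<kappa>" using br unfolding f by blast
    then show ?thesis using that[OF r] g by blast
  next
    assume e: "s3 ''e'' 0 = 1" and ev: "event n s3"
    have ok: "level_ok n es s3"
      unfolding level_ok_def using c3 es rep wit Q s3(2) ev by (simp add: f3 Q3)
    let ?if2 = "If (Eq (Get ''o'' (V ''x'')) (Get ''o'' (V ''u''))) (Seq walk_prog contract_prog) augment_prog"
    have fin2: "runs level_prog s (W ^ 40) s'" if "runs ?if2 s3 (W ^ 27) s'" for s'
      by (rule fin[OF runs_If_True[OF _ that W(1)]]) (use e in auto)
    show ?thesis
    proof (cases "s3 ''o'' (s3 ''x'' 0) = s3 ''o'' (s3 ''u'' 0)")
      case True
      obtain s4 k where s4: "runs walk_prog s3 (W ^ 9) s4"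
        "walk (live n (s3 ''R'')) (s3 ''l'') (s3 ''o'') (mt n s3 ''T'' (s3 ''u'' 0)) (mt n s3 ''T'' (s3 ''x'' 0)) (s3 ''u'' 0) (posf n s4) (s3 ''x'' 0) k"
        "frame {''i'', ''P'', ''t'', ''k'', ''c'', ''y''} s3 s4"
        using walk_runs[OF W(1,2) ok True] by blast
      have ok4: "level_ok n es s4" by (rule level_ok_frame[OF ok s4(3)]) (simp add: level_vars_def ctx_vars_def)
      have f4: "s4 ''R'' = s3 ''R''" "s4 ''l'' = s3 ''l''" "s4 ''o'' = s3 ''o''" "s4 ''T'' = s3 ''T''" "s4 ''u'' = s3 ''u''"
        "s4 ''x'' = s3 ''x''" "s4 ''M'' = s3 ''M''" "s4 ''g'' = s3 ''g''" "s4 ''m'' = s3 ''m''"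
        by (auto intro!: frameD[OF s4(3)])
      have T4: "mt n s4 ''T'' = mt n s3 ''T''" by (rule mt_cong) (rule f4)
      have wk: "walk (live n (s4 ''R'')) (s4 ''l'') (s4 ''o'') (mt n s4 ''T'' (s4 ''u'' 0)) (mt n s4 ''T'' (s4 ''x'' 0)) (s4 ''u'' 0) (posf n s4) (s4 ''x'' 0) k"
        using s4(2) unfolding f4 T4 .
      have fc: "f = card {v \<in> live n (s4 ''R''). s4 ''M'' v = 0}" using f by (simp add: f3 f4)
      obtain s5 where s5: "runs contract_prog s4 (W ^ 25) s5" "rep_ok n (s5 ''R'')"
        "class_matchings n ?ad (s5 ''R'') (mt n s5 ''Q'')"
        "mate_on (live n (s5 ''R'')) (ladj n ?ad (s5 ''R'')) (s5 ''M'')"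
        "card {v \<in> live n (s5 ''R''). s5 ''M'' v = 0} = f"
        "\<And>A \<kappa>. barrier (live n (s5 ''R'')) (ladj n ?ad (s5 ''R'')) f A \<kappa> \<Longrightarrow>
          \<exists>A \<kappa>. barrier (live n (s4 ''R'')) (ladj n ?ad (s4 ''R'')) f A \<kappa>"
        "card (live n (s5 ''R'')) < card (live n (s4 ''R''))"
        "frame {''c'', ''i'', ''C'', ''t'', ''a'', ''S'', ''y'', ''d'', ''z'', ''Q'', ''M'', ''R''} s4 s5"
        using contract_runs[OF W(1,2) ok4 wk fc] by blast
      have "runs (Seq walk_prog contract_prog) s3 (W ^ 26) s5" by (rule runs_Seq[OF s4(1) s5(1) W(1)]) auto
      from runs_If_True[OF _ this W(1)] have "runs ?if2 s3 (W ^ 27) s5" using True by simp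
      note r = fin2[OF this]
      have c5: "bctx n es s5" by (rule bctx_frame[OF level_okD(1)[OF ok4] s5(8)]) (simp add: ctx_vars_def)
      have "s5 ''g'' = s4 ''g''" "s5 ''m'' = s4 ''m''" by (auto intro!: frameD[OF s5(8)])
      then have gm: "s5 ''g'' = s ''g''" "s5 ''m'' = s ''m''" by (simp_all add: f3 f4)
      have "level_inv n es f s5"
        unfolding level_inv_def using c5 s5(2-6) br by (simp add: f3 f4) blast
      moreover have "card (live n (s5 ''R'')) < card ?L" using s5(7) by (simp add: f3 f4)
      ultimately show ?thesis using that[OF r] gm by blast
    next
      case False
      obtain s4 where s4: "runs augment_prog s3 (W ^ 12) s4" "mate_on {..<n} ?ad (s4 ''m'')"
        "card {v \<in> {..<n}. s4 ''m'' v = 0} + 2 = card {v \<in> live n (s3 ''R''). s3 ''M'' v = 0}" "s4 ''g'' 0 = 1"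
        by (rule augment_runs[OF W(1,2) ok False[symmetric]])
      from runs_If_False[OF _ s4(1) W(1)] have "runs ?if2 s3 (W ^ 27) s4" using False by simp
      note r = fin2[OF this]
      then show ?thesis using that[OF r] s4(2-4) f by (simp add: f3)
    qed
  qed
qed

lemma phase_runs:
  assumes W: "100 \<le> W" "n * n \<le> W" "length es \<le> W" and es: "proper_edges n es"
    and c: "bctx n es s" and m: "mate_on {..<n} (edge_rel (set es)) (s ''m'')"
    and f: "f = card {v \<in> {..<n}. s ''m'' v = 0}"
  obtains s' where "runs phase_prog s (W ^ 50) s'"
    "s' ''g'' 0 = 1 \<and> mate_on {..<n} (edge_rel (set es)) (s' ''m'') \<and> card {v \<in> {..<n}. s' ''m'' v = 0} + 2 = f
     \<or> s' ''g'' 0 = 2 \<and> s' ''m'' = s ''m'' \<and> (\<exists>A \<kappa>. barrier {..<n} (edge_rel (set es)) f A \<kappa>)"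
proof -
  let ?ad = "edge_rel (set es)"
  note cD = bctxD[OF c]
  have nW: "n \<le> W" using W(2) by (cases n) auto
  let ?B1 = "Set ''t'' (V ''i'')" and ?B2 = "Set ''t'' (Get ''m'' (V ''i''))"
  obtain s1 where s1: "runs (Fill ''i'' ''n'' ?B1 ''R'' (N 0) ''t'') s (W ^ 6) s1"
    "s1 ''R'' = (\<lambda>k. if 0 \<le> k \<and> k < 0 + s ''n'' 0 then k - 0 else s ''R'' k)"
    "frame (insert ''i'' (insert ''R'' (mods ?B1))) s s1"
    by (rule runs_Fill[where W = W and s = s and i = "''i''" and l = "''n''" and B = ?B1 and X = "''R''" and off = "N 0"
      and t = "''t''" and p = 0 and val = "\<lambda>k. k"]) (use W nW cD in auto)
  have fr1: "frame {''i'', ''R'', ''t''} s s1" by (rule frame_mono[OF s1(3)]) auto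
  have c1: "bctx n es s1" by (rule bctx_frame[OF c fr1]) (simp add: ctx_vars_def)
  have m1: "s1 ''m'' = s ''m''" by (auto intro!: frameD[OF fr1])
  have n1: "s1 ''n'' 0 \<le> W" using bctxD(1)[OF c1] nW by simp
  obtain s2 where s2: "runs (Fill ''i'' ''n'' ?B2 ''M'' (N 0) ''t'') s1 (W ^ 6) s2"
    "s2 ''M'' = (\<lambda>k. if 0 \<le> k \<and> k < 0 + s1 ''n'' 0 then s ''m'' (k - 0) else s1 ''M'' k)"
    "frame (insert ''i'' (insert ''M'' (mods ?B2))) s1 s2"
  proof (rule runs_Fill[where W = W and s = s1 and i = "''i''" and l = "''n''" and B = ?B2 and X = "''M''" and off = "N 0"
      and t = "''t''" and p = 0 and val = "s ''m''"])
    fix j v assume j: "v ''i'' 0 = j" and fv: "frame (insert ''i'' (insert ''M'' (mods ?B2))) s1 v"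
    have "v ''m'' = s1 ''m''" by (auto intro!: frameD[OF fv])
    then show "run ?B2 v ''t'' 0 = s ''m'' j" using j m1 by simp
  qed (use W n1 in auto)
  have fr2: "frame {''i'', ''R'', ''t'', ''M''} s s2" by (rule frame_trans[OF fr1 s2(3)]) auto
  define s3 where "s3 = run (Set ''g'' (N 0)) s2"
  have fr3: "frame {''i'', ''R'', ''t'', ''M'', ''g''} s s3" using fr2 by (auto simp: s3_def frame_def)
  have c3: "bctx n es s3" by (rule bctx_frame[OF c fr3]) (simp add: ctx_vars_def)
  have R2: "s2 ''R'' = s1 ''R''" by (auto intro!: frameD[OF s2(3)])
  have R3: "s3 ''R'' a = a" if "a < n" for a using that s1(2) cD by (simp add: s3_def R2)
  have M3: "s3 ''M'' a = s ''m'' a" if "a < n" for a using that s2(2) bctxD(1)[OF c1] by (simp add: s3_def)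
  have g3: "s3 ''g'' 0 = 0" "s3 ''m'' = s ''m''" using fr2 by (simp_all add: s3_def frame_def)
  have L: "live n (s3 ''R'') = {..<n}" using R3 by (auto simp: live_def)
  have irr: "\<not> ?ad a a" for a using edge_rel_irrefl[OF es] .
  have adn: "a < n \<and> b < n" if "?ad a b" for a b
    using that es by (auto simp: edge_rel_def proper_edges_set)
  have la: "ladj n ?ad (s3 ''R'') = ?ad"
  proof (intro ext iffI)
    fix a b assume "ladj n ?ad (s3 ''R'') a b"
    then show "?ad a b" using R3 by (auto simp: ladj_def)
  next
    fix a b assume ab: "?ad a b"
    moreover have "a \<noteq> b" using ab irr by auto
    ultimately show "ladj n ?ad (s3 ''R'') a b" using adn R3 unfolding ladj_def by blast
  qed
  have inv3: "level_inv n es f s3"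
    unfolding level_inv_def L la
  proof (intro conjI)
    show "rep_ok n (s3 ''R'')" using R3 L by (simp add: rep_ok_def)
    \<comment> \<open>All classes are singletons here, so the condition on \<open>Q\<close> is
      vacuous.\<close>
    show "class_matchings n ?ad (s3 ''R'') (mt n s3 ''Q'')" using R3 by (auto simp: class_matchings_def)
    show "mate_on {..<n} ?ad (s3 ''M'')" by (rule mate_on_cong[OF _ m]) (simp add: M3)
    have "{v \<in> {..<n}. s3 ''M'' v = 0} = {v \<in> {..<n}. s ''m'' v = 0}" using M3 by auto
    then show "card {v \<in> {..<n}. s3 ''M'' v = 0} = f" using f by simp
  qed (use c3 in auto)
  let ?b = "Less (V ''g'') (N 1)"
  let ?done = "\<lambda>t. t ''g'' 0 = 1 \<and> mate_on {..<n} ?ad (t ''m'') \<and> card {v \<in> {..<n}. t ''m'' v = 0} + 2 = f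
     \<or> t ''g'' 0 = 2 \<and> t ''m'' = s ''m'' \<and> (\<exists>A \<kappa>. barrier {..<n} ?ad f A \<kappa>)"
  let ?I = "\<lambda>t. level_inv n es f t \<and> t ''g'' 0 = 0 \<and> t ''m'' = s ''m'' \<or> ?done t"
  \<comment> \<open>The successor makes the measure drop also in the round that ends the
    phase.\<close>
  let ?\<mu> = "\<lambda>t. if t ''g'' 0 = 0 then Suc (card (live n (t ''R''))) else 0"
  obtain s4 where s4: "runs (While ?b level_prog) s3 (W ^ 45) s4" "?I s4" "\<not> bval ?b s4"
  proof (rule runs_While[of ?I s3 W ?\<mu> 2 40 45 level_prog ?b])
    show "?I s3" using inv3 g3 by blast
    have "Suc n \<le> 2 * W" using nW W(1) by simp
    also have "\<dots> \<le> W ^ 2" using W(1) by (simp add: power2_eq_square)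
    finally show "?\<mu> s3 \<le> W ^ 2" by (simp add: L)
  next
    fix t assume t: "?I t" "bval ?b t"
    then have g: "t ''g'' 0 = 0" by simp
    then have I: "level_inv n es f t" "t ''m'' = s ''m''" using t(1) by auto
    obtain t' where t': "runs level_prog t (W ^ 40) t'"
      "level_inv n es f t' \<and> card (live n (t' ''R'')) < card (live n (t ''R'')) \<and> t' ''g'' = t ''g'' \<and> t' ''m'' = t ''m''
       \<or> t' ''g'' 0 = 1 \<and> mate_on {..<n} ?ad (t' ''m'') \<and> card {v \<in> {..<n}. t' ''m'' v = 0} + 2 = f
       \<or> t' ''g'' 0 = 2 \<and> t' ''m'' = t ''m'' \<and> (\<exists>A \<kappa>. barrier {..<n} ?ad f A \<kappa>)"
      using level_runs[OF W es I(1)] by blast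
    have "?I t' \<and> ?\<mu> t' < ?\<mu> t" using t'(2) g I(2) by (elim disjE conjE) simp_all
    then show "\<exists>t'. runs level_prog t (W ^ 40) t' \<and> (frame (mods level_prog) t t' \<longrightarrow> ?I t' \<and> ?\<mu> t' < ?\<mu> t)"
      using t'(1) by blast
  qed (use W in auto)
  have r3: "runs (Set ''g'' (N 0)) s2 (W ^ 1) s3" unfolding s3_def using W by (intro runs_line) auto
  from runs_Seq[OF r3 s4(1) W(1), of 46]
  have "runs (Seq (Set ''g'' (N 0)) (While ?b level_prog)) s2 (W ^ 46) s4" by simp
  from runs_Seq[OF s2(1) this W(1), of 47]
  have "runs (Seq (Fill ''i'' ''n'' ?B2 ''M'' (N 0) ''t'') (Seq (Set ''g'' (N 0)) (While ?b level_prog))) s1 (W ^ 47) s4" by simp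
  from runs_Seq[OF s1(1) this W(1), of 50] have "runs phase_prog s (W ^ 50) s4" by (simp add: phase_prog_def)
  moreover have "?done s4" using s4(2,3) by auto
  ultimately show ?thesis using that by blast
qed

lemma matching_runs:
  assumes W: "100 \<le> W" "n * n \<le> W" "length es \<le> W" and es: "proper_edges n es"
    and c: "bctx n es s" and m: "\<And>v. s ''m'' v = 0"
  obtains s' A \<kappa> where "runs matching_prog s (W ^ 60) s'" "mate_on {..<n} (edge_rel (set es)) (s' ''m'')"
    "barrier {..<n} (edge_rel (set es)) (card {v \<in> {..<n}. s' ''m'' v = 0}) A \<kappa>" "frame work_vars s s'"
proof -
  let ?ad = "edge_rel (set es)"
  have nW: "n \<le> W" using W(2) by (cases n) auto
  define s1 where "s1 = run (Set ''f'' (N 1)) s"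
  have fr1: "frame {''f''} s s1" by (auto simp: s1_def frame_def)
  have c1: "bctx n es s1" by (rule bctx_frame[OF c fr1]) (simp add: ctx_vars_def)
  let ?free = "\<lambda>t. card {v \<in> {..<n}. t ''m'' v = 0}"
  let ?I = "\<lambda>t. bctx n es t \<and> mate_on {..<n} ?ad (t ''m'') \<and>
    (t ''f'' 0 = 1 \<or> t ''f'' 0 = 0 \<and> (\<exists>A \<kappa>. barrier {..<n} ?ad (?free t) A \<kappa>))"
  let ?b = "Less (N 0) (V ''f'')"
  let ?if = "If (Less (N 1) (V ''g'')) (Set ''f'' (N 0)) Skip"
  let ?c = "Seq phase_prog ?if"
  obtain s2 where s2: "runs (While ?b ?c) s1 (W ^ 58) s2" "?I s2" "\<not> bval ?b s2" "frame (mods ?c) s1 s2"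
  \<comment> \<open>An augmentation removes two free vertices; the final phase keeps the matching
    and lowers the flag \<open>f\<close>.\<close>
  proof (rule runs_While[of ?I s1 W "\<lambda>t. ?free t + t ''f'' 0" 2 52 58 ?c ?b])
    show "?I s1" using c1 m by (auto simp: s1_def mate_on_def)
    have "?free s1 \<le> n" using card_mono[of "{..<n}" "{v \<in> {..<n}. s1 ''m'' v = 0}"] by auto
    then have "?free s1 + s1 ''f'' 0 \<le> 2 * W" using nW W(1) by (simp add: s1_def)
    also have "\<dots> \<le> W ^ 2" using W(1) by (simp add: power2_eq_square)
    finally show "?free s1 + s1 ''f'' 0 \<le> W ^ 2" .
  next
    fix t assume t: "?I t" "bval ?b t"
    then have ct: "bctx n es t" and mt: "mate_on {..<n} ?ad (t ''m'')" and f1: "t ''f'' 0 = 1" by auto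
    obtain t1 where t1: "runs phase_prog t (W ^ 50) t1"
      "t1 ''g'' 0 = 1 \<and> mate_on {..<n} ?ad (t1 ''m'') \<and> ?free t1 + 2 = ?free t
       \<or> t1 ''g'' 0 = 2 \<and> t1 ''m'' = t ''m'' \<and> (\<exists>A \<kappa>. barrier {..<n} ?ad (?free t) A \<kappa>)"
      using phase_runs[OF W es ct mt refl] by blast
    have frt: "frame (work_vars - {''f''}) t t1" by (rule frame_mono[OF runs_frame[OF t1(1)] mods_phase])
    have ct1: "bctx n es t1" by (rule bctx_frame[OF ct frt]) (rule work_ctx, auto)
    have ft1: "t1 ''f'' = t ''f''" by (rule frameD[OF frt]) simp
    define t2 where "t2 = run ?if t1"
    have "runs ?if t1 (W ^ 1) t2" unfolding t2_def using W by (intro runs_line) auto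
    from runs_Seq[OF t1(1) this W(1), of 52] have r: "runs ?c t (W ^ 52) t2" by simp
    have "frame {''f''} t1 t2" by (auto simp: t2_def frame_def)
    then have ct2: "bctx n es t2" by (rule bctx_frame[OF ct1]) (simp add: ctx_vars_def)
    have t2: "t2 ''m'' = t1 ''m''" "t2 ''f'' 0 = (if 1 < t1 ''g'' 0 then 0 else t1 ''f'' 0)" by (auto simp: t2_def)
    have "?I t2 \<and> ?free t2 + t2 ''f'' 0 < ?free t + t ''f'' 0"
      using t1(2) ct2 mt f1 ft1 unfolding t2 by (elim disjE conjE) simp_all
    then show "\<exists>t'. runs ?c t (W ^ 52) t' \<and> (frame (mods ?c) t t' \<longrightarrow> ?I t' \<and> ?free t' + t' ''f'' 0 < ?free t + t ''f'' 0)"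
      using r by blast
  qed (use W in auto)
  have "runs (Set ''f'' (N 1)) s (W ^ 1) s1" unfolding s1_def using W by (intro runs_line) auto
  from runs_Seq[OF this s2(1) W(1), of 60] have r: "runs matching_prog s (W ^ 60) s2" by (simp add: matching_prog_def)
  have "frame work_vars s s2"
  proof (rule frame_trans[OF fr1 s2(4)])
    have f: "''f'' \<in> work_vars" by (simp add: work_vars_def)
    then show "{''f''} \<subseteq> work_vars" by simp
    show "mods ?c \<subseteq> work_vars" using mods_phase f by auto
  qed
  then show ?thesis using that[OF r] s2(2,3) by auto
qed

lemma rows_runs:
  assumes W: "100 \<le> W" "n \<le> W" and n: "s ''n'' 0 = n" and r: "s ''r'' 0 = 0"
  obtains s' where "runs rows_prog s (W ^ 8) s'" "s' ''h'' 0 = n * n" "\<And>a. a \<le> n \<Longrightarrow> s' ''r'' a = a * n"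
    "frame {''i'', ''r'', ''h''} s s'"
proof -
  let ?c = "Put ''r'' (Plus (V ''i'') (N 1)) (Plus (Get ''r'' (V ''i'')) (V ''n''))"
  let ?J = "\<lambda>j t. \<forall>a\<le>j. t ''r'' a = a * n"
  obtain s1 where s1: "runs (For ''i'' ''n'' ?c) s (W ^ 6) s1" "?J (s ''n'' 0) s1" "frame (insert ''i'' (mods ?c)) s s1"
  proof (rule runs_For[of W s "''n''" "''i''" ?c 1 6 ?J])
    fix j t assume t: "j < s ''n'' 0" "t ''i'' 0 = j" "frame (insert ''i'' (mods ?c)) s t" "?J j t"
    have nt: "t ''n'' 0 = n" using frameD[OF t(3)] n by simp
    have "runs ?c t (W ^ 1) (run ?c t)" using W by (intro runs_line) auto
    moreover have "?J (Suc j) ((run ?c t)(''i'' := (run ?c t ''i'')(0 := Suc j)))"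
      using t(2,4) nt by (auto simp: le_Suc_eq)
    ultimately show "\<exists>t'. runs ?c t (W ^ 1) t' \<and> (frame (mods ?c) t t' \<longrightarrow> ?J (Suc j) (t'(''i'' := (t' ''i'')(0 := Suc j))))"
      by blast
  qed (use W n r in auto)
  define s2 where "s2 = run (Set ''h'' (Get ''r'' (V ''n''))) s1"
  have n1: "s1 ''n'' 0 = n" using frameD[OF s1(3)] n by simp
  have "runs (Set ''h'' (Get ''r'' (V ''n''))) s1 (W ^ 1) s2" unfolding s2_def using W by (intro runs_line) auto
  from runs_Seq[OF s1(1) this W(1), of 8] have "runs rows_prog s (W ^ 8) s2" by (simp add: rows_prog_def)
  moreover have "s2 ''h'' 0 = n * n" "\<And>a. a \<le> n \<Longrightarrow> s2 ''r'' a = a * n" using s1(2) n n1 by (auto simp: s2_def)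
  moreover have "frame {''i'', ''r'', ''h''} s s2" using s1(3) by (auto simp: s2_def frame_def)
  ultimately show ?thesis using that by blast
qed

lemma output_runs:
  assumes W: "100 \<le> W" "n \<le> W" and n: "s ''n'' 0 = n" and z: "s ''out_len'' 0 = 0"
  obtains s' where "runs output_prog s (W ^ 6) s'"
    "load_edges ''out'' s' = map (\<lambda>v. (v, s ''m'' v - 1)) (filter (\<lambda>v. Suc v < s ''m'' v) [0..<n])"
proof -
  let ?c = "If (Less (Plus (V ''i'') (N 1)) (Get ''m'' (V ''i'')))
     (Seq (Put ''out_fst'' (V ''out_len'') (V ''i''))
     (Seq (Put ''out_snd'' (V ''out_len'') (Minus (Get ''m'' (V ''i'')) (N 1)))
       (Put ''out_len'' (N 0) (Plus (V ''out_len'') (N 1))))) Skip"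
  let ?J = "\<lambda>j t. load_edges ''out'' t = map (\<lambda>v. (v, s ''m'' v - 1)) (filter (\<lambda>v. Suc v < s ''m'' v) [0..<j])"
  obtain s' where "runs (For ''i'' ''n'' ?c) s (W ^ 6) s'" "?J (s ''n'' 0) s'"
  proof (rule runs_For[of W s "''n''" "''i''" ?c 1 6 ?J])
    show "?J 0 (s(''i'' := (s ''i'')(0 := 0)))" using z by (simp add: load_edges_def)
  next
    fix j t assume t: "j < s ''n'' 0" "t ''i'' 0 = j" "frame (insert ''i'' (mods ?c)) s t" "?J j t"
    have f: "t ''m'' = s ''m''" by (rule frameD[OF t(3)]) simp
    let ?t' = "(run ?c t)(''i'' := (run ?c t ''i'')(0 := Suc j))"
    have "?J (Suc j) ?t'"
    proof (cases "Suc j < s ''m'' j")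
      case True
      have "load_edges ''out'' ?t' = load_edges ''out'' t @ [(j, s ''m'' j - 1)]"
        by (rule load_edges_push) (use True f t(2) in auto)
      then show ?thesis using t(4) True by simp
    next
      case False
      have "load_edges ''out'' ?t' = load_edges ''out'' t"
        by (rule load_edges_cong) (use False f t(2) in auto)
      then show ?thesis using t(4) False by simp
    qed
    moreover have "runs ?c t (W ^ 1) (run ?c t)" using W by (intro runs_line) auto
    ultimately show "\<exists>t'. runs ?c t (W ^ 1) t' \<and> (frame (mods ?c) t t' \<longrightarrow> ?J (Suc j) (t'(''i'' := (t' ''i'')(0 := Suc j))))"
      by blast
  qed (use W n in auto)
  then show ?thesis using that n by (auto simp: output_prog_def)
qed

lemma bob_runs:
  assumes W: "100 \<le> W" "n * n \<le> W" "length bs + length msg \<le> W" and es: "proper_edges n (bs @ msg)"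
  obtains s' m A \<kappa> where "runs bob (bob_input n p q bs msg) (W ^ 70) s'"
    "load_edges ''out'' s' = map (\<lambda>v. (v, m v - 1)) (filter (\<lambda>v. Suc v < m v) [0..<n])"
    "mate_on {..<n} (edge_rel (set (bs @ msg))) m"
    "barrier {..<n} (edge_rel (set (bs @ msg))) (card {v \<in> {..<n}. m v = 0}) A \<kappa>"
proof -
  let ?s = "bob_input n p q bs msg" and ?es = "bs @ msg"
  have nW: "n \<le> W" using W(2) by (cases n) auto
  have in0: "?s ''n'' 0 = n" "?s ''r'' 0 = 0" "?s ''out_len'' 0 = 0" "\<And>v. ?s ''m'' v = 0"
    by (simp_all add: bob_input_def store_edges_def store_def)
  have ld: "load_edges ''edges'' ?s = bs" "load_edges ''msg'' ?s = msg"
    by (auto simp: bob_input_def store_edges_def store_def load_edges_def intro!: nth_equalityI)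
  obtain s1 where s1: "runs rows_prog ?s (W ^ 8) s1" "s1 ''h'' 0 = n * n" "\<And>a. a \<le> n \<Longrightarrow> s1 ''r'' a = a * n"
    "frame {''i'', ''r'', ''h''} ?s s1"
    using rows_runs[of W n ?s, OF W(1) nW in0(1,2)] by blast
  have f1: "s1 ''n'' 0 = n" "s1 ''out_len'' 0 = 0" "\<And>v. s1 ''m'' v = 0"
    "load_edges ''edges'' s1 = load_edges ''edges'' ?s" "load_edges ''msg'' s1 = load_edges ''msg'' ?s"
    using s1(4) in0 by (simp_all add: frame_def load_edges_def)
  have c1: "bctx n ?es s1" using f1 s1(2,3) ld by (simp add: bctx_def)
  obtain s2 A \<kappa> where s2: "runs matching_prog s1 (W ^ 60) s2" "mate_on {..<n} (edge_rel (set ?es)) (s2 ''m'')"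
    "barrier {..<n} (edge_rel (set ?es)) (card {v \<in> {..<n}. s2 ''m'' v = 0}) A \<kappa>" "frame work_vars s1 s2"
    by (rule matching_runs[OF W(1,2) _ es c1 f1(3)]) (use W(3) in auto)
  have f2: "s2 ''n'' = s1 ''n''" "s2 ''out_len'' = s1 ''out_len''"
    by (rule frameD[OF s2(4)], simp add: work_vars_def)+
  obtain s3 where s3: "runs output_prog s2 (W ^ 6) s3"
    "load_edges ''out'' s3 = map (\<lambda>v. (v, s2 ''m'' v - 1)) (filter (\<lambda>v. Suc v < s2 ''m'' v) [0..<n])"
    by (rule output_runs[of W n s2]) (use W nW f1 f2 in auto)
  from runs_Seq[OF s2(1) s3(1) W(1), of 61] have "runs (Seq matching_prog output_prog) s1 (W ^ 61) s3" by simp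
  from runs_Seq[OF s1(1) this W(1), of 70] have "runs bob ?s (W ^ 70) s3" by (simp add: bob_def)
  then show ?thesis using that s3(2) s2(2,3) by blast
qed

subsection \<open>The protocol\<close>

lemma edge_rel_edge_set: "edge_rel (set es) a b \<longleftrightarrow> {a, b} \<in> edge_set es"
  by (auto simp: edge_rel_def edge_set_def doubleton_eq_iff image_iff)

lemma edge_set_append: "edge_set (xs @ ys) = edge_set xs \<union> edge_set ys"
  by (auto simp: edge_set_def)

lemma valid_proper:
  assumes "valid_input n p q es E"
  shows "proper_edges n es"
  unfolding proper_edges_set
proof
  fix e assume e: "e \<in> set es"
  obtain u v where uv: "e = (u, v)" by force
  have "{u, v} \<in> E" using assms e uv by (force simp: valid_input_def edge_list_of_def edge_set_def)
  then obtain a b where "{u, v} = {a, b}" "a < n" "b < n" "a \<noteq> b"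
    using assms unfolding valid_input_def simple_graph_def by blast
  then show "fst e < n \<and> snd e < n \<and> fst e \<noteq> snd e" using uv by (auto simp: doubleton_eq_iff)
qed

definition nth_edge :: "(nat \<times> nat) list \<Rightarrow> nat \<Rightarrow> nat set" where
  "nth_edge es j = {fst (es ! j), snd (es ! j)}"

lemma nth_edge_inj:
  assumes "distinct (map (\<lambda>(u, v). {u, v}) es)"
  shows "inj_on (nth_edge es) {..<length es}"
proof (rule inj_onI)
  fix i j assume ij: "i \<in> {..<length es}" "j \<in> {..<length es}" and eq: "nth_edge es i = nth_edge es j"
  have "map (\<lambda>(u, v). {u, v}) es ! i = map (\<lambda>(u, v). {u, v}) es ! j"
    using ij eq by (simp add: nth_edge_def case_prod_beta)
  then show "i = j" using nth_eq_iff_index_eq[OF assms] ij by (metis length_map lessThan_iff)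
qed

lemma edge_set_nth: "edge_set es = nth_edge es ` {..<length es}"
proof -
  have "set es = (!) es ` {..<length es}" by (auto simp: set_conv_nth)
  then show ?thesis by (simp add: edge_set_def nth_edge_def image_image case_prod_beta)
qed

lemma deg_card:
  assumes "distinct (map (\<lambda>(u, v). {u, v}) es)" "I \<subseteq> {..<length es}"
  shows "deg es I v = card {e \<in> nth_edge es ` I. v \<in> e}"
proof -
  have "{e \<in> nth_edge es ` I. v \<in> e} = nth_edge es ` {j \<in> I. v = fst (es ! j) \<or> v = snd (es ! j)}"
    by (auto simp: nth_edge_def)
  moreover have "inj_on (nth_edge es) {j \<in> I. v = fst (es ! j) \<or> v = snd (es ! j)}"
    by (rule inj_on_subset[OF nth_edge_inj[OF assms(1)]]) (use assms(2) in auto)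
  ultimately show ?thesis by (simp add: deg_def card_image)
qed

text \<open>Different edges at \<open>v\<close> have different other ends. The resulting bound
  \<open>2 * n\<close> on degree sums makes a large \<beta> force every edge into the
  subgraph.\<close>

lemma deg_le:
  assumes d: "distinct (map (\<lambda>(u, v). {u, v}) es)" and es: "proper_edges n es" and I: "I \<subseteq> {..<length es}"
  shows "deg es I v \<le> n"
proof -
  let ?J = "{j \<in> I. v = fst (es ! j) \<or> v = snd (es ! j)}"
  let ?g = "\<lambda>j. if v = fst (es ! j) then snd (es ! j) else fst (es ! j)"
  have "inj_on ?g ?J"
  proof (rule inj_onI)
    fix i j assume i: "i \<in> ?J" and j: "j \<in> ?J" and eq: "?g i = ?g j"
    have "nth_edge es i = {v, ?g i}" "nth_edge es j = {v, ?g j}" using i j by (auto simp: nth_edge_def)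
    then have "nth_edge es i = nth_edge es j" using eq by simp
    then show "i = j" using inj_onD[OF nth_edge_inj[OF d]] i j I by blast
  qed
  moreover have "?g ` ?J \<subseteq> {..<n}" using es I by (auto simp: proper_edges_def)
  ultimately have "card ?J \<le> card {..<n}" by (rule card_inj_on_le) simp
  then show ?thesis by (simp add: deg_def)
qed

section \<open>Mate functions and sets of edges\<close>

lemma card_matched:
  assumes m: "mate_on {..<n} a m"
  shows "n = card {v \<in> {..<n}. m v = 0} + 2 * card {v \<in> {..<n}. Suc v < m v}"
proof -
  let ?F = "{v \<in> {..<n}. m v = 0}" and ?U = "{v \<in> {..<n}. Suc v < m v}" and ?D = "{v \<in> {..<n}. m v \<noteq> 0 \<and> m v < Suc v}"
  have "bij_betw (\<lambda>v. m v - 1) ?U ?D"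
  proof (rule bij_betw_byWitness[where f' = "\<lambda>v. m v - 1"])
    have 1: "m v - 1 < n \<and> m (m v - 1) = Suc v" if "v < n" "m v \<noteq> 0" for v
    proof -
      obtain y where y: "m v = Suc y" using \<open>m v \<noteq> 0\<close> not0_implies_Suc by blast
      show ?thesis using mate_onD[OF m _ y] that y by auto
    qed
    show "\<forall>v\<in>?U. m (m v - 1) - 1 = v" "\<forall>v\<in>?D. m (m v - 1) - 1 = v" using 1 by auto
    show "(\<lambda>v. m v - 1) ` ?U \<subseteq> ?D"
    proof
      fix w assume "w \<in> (\<lambda>v. m v - 1) ` ?U"
      then obtain v where "v < n" "Suc v < m v" "w = m v - 1" by auto
      then show "w \<in> ?D" using 1[of v] by auto
    qed
    show "(\<lambda>v. m v - 1) ` ?D \<subseteq> ?U"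
    proof
      fix w assume "w \<in> (\<lambda>v. m v - 1) ` ?D"
      then obtain v where "v < n" "m v \<noteq> 0" "m v < Suc v" "w = m v - 1" by auto
      then show "w \<in> ?U" using 1[of v] by auto
    qed
  qed
  then have UD: "card ?U = card ?D" by (rule bij_betw_same_card)
  have "m v \<noteq> Suc v" if "v < n" for v using mate_onD(2)[OF m, of v v] that by auto
  then have "{..<n} = ?F \<union> (?U \<union> ?D)" using linorder_less_linear by fastforce
  then have "n = card (?F \<union> (?U \<union> ?D))" by (metis card_lessThan)
  also have "\<dots> = card ?F + (card ?U + card ?D)" by (subst card_Un_disjoint; auto)+
  finally show ?thesis using UD by simp
qed

lemma matching_mate:
  assumes sg: "E \<subseteq> {{u, v} | u v. u < n \<and> v < n \<and> u \<noteq> v}" and M: "matching E M"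
  obtains m where "mate_on {..<n} (\<lambda>x y. {x, y} \<in> E) m" "card {v \<in> {..<n}. m v = 0} + 2 * card M = n"
proof -
  have ME: "M \<subseteq> E" and disj: "\<And>e f. e \<in> M \<Longrightarrow> f \<in> M \<Longrightarrow> e \<noteq> f \<Longrightarrow> e \<inter> f = {}"
    using M by (auto simp: matching_def)
  have uniq: "w = w'" if "{v, w} \<in> M" "{v, w'} \<in> M" for v w w'
  proof -
    have "{v, w} = {v, w'}" using disj[OF that] by auto
    then show ?thesis by (auto simp: doubleton_eq_iff)
  qed
  have lt: "v < n \<and> w < n \<and> v \<noteq> w" if "{v, w} \<in> M" for v w
  proof -
    have "{v, w} \<in> E" using ME that by blast
    then obtain a b where "{v, w} = {a, b}" "a < n" "b < n" "a \<noteq> b" using sg by blast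
    then show ?thesis by (auto simp: doubleton_eq_iff)
  qed
  define m where "m v = (if \<exists>w. {v, w} \<in> M then Suc (THE w. {v, w} \<in> M) else 0)" for v
  have mS: "m v = Suc w \<longleftrightarrow> {v, w} \<in> M" for v w
  proof
    assume vw: "{v, w} \<in> M"
    have "(THE w. {v, w} \<in> M) = w" by (rule the_equality) (rule vw, rule uniq[OF _ vw])
    then show "m v = Suc w" unfolding m_def using vw by auto
  next
    assume a: "m v = Suc w"
    then obtain w' where w': "{v, w'} \<in> M" unfolding m_def by (auto split: if_splits)
    have "(THE w. {v, w} \<in> M) = w'" by (rule the_equality) (rule w', rule uniq[OF _ w'])
    then have "m v = Suc w'" unfolding m_def using w' by auto
    then show "{v, w} \<in> M" using a w' by simp
  qed
  have mate: "mate_on {..<n} (\<lambda>x y. {x, y} \<in> E) m"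
    unfolding mate_on_def mS
  proof (intro ballI allI impI)
    fix x y assume xy: "{x, y} \<in> M"
    then show "y \<in> {..<n} \<and> y \<noteq> x \<and> {x, y} \<in> E \<and> {y, x} \<in> M"
      using lt[OF xy] ME by (auto simp: insert_commute)
  qed
  have "bij_betw (\<lambda>v. {v, m v - 1}) {v \<in> {..<n}. Suc v < m v} M"
    unfolding bij_betw_def
  proof (intro conjI equalityI subsetI)
    show "inj_on (\<lambda>v. {v, m v - 1}) {v \<in> {..<n}. Suc v < m v}"
      by (rule inj_onI) (auto simp: doubleton_eq_iff)
    fix e assume "e \<in> (\<lambda>v. {v, m v - 1}) ` {v \<in> {..<n}. Suc v < m v}"
    then obtain v where v: "Suc v < m v" "e = {v, m v - 1}" by auto
    then have "m v = Suc (m v - 1)" by simp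
    then have "{v, m v - 1} \<in> M" unfolding mS .
    then show "e \<in> M" using v by simp
  next
    fix e assume e: "e \<in> M"
    then obtain u v where uv: "e = {u, v}" using ME sg by blast
    define a b where "a = min u v" and "b = max u v"
    have ab: "{a, b} \<in> M" using e uv by (auto simp: a_def b_def min_def max_def insert_commute)
    have "a < b" using lt[OF e[unfolded uv]] by (auto simp: a_def b_def)
    moreover have mab: "m a = Suc b" using ab unfolding mS .
    ultimately have "a \<in> {v \<in> {..<n}. Suc v < m v}" using lt[OF ab] by simp
    moreover have "e = {a, m a - 1}" using uv unfolding mab by (auto simp: a_def b_def min_def max_def)
    ultimately show "e \<in> (\<lambda>v. {v, m v - 1}) ` {v \<in> {..<n}. Suc v < m v}" by (rule rev_image_eqI)
  qed
  then have "card {v \<in> {..<n}. Suc v < m v} = card M" by (rule bij_betw_same_card)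
  then show ?thesis using that[OF mate] card_matched[OF mate] by simp
qed

lemma max_matching_exists:
  assumes sg: "E \<subseteq> {{u, v} | u v. u < n \<and> v < n \<and> u \<noteq> v}"
  obtains M where "matching E M" "card M = max_matching_size E"
proof -
  have "{{u, v} | u v. u < n \<and> v < n \<and> u \<noteq> v} \<subseteq> Pow {..<n}" by auto
  then have "finite E" using sg finite_subset[of E "Pow {..<n}"] by auto
  then have "finite {M. matching E M}"
    by (rule_tac finite_subset[of _ "Pow E"]) (auto simp: matching_def)
  moreover have "matching E {}" by (simp add: matching_def)
  ultimately have "Max (card ` {M. matching E M}) \<in> card ` {M. matching E M}"
    by (intro Max_in) auto
  then show ?thesis using that by (auto simp: max_matching_size_def)
qed

text \<open>The condition \<open>Suc v < m v\<close> selects the smaller end of each matching edge,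
  so no edge is listed twice.\<close>

lemma mate_output:
  assumes m: "mate_on {..<n} (edge_rel (set es)) m"
  defines "out \<equiv> map (\<lambda>v. (v, m v - 1)) (filter (\<lambda>v. Suc v < m v) [0..<n])"
  shows "edge_list_of out (edge_set out)" "matching (edge_set es) (edge_set out)"
    "card {v \<in> {..<n}. m v = 0} + 2 * card (edge_set out) = n"
proof -
  let ?U = "{v \<in> {..<n}. Suc v < m v}"
  let ?e = "\<lambda>v. {v, m v - 1}"
  have eo: "edge_set out = ?e ` ?U" by (auto simp: edge_set_def out_def image_image)
  have inj: "inj_on ?e ?U" by (rule inj_onI) (auto simp: doubleton_eq_iff)
  have mo: "map (\<lambda>(u, v). {u, v}) out = map ?e (filter (\<lambda>v. Suc v < m v) [0..<n])"
    by (simp add: out_def)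
  have "distinct (map ?e (filter (\<lambda>v. Suc v < m v) [0..<n]))"
    unfolding distinct_map by (intro conjI inj_on_subset[OF inj]) auto
  then show "edge_list_of out (edge_set out)" by (simp add: edge_list_of_def mo)
  show "card {v \<in> {..<n}. m v = 0} + 2 * card (edge_set out) = n"
    unfolding eo card_image[OF inj] using card_matched[OF m] by simp
  have mate: "{v, m v - 1} \<in> edge_set es \<and> m (m v - 1) = Suc v" if "v \<in> ?U" for v
  proof -
    have v: "v \<in> {..<n}" "m v = Suc (m v - 1)" using that by auto
    show ?thesis using mate_onD(3,4)[OF m v] by (simp add: edge_rel_edge_set)
  qed
  show "matching (edge_set es) (edge_set out)"
    unfolding matching_def
  proof (intro conjI ballI impI)
    show "edge_set out \<subseteq> edge_set es" unfolding eo using mate by auto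
    fix e f assume "e \<in> edge_set out" "f \<in> edge_set out" and ne: "e \<noteq> f"
    then obtain v w where v: "v \<in> ?U" "e = ?e v" and w: "w \<in> ?U" "f = ?e w" unfolding eo by auto
    show "e \<inter> f = {}"
    proof (rule ccontr)
      assume "e \<inter> f \<noteq> {}"
      then obtain a where "a \<in> e" "a \<in> f" by auto
      then consider "v = w" | "v = m w - 1" | "m v - 1 = w" | "m v - 1 = m w - 1" using v w by auto
      then show False
      proof cases
        case 1 then show False using ne v w by simp
      next
        case 2 then show False using mate[OF w(1)] v(1) w(1) by auto
      next
        case 3 then show False using mate[OF v(1)] v(1) w(1) by auto
      next
        case 4
        then have "v = w" using mate[OF v(1)] mate[OF w(1)] by simp
        then show False using ne v w by simp
      qed
    qed
  qed
qed

text \<open>By determinism any run of Alice ends in the state of the run constructed in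
  \<open>alice_runs\<close>; of the time bound proved there only the existence of a halting run is
  used.\<close>

lemma alice_message:
  assumes v: "valid_input n p q as EA" and e: "exec alice (alice_input n p q as) t s"
  obtains I k where "load_edges ''out'' s = map ((!) as) (filter (\<lambda>j. j \<in> I) [0..<length as])"
    "I \<subseteq> {..<length as}" "\<And>j. j < length as \<Longrightarrow> edge_constrained (k + 32) as I j"
    "k \<le> 2 * n" "3 * q \<le> k * p \<or> k = 2 * n" "k * p < 3 * q + p"
proof -
  let ?W = "2 * n + length as + 100"
  have "0 < p" using v by (simp add: valid_input_def)
  then obtain s' I k where *: "runs alice (alice_input n p q as) (?W ^ 12) s'"
    "load_edges ''out'' s' = map ((!) as) (filter (\<lambda>j. j \<in> I) [0..<length as])"
    "I \<subseteq> {..<length as}" "\<And>j. j < length as \<Longrightarrow> edge_constrained (k + 32) as I j"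
    "k \<le> 2 * n" "3 * q \<le> k * p \<or> k = 2 * n" "k * p < 3 * q + p"
    using alice_runs[of ?W n as p q] valid_proper[OF v] by auto
  then have "s' = s" using exec_deterministic[OF e] by (auto simp: runs_def)
  then show ?thesis using that * by blast
qed

lemma message_edges:
  assumes I: "I \<subseteq> {..<length as}" and msg: "msg = map ((!) as) (filter (\<lambda>j. j \<in> I) [0..<length as])"
  shows "edge_set msg = nth_edge as ` I" "length msg = card I" "set msg \<subseteq> set as"
proof -
  have s: "set (filter (\<lambda>j. j \<in> I) [0..<length as]) = I" using I by auto
  have "set msg = (!) as ` I" unfolding msg set_map s ..
  then show "edge_set msg = nth_edge as ` I" "set msg \<subseteq> set as"
    using I by (auto simp: edge_set_def nth_edge_def image_image case_prod_beta)
  show "length msg = card I" unfolding msg length_map by (metis s distinct_card distinct_filter distinct_upt)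
qed

lemma degree_le_beta:
  assumes "I \<subseteq> {..<length es}" "\<And>j. j < length es \<Longrightarrow> edge_constrained \<beta> es I j"
  shows "deg es I v \<le> \<beta>"
proof (cases "{j \<in> I. v = fst (es ! j) \<or> v = snd (es ! j)} = {}")
  case True
  then show ?thesis by (simp only: deg_def) simp
next
  case False
  then obtain j where j: "j \<in> I" "v = fst (es ! j) \<or> v = snd (es ! j)" by blast
  then have "deg es I (fst (es ! j)) + deg es I (snd (es ! j)) \<le> \<beta>"
    using assms by (auto simp: edge_constrained_def)
  then show ?thesis using j by auto
qed

lemma bob_exec:
  assumes W: "100 \<le> W" "n * n \<le> W" "length bs + length msg \<le> W"
    and vB: "valid_input n p q bs EB" and msg: "proper_edges n msg"
    and e: "exec bob (bob_input n p q bs msg) t s"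
  obtains m A \<kappa> where "load_edges ''out'' s = map (\<lambda>v. (v, m v - 1)) (filter (\<lambda>v. Suc v < m v) [0..<n])"
    "mate_on {..<n} (edge_rel (set (bs @ msg))) m"
    "barrier {..<n} (edge_rel (set (bs @ msg))) (card {v \<in> {..<n}. m v = 0}) A \<kappa>"
proof -
  have es: "proper_edges n (bs @ msg)" using valid_proper[OF vB] msg by (auto simp: proper_edges_set)
  obtain s' m A \<kappa> where *: "runs bob (bob_input n p q bs msg) (W ^ 70) s'"
    "load_edges ''out'' s' = map (\<lambda>v. (v, m v - 1)) (filter (\<lambda>v. Suc v < m v) [0..<n])"
    "mate_on {..<n} (edge_rel (set (bs @ msg))) m"
    "barrier {..<n} (edge_rel (set (bs @ msg))) (card {v \<in> {..<n}. m v = 0}) A \<kappa>"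
    by (rule bob_runs[OF W es])
  then have "s' = s" using exec_deterministic[OF e] by (auto simp: runs_def)
  then show ?thesis using that * by blast
qed

lemma alice_bob_poly_time: "poly_time_protocol alice bob"
  unfolding poly_time_protocol_def
\<comment> \<open>The polynomial is \<open>(z + 100) ^ 140\<close>: Bob takes at most
  \<open>W ^ 70\<close> steps, and \<open>W\<close> has to bound \<open>n * n\<close>, so it is the
  square of \<open>z + 100\<close>.\<close>
proof (rule exI[of _ "[:100, 1:] ^ 140"], intro allI impI)
  let ?T = "[:100, 1:] ^ 140 :: nat poly"
  fix n p q as bs EA EB assume vA: "valid_input n p q as EA" and vB: "valid_input n p q bs EB"
  have T: "poly ?T z = (z + 100) ^ 140" for z by (simp add: poly_power add.commute)
  have pow: "((z + 100) ^ 2) ^ k \<le> poly ?T z" if "k \<le> 70" for z k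
    unfolding T power_mult[symmetric] using that by (intro power_increasing) auto
  have big: "100 \<le> (z + 100) ^ 2 \<and> y \<le> (z + 100) ^ 2" if "y \<le> z * z + 2 * z" for y z :: nat
    using that by (simp add: power2_eq_square algebra_simps)
  let ?a = "input_size n p q (length as)"
  let ?WA = "(?a + 100)\<^sup>2"
  have sA: "n \<le> ?a" "length as \<le> ?a" by (simp_all add: input_size_def)
  have p: "0 < p" using vA by (simp add: valid_input_def)
  obtain s I where s: "runs alice (alice_input n p q as) (?WA ^ 12) s"
    "load_edges ''out'' s = map ((!) as) (filter (\<lambda>j. j \<in> I) [0..<length as])" "I \<subseteq> {..<length as}"
    by (rule alice_runs[of ?WA n as p q])
      (use big[of 100 ?a] big[of "2 * n" ?a] big[of "length as" ?a] sA valid_proper[OF vA] p in auto)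
  let ?msg = "load_edges ''out'' s"
  obtain tA where tA: "exec alice (alice_input n p q as) tA s" "tA \<le> ?WA ^ 12" using s(1) by (auto simp: runs_def)
  let ?b = "input_size n p q (length bs + length ?msg)"
  let ?WB = "(?b + 100)\<^sup>2"
  have sB: "n \<le> ?b" "length bs + length ?msg \<le> ?b" by (simp_all add: input_size_def)
  have nn: "n * n \<le> ?b * ?b" using sB by (intro mult_mono) auto
  have "proper_edges n ?msg"
    using valid_proper[OF vA] message_edges(3)[OF s(3) s(2)] by (auto simp: proper_edges_set)
  then have "proper_edges n (bs @ ?msg)" using valid_proper[OF vB] by (auto simp: proper_edges_set)
  then obtain s' where s': "runs bob (bob_input n p q bs ?msg) (?WB ^ 70) s'"
    by (rule bob_runs[of ?WB n bs ?msg p q, rotated 3])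
      (use big[of "n * n" ?b] big[of "length bs + length ?msg" ?b] sB nn in auto)
  obtain tB where tB: "exec bob (bob_input n p q bs ?msg) tB s'" "tB \<le> ?WB ^ 70" using s' by (auto simp: runs_def)
  have "protocol_run alice bob n p q as bs tA ?msg tB (load_edges ''out'' s')"
    using tA tB unfolding protocol_run_def by blast
  moreover have "tA \<le> poly ?T ?a" by (rule le_trans[OF tA(2) pow]) simp
  moreover have "tB \<le> poly ?T ?b" by (rule le_trans[OF tB(2) pow]) simp
  ultimately show "\<exists>tA msg tB out. protocol_run alice bob n p q as bs tA msg tB out \<and>
      tA \<le> poly ?T (input_size n p q (length as)) \<and> tB \<le> poly ?T (input_size n p q (length bs + length msg))"
    by blast
qed

lemma fraction_bounds:
  fixes \<epsilon> :: real
  assumes "0 < \<epsilon>" "\<epsilon> / 2 \<le> real p / real q" "real p / real q \<le> \<epsilon>" "0 < p" "0 < q"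
  shows "1 / \<epsilon> \<le> real q / real p" "real q / real p \<le> 2 / \<epsilon>"
  using assms by (simp_all add: field_simps)

text \<open>Degrees in the subgraph are at most \<beta>, which allows at most
  \<open>n * (k + 32)\<close> edges, and
  \<open>k \<le> 3 * q / p + 1 \<le> 6 / \<epsilon> + 1\<close>. This is O(n/\<epsilon>) once
  \<epsilon> is replaced by \<open>min \<epsilon> (1/2)\<close>, and is then weakened to the claimed
  bound.\<close>

lemma alice_bob_communication:
  "communication_bound alice bob (\<lambda>n \<epsilon>. 23 * (real n * ln (1 / min \<epsilon> (1 / 2)) / (min \<epsilon> (1 / 2))\<^sup>2))"
  unfolding communication_bound_def
proof (intro allI impI)
  fix \<epsilon> :: real and n p q as bs EA EB tA msg tB out
  assume eps: "0 < \<epsilon>" "\<epsilon> / 2 \<le> real p / real q" "real p / real q \<le> \<epsilon>"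
    and vA: "valid_input n p q as EA" and vB: "valid_input n p q bs EB"
    and run: "protocol_run alice bob n p q as bs tA msg tB out"
  have pq: "0 < p" "0 < q" using vA by (auto simp: valid_input_def)
  obtain s where s: "exec alice (alice_input n p q as) tA s" "msg = load_edges ''out'' s"
    using run by (auto simp: protocol_run_def)
  obtain I k where I: "load_edges ''out'' s = map ((!) as) (filter (\<lambda>j. j \<in> I) [0..<length as])"
    "I \<subseteq> {..<length as}" "\<And>j. j < length as \<Longrightarrow> edge_constrained (k + 32) as I j" "k * p < 3 * q + p"
    by (rule alice_message[OF vA s(1)]) blast
  note me = message_edges[OF I(2), of msg, unfolded s(2), OF I(1)]
  have "edge_set (load_edges ''out'' s) \<subseteq> EA"
    using me(3) vA by (auto simp: valid_input_def edge_list_of_def edge_set_def)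
  then have sg: "simple_graph n (edge_set msg)" using vA s(2) by (auto simp: valid_input_def simple_graph_def)
  have "2 * card I = (\<Sum>v<n. deg as I v)" using handshake[OF I(2) valid_proper[OF vA]] by simp
  also have "\<dots> \<le> (\<Sum>v<n. k + 32)" using degree_le_beta[OF I(2,3)] by (intro sum_mono) auto
  finally have "2 * card I \<le> n * (k + 32)" by simp
  then have "real (2 * card I) \<le> real (n * (k + 32))" by (rule of_nat_mono)
  then have c: "real (card I) \<le> real n * (real k + 32)" by simp
  define e where "e = min \<epsilon> (1/2)"
  have e: "0 < e" "e \<le> 1/2" "e \<le> \<epsilon>" using eps by (auto simp: e_def)
  have "real (k * p) \<le> real (3 * q + p)" using I(4) by (intro of_nat_mono) simp
  then have "real k \<le> 3 * (real q / real p) + 1" using pq by (simp add: field_simps)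
  also have "\<dots> \<le> 3 * (2 / \<epsilon>) + 1" using fraction_bounds(2)[OF eps pq] by simp
  also have "\<dots> \<le> 6 / e + 1" using e eps by (simp add: frac_le)
  finally have k: "real k + 32 \<le> 6 / e + 33" by simp
  \<comment> \<open>For \<open>e \<le> 1/2\<close> the 33 is at most \<open>(33/2) / e\<close>, and
    6 + 33/2 is rounded up to 23. A further factor \<open>1 / e \<ge> 2\<close> gives the square;
    the remaining 1/2 is a lower bound for \<open>ln 2\<close>, hence for
    \<open>ln (1 / e)\<close>.\<close>
  have "6 / e + 33 \<le> 23 * (1/2) / e\<^sup>2"
  proof -
    have "33 \<le> 33 / 2 / e" using e by (simp add: field_simps)
    then have "6 / e + 33 \<le> 23 / e" using e by (simp add: field_simps)
    also have "\<dots> \<le> 23 * (1/2) / e\<^sup>2" using e by (simp add: field_simps power2_eq_square)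
    finally show ?thesis .
  qed
  also have "\<dots> \<le> 23 * ln (1 / e) / e\<^sup>2"
  proof -
    have "(1::real) / 2 \<le> ln 2" using ln_le_minus_one[of "1/2"] by (simp add: ln_div)
    also have "ln 2 \<le> ln (1 / e)" using e by (subst ln_le_cancel_iff) (auto simp: field_simps)
    finally show ?thesis using e by (intro divide_right_mono mult_left_mono) auto
  qed
  finally have "real k + 32 \<le> 23 * ln (1 / e) / e\<^sup>2" using k by linarith
  then have "real n * (real k + 32) \<le> real n * (23 * ln (1 / e) / e\<^sup>2)" by (intro mult_left_mono) auto
  also have "\<dots> = 23 * (real n * ln (1 / e) / e\<^sup>2)" by simp
  finally have "real (length msg) \<le> 23 * (real n * ln (1 / e) / e\<^sup>2)" using c me(2) s(2) by simp
  then show "simple_graph n (edge_set msg) \<and>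
      real (length msg) \<le> 23 * (real n * ln (1 / min \<epsilon> (1 / 2)) / (min \<epsilon> (1 / 2))\<^sup>2)"
    using sg by (simp add: e_def)
qed

text \<open>If \<open>k * p\<close> has reached \<open>3 * q\<close>, then \<beta> is large enough
  for \<open>edcs_barrier_bound\<close> to give the ratio. Otherwise the cut-off has made \<beta> so
  large that Alice sends her whole graph, and Bob's matching is maximum by duality.\<close>

lemma alice_bob_approximates: "approximates_max_matching alice bob (\<lambda>\<epsilon>. 3 / 2 + \<epsilon>)"
  unfolding approximates_max_matching_def
proof (intro allI impI)
  fix \<epsilon> :: real and n p q as bs EA EB tA msg tB out
  assume eps: "0 < \<epsilon>" "\<epsilon> / 2 \<le> real p / real q" "real p / real q \<le> \<epsilon>"
    and vA: "valid_input n p q as EA" and vB: "valid_input n p q bs EB"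
    and run: "protocol_run alice bob n p q as bs tA msg tB out"
  have pq: "0 < p" "0 < q" using vA by (auto simp: valid_input_def)
  have EA: "edge_set as = EA" "distinct (map (\<lambda>(u, v). {u, v}) as)" "simple_graph n EA"
    and EB: "edge_set bs = EB" "simple_graph n EB"
    using vA vB by (auto simp: valid_input_def edge_list_of_def)
  have pas: "proper_edges n as" by (rule valid_proper[OF vA])
  obtain s where s: "exec alice (alice_input n p q as) tA s" "msg = load_edges ''out'' s"
    using run by (auto simp: protocol_run_def)
  obtain s' where s': "exec bob (bob_input n p q bs msg) tB s'" "out = load_edges ''out'' s'"
    using run by (auto simp: protocol_run_def)
  obtain I k where I: "load_edges ''out'' s = map ((!) as) (filter (\<lambda>j. j \<in> I) [0..<length as])"
    "I \<subseteq> {..<length as}" "\<And>j. j < length as \<Longrightarrow> edge_constrained (k + 32) as I j"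
    "3 * q \<le> k * p \<or> k = 2 * n"
    by (rule alice_message[OF vA s(1)]) blast
  note me = message_edges[OF I(2), of msg, unfolded s(2), OF I(1)]
  have pmsg: "proper_edges n msg" using pas me(3) s(2) by (auto simp: proper_edges_set)
  define H where "H = nth_edge as ` I"
  have Hm: "edge_set msg = H" using me(1) s(2) by (simp add: H_def)
  have HA: "H \<subseteq> EA" using EA(1) I(2) unfolding H_def edge_set_nth by auto
  let ?W = "n * n + length bs + length msg + 100"
  obtain m A \<kappa> where m: "load_edges ''out'' s' = map (\<lambda>v. (v, m v - 1)) (filter (\<lambda>v. Suc v < m v) [0..<n])"
    "mate_on {..<n} (edge_rel (set (bs @ msg))) m"
    "barrier {..<n} (edge_rel (set (bs @ msg))) (card {v \<in> {..<n}. m v = 0}) A \<kappa>"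
    by (rule bob_exec[of ?W, OF _ _ _ vB pmsg s'(1)]) auto
  note mo = mate_output[OF m(2), folded m(1), folded s'(2)]
  have Eu: "edge_set (bs @ msg) = H \<union> EB" by (auto simp: edge_set_append EB Hm)
  have er: "edge_rel (set (bs @ msg)) = (\<lambda>x y. {x, y} \<in> H \<union> EB)"
    by (intro ext) (simp only: edge_rel_edge_set Eu)
  let ?f = "card {v \<in> {..<n}. m v = 0}"
  have sg: "EA \<union> EB \<subseteq> {{u, v} | u v. u < n \<and> v < n \<and> u \<noteq> v}" using EA EB by (auto simp: simple_graph_def)
  obtain Mx where Mx: "matching (EA \<union> EB) Mx" "card Mx = max_matching_size (EA \<union> EB)"
    by (rule max_matching_exists[OF sg])
  obtain m' where m': "mate_on {..<n} (\<lambda>x y. {x, y} \<in> EA \<union> EB) m'" "card {v \<in> {..<n}. m' v = 0} + 2 * card Mx = n"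
    by (rule matching_mate[OF sg Mx(1)])
  let ?\<mu> = "real (card Mx)" and ?\<nu> = "real (card (edge_set out))"
  have "?\<nu> \<ge> ?\<mu> / (3 / 2 + \<epsilon>)"
  proof (cases "3 * q \<le> k * p")
    case True
    let ?\<beta> = "k + 32"
    have dH: "deg as I v = card {e \<in> H. v \<in> e}" for v unfolding H_def by (rule deg_card[OF EA(2) I(2)])
    have "3 * (real n - real ?f) \<ge> (real n - real (card {x \<in> {..<n}. m' x = 0})) * (2 - 4 / real ?\<beta>)"
    proof (rule edcs_barrier_bound[where H = H and EA = EA and EB = EB and d = "deg as I" and A = A and \<kappa> = \<kappa>])
      fix u v assume "{u, v} \<in> H"
      then obtain j where j: "j \<in> I" "{u, v} = nth_edge as j" by (auto simp: H_def)
      then have "edge_constrained ?\<beta> as I j" using I by auto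
      then show "deg as I u + deg as I v \<le> ?\<beta>"
        using j by (auto simp: edge_constrained_def nth_edge_def doubleton_eq_iff)
    next
      fix u v assume uv: "{u, v} \<in> EA - H"
      then obtain j where j: "j < length as" "{u, v} = nth_edge as j" using EA(1) by (auto simp: edge_set_nth)
      then have "j \<notin> I" using uv by (auto simp: H_def)
      then show "?\<beta> \<le> deg as I u + deg as I v + 1"
        using I(3)[OF j(1)] j by (auto simp: edge_constrained_def nth_edge_def doubleton_eq_iff)
    qed (use EA HA dH m(3) m'(1) er in auto)
    moreover have "real n - real ?f = 2 * ?\<nu>" using mo(3) by linarith
    moreover have "real n - real (card {x \<in> {..<n}. m' x = 0}) = 2 * ?\<mu>" using m'(2) by linarith
    ultimately have "2 * ?\<mu> * (2 - 4 / real ?\<beta>) \<le> 3 * (2 * ?\<nu>)" by (simp only:)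
    moreover have "a * (y / 3) \<le> c" if "2 * a * y \<le> 3 * (2 * c)" for a y c :: real using that by simp
    ultimately have b: "?\<nu> \<ge> ?\<mu> * ((2 - 4 / real ?\<beta>) / 3)" by blast
    have "real (3 * q) \<le> real (k * p)" using True by (rule of_nat_mono)
    then have "3 * (real q / real p) \<le> real k" using pq by (simp add: field_simps)
    \<comment> \<open>The number \<open>3 / \<epsilon> + 2\<close> is the value of \<beta> at which
      \<open>(2 - 4 / \<beta>) / 3\<close> equals \<open>1 / (3 / 2 + \<epsilon>)\<close>; hence the
      factor 3 in \<open>choose_beta\<close>.\<close>
    then have "3 / \<epsilon> + 2 \<le> real ?\<beta>" using fraction_bounds(1)[OF eps pq] by simp
    moreover have "0 < 3 / \<epsilon> + 2" using eps by (simp add: add_pos_pos)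
    ultimately have "4 / real ?\<beta> \<le> 4 / (3 / \<epsilon> + 2)" by (intro divide_left_mono mult_pos_pos) auto
    also have "\<dots> = 2 - 3 * (1 / (3 / 2 + \<epsilon>))" using eps by (simp add: field_simps)
    finally have "4 / real ?\<beta> \<le> 2 - 3 * (1 / (3 / 2 + \<epsilon>))" .
    moreover have "c \<le> (2 - y) / 3" if "y \<le> 2 - 3 * c" for c y :: real using that by simp
    ultimately have "1 / (3 / 2 + \<epsilon>) \<le> (2 - 4 / real ?\<beta>) / 3" by blast
    then have "?\<mu> * (1 / (3 / 2 + \<epsilon>)) \<le> ?\<mu> * ((2 - 4 / real ?\<beta>) / 3)" by (intro mult_left_mono) auto
    from order_trans[OF this b] show ?thesis unfolding times_divide_eq_right mult_1_right .
  next
    case False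
    then have k: "k = 2 * n" using I(4) by simp
    \<comment> \<open>Degree sums are at most \<open>2 * n\<close>, which is below
      \<open>\<beta> - 1 = 2 * n + 31\<close>, so an edge outside the subgraph would violate its
      constraint.\<close>
    have "j \<in> I" if "j < length as" for j
      using I(3)[OF that] deg_le[OF EA(2) pas I(2), of "fst (as ! j)"] deg_le[OF EA(2) pas I(2), of "snd (as ! j)"]
      by (auto simp: edge_constrained_def k)
    then have "H = EA" using HA EA(1) by (auto simp: H_def edge_set_nth)
    then have "barrier {..<n} (\<lambda>x y. {x, y} \<in> EA \<union> EB) ?f A \<kappa>" using m(3) er by simp
    from barrier_optimal(1)[OF _ this m'(1)] have "?f \<le> card {x \<in> {..<n}. m' x = 0}" by simp
    then have "?\<mu> \<le> ?\<nu>" using mo(3) m'(2) by linarith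
    moreover have "?\<mu> / (3 / 2 + \<epsilon>) \<le> ?\<mu> / 1" using eps by (intro divide_left_mono) auto
    ultimately show ?thesis by simp
  qed
  moreover have "matching (EA \<union> EB) (edge_set out)"
    using mo(2) HA unfolding Eu matching_def by blast
  ultimately show "\<exists>M. edge_list_of out M \<and> matching (EA \<union> EB) M \<and>
      real (max_matching_size (EA \<union> EB)) / (3 / 2 + \<epsilon>) \<le> real (card M)"
    using mo(1) Mx(2) by auto
qed

theorem theorem4p1:
  "\<exists>(A::com) (B::com).
     poly_time_protocol A B \<and>
     approximates_max_matching A B (\<lambda>\<epsilon>. 3 / 2 + \<epsilon>) \<and>
     (\<exists>C::real. communication_bound A B
        (\<lambda>n \<epsilon>. C * (real n * ln (1 / min \<epsilon> (1 / 2)) / (min \<epsilon> (1 / 2))\<^sup>2)))"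
  using alice_bob_poly_time alice_bob_approximates alice_bob_communication by blast

end
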